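(* Let $\phi\in L^{2}(G)$ and let $0<C\le D<\infty$. The sequence $\{T_{h}\phi:h\in H\}$ in $L^{2}(G)$ is a frame sequence with frame bounds $C$ and $D$ if and only if $$C\le[\hat\phi,\hat\phi](\omega)\le D\quad\text{for a.e. }\omega\in U^{*}\setminus\mathcal N_{\phi},$$ where $\mathcal N_{\phi}=\{\omega\in U^{*}:[\hat\phi,\hat\phi](\omega)=0\}$.
   Context: Let $p\ge 2$ be an integer. The Vilenkin group $G$ is the set of sequences $x=(x_j)_{j\in\mathbb Z}$ with $x_j\in\{0,\dots,p-1\}$ for which there is $k=k(x)$ with $x_j=0$ for all $j<k$; the operation $\oplus$ is coordinatewise addition modulo $p$, $\ominus$ is the inverse operation, and the topology is generated by the neighbourhoods of zero $U_l=\{x\in G:x_j=0\text{ for }j\le l\}$, $l\in\mathbb Z$. Put $U=U_0$; the Haar measure $\mu$ is normalized by $\mu(U)=1$. The dual group $G^{*}$ consists of sequences $\omega=(\omega_j)$ of the same form, with analogous operations, neighbourhoods $U_l^{*}$, set $U^{*}=U_0^{*}$, and Haar measure $\mu^{*}$ (written $d\omega$) with $\mu^{*}(U^{*})=1$; the pairing is $\chi(x,\omega)=\exp\big(\frac{2\pi i}{p}\sum_{j\in\mathbb Z}x_j\omega_{1-j}\big)$. Let $H=\{x\in G:x_j=0\text{ for }j>0\}$ (a countable discrete subgroup), whose annihilator is $H^{\perp}=\{\omega\in G^{*}:\omega_j=0\text{ for }j>0\}$. For $h\in H$, $T_hf(x)=f(x\ominus h)$. The Fourier transform is $\hat f(\omega)=\int_G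 f(x)\overline{\chi(x,\omega)}\,d\mu(x)$, extended to a unitary map $L^2(G)\to L^2(G^{*})$. For $f,g\in L^2(G)$, the $C$-bracket of $\hat f,\hat g$ is $[\hat f,\hat g](\omega)=\sum_{h\in H^{\perp}}\hat f(\omega\oplus h)\overline{\hat g(\omega\oplus h)}$. A sequence $\{f_j\}_{j\in J}$ ($J$ countable) in a Hilbert space is a frame sequence with frame bounds $C$ and $D$, where $0<C\le D<\infty$, if the synthesis operator $Tc=\sum_j c_jf_j$ is well defined on $\ell^2(J)$ (the series converges in the Hilbert space for every $c\in\ell^2(J)$) and $C\|c\|^2\le\|Tc\|^2\le D\|c\|^2$ for all $c\in(\mathrm{Ker}\,T)^{\perp}$. Here $J=H$, which is identified with $\mathbb N_0$ by the bijection $h\mapsto\sum_j h_jp^{-j}$. *)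

theory Defs
  imports "HOL-Analysis.Analysis"
begin

section \<open>The Vilenkin group\<close>

text \<open>
  Digits are represented as integers in \<open>{0..<p}\<close>. The dual group consists of sequences of the
  same form with the same operations and neighbourhoods, so \<open>vil\<close>, \<open>vil_add\<close>, \<open>vil_nbhd\<close>,
  \<open>vil_topology\<close> and \<open>haar_measure\<close> serve for both groups.
\<close>

type_synonym digits = "int \<Rightarrow> int"

definition vil :: "int \<Rightarrow> digits set" where
  "vil p = {x. (\<forall>j. 0 \<le> x j \<and> x j < p) \<and> (\<exists>k. \<forall>j<k. x j = 0)}"

definition vil_add :: "int \<Rightarrow> digits \<Rightarrow> digits \<Rightarrow> digits" where
  "vil_add p x y = (\<lambda>j. (x j + y j) mod p)"

definition vil_diff :: "int \<Rightarrow> digits \<Rightarrow> digits \<Rightarrow> digits" where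
  "vil_diff p x y = (\<lambda>j. (x j - y j) mod p)"

definition vil_nbhd :: "int \<Rightarrow> int \<Rightarrow> digits set" where
  "vil_nbhd p l = {x \<in> vil p. \<forall>j\<le>l. x j = 0}"

text \<open>The sets \<open>U\<^sub>l\<close> are neighbourhoods of zero only; the group topology is generated by their
  translates.\<close>

definition vil_topology :: "int \<Rightarrow> digits topology" where
  "vil_topology p = topology_generated_by {vil_add p a ` vil_nbhd p l | a l. a \<in> vil p}"

text \<open>The group is second countable and locally compact, so a translation-invariant Borel measure
  that is finite on compact sets is automatically regular, and the normalization determines it
  uniquely.\<close>

definition haar_measure :: "int \<Rightarrow> digits measure \<Rightarrow> bool" where
  "haar_measure p \<mu> \<longleftrightarrow>
     space \<mu> = vil p \<and>
     sets \<mu> = sigma_sets (vil p) {S. openin (vil_topology p) S} \<and>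
     (\<forall>K. compactin (vil_topology p) K \<longrightarrow> emeasure \<mu> K < \<infinity>) \<and>
     (\<forall>a \<in> vil p. \<forall>A \<in> sets \<mu>. emeasure \<mu> (vil_add p a ` A) = emeasure \<mu> A) \<and>
     emeasure \<mu> (vil_nbhd p 0) = 1"

text \<open>For \<open>x\<close>, \<open>\<omega>\<close> in \<open>vil p\<close> only finitely many terms of the sum over all integers are nonzero.\<close>

definition vil_char :: "int \<Rightarrow> digits \<Rightarrow> digits \<Rightarrow> complex" where
  "vil_char p x \<omega> =
     exp (2 * of_real pi * \<i> / of_int p * of_int (\<Sum>j | x j * \<omega> (1 - j) \<noteq> 0. x j * \<omega> (1 - j)))"

definition vil_H :: "int \<Rightarrow> digits set" where
  "vil_H p = {x \<in> vil p. \<forall>j>0. x j = 0}"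

definition vil_H_perp :: "int \<Rightarrow> digits set" where
  "vil_H_perp p = {\<omega> \<in> vil p. \<forall>j>0. \<omega> j = 0}"

text \<open>The bijection between \<open>H\<close> and the natural numbers sending \<open>h\<close> to the sum of \<open>h\<^sub>j p\<^bsup>-j\<^esup>\<close>; all
  nonzero digits of \<open>h\<close> have index \<open>j \<le> 0\<close>.\<close>

definition vil_H_index :: "int \<Rightarrow> digits \<Rightarrow> nat" where
  "vil_H_index p h = nat (\<Sum>j | h j \<noteq> 0. h j * p ^ nat (- j))"

definition vil_H_enum :: "int \<Rightarrow> nat \<Rightarrow> digits" where
  "vil_H_enum p = inv_into (vil_H p) (vil_H_index p)"

definition vil_translate :: "int \<Rightarrow> digits \<Rightarrow> (digits \<Rightarrow> complex) \<Rightarrow> digits \<Rightarrow> complex" where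
  "vil_translate p h f = (\<lambda>x. f (vil_diff p x h))"


section \<open>Square-integrable functions\<close>

text \<open>Elements of \<open>L\<^sup>2\<close> are represented by functions; two functions represent the same element iff
  the norm of their difference is zero.\<close>

definition L2 :: "'a measure \<Rightarrow> ('a \<Rightarrow> complex) set" where
  "L2 M = {f \<in> borel_measurable M. integrable M (\<lambda>x. (cmod (f x))\<^sup>2)}"

definition L2_norm :: "'a measure \<Rightarrow> ('a \<Rightarrow> complex) \<Rightarrow> real" where
  "L2_norm M f = sqrt (LINT x|M. (cmod (f x))\<^sup>2)"

definition L2_converges :: "'a measure \<Rightarrow> (nat \<Rightarrow> 'a \<Rightarrow> complex) \<Rightarrow> ('a \<Rightarrow> complex) \<Rightarrow> bool" where
  "L2_converges M F f \<longleftrightarrow>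
     (\<forall>n. F n \<in> L2 M) \<and> f \<in> L2 M \<and> (\<lambda>n. L2_norm M (\<lambda>x. F n x - f x)) \<longlonglongrightarrow> 0"


section \<open>Fourier transform and bracket\<close>

definition vil_fourier_L1 ::
    "int \<Rightarrow> digits measure \<Rightarrow> (digits \<Rightarrow> complex) \<Rightarrow> digits \<Rightarrow> complex" where
  "vil_fourier_L1 p \<mu> f \<omega> = (LINT x|\<mu>. f x * cnj (vil_char p x \<omega>))"

text \<open>The continuous extension from \<open>L\<^sup>1 \<inter> L\<^sup>2\<close> to \<open>L\<^sup>2\<close>. The result is determined up to equality
  almost everywhere with respect to \<open>\<nu>\<close>, the Haar measure of the dual group; the choice operator
  picks one representative.\<close>

definition vil_fourier ::
    "int \<Rightarrow> digits measure \<Rightarrow> digits measure \<Rightarrow> (digits \<Rightarrow> complex) \<Rightarrow> digits \<Rightarrow> complex" where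
  "vil_fourier p \<mu> \<nu> f =
     (SOME g. \<exists>F. (\<forall>n. integrable \<mu> (F n)) \<and> L2_converges \<mu> F f \<and>
                  L2_converges \<nu> (\<lambda>n. vil_fourier_L1 p \<mu> (F n)) g)"

text \<open>For \<open>L\<^sup>2\<close> functions the series converges absolutely for almost every \<open>\<omega>\<close>; on the remaining
  null set \<open>infsum\<close> returns \<open>0\<close>.\<close>

definition vil_bracket ::
    "int \<Rightarrow> (digits \<Rightarrow> complex) \<Rightarrow> (digits \<Rightarrow> complex) \<Rightarrow> digits \<Rightarrow> complex" where
  "vil_bracket p f g \<omega> = (\<Sum>\<^sub>\<infinity>h\<in>vil_H_perp p. f (vil_add p \<omega> h) * cnj (g (vil_add p \<omega> h)))"


section \<open>Frame sequences in the Hilbert space of square-integrable functions\<close>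

definition ell2 :: "(nat \<Rightarrow> complex) set" where
  "ell2 = {c. summable (\<lambda>n. (cmod (c n))\<^sup>2)}"

definition ell2_inner :: "(nat \<Rightarrow> complex) \<Rightarrow> (nat \<Rightarrow> complex) \<Rightarrow> complex" where
  "ell2_inner c d = (\<Sum>n. c n * cnj (d n))"

definition ell2_norm :: "(nat \<Rightarrow> complex) \<Rightarrow> real" where
  "ell2_norm c = sqrt (\<Sum>n. (cmod (c n))\<^sup>2)"

definition L2_sums :: "'a measure \<Rightarrow> (nat \<Rightarrow> 'a \<Rightarrow> complex) \<Rightarrow> ('a \<Rightarrow> complex) \<Rightarrow> bool" where
  "L2_sums M u g \<longleftrightarrow> L2_converges M (\<lambda>N x. \<Sum>n<N. u n x) g"

text \<open>A representative of the sum, which is unique up to equality almost everywhere.\<close>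

definition synthesis ::
    "'a measure \<Rightarrow> (nat \<Rightarrow> 'a \<Rightarrow> complex) \<Rightarrow> (nat \<Rightarrow> complex) \<Rightarrow> 'a \<Rightarrow> complex" where
  "synthesis M f c = (SOME g. L2_sums M (\<lambda>n x. c n * f n x) g)"

definition synthesis_ker :: "'a measure \<Rightarrow> (nat \<Rightarrow> 'a \<Rightarrow> complex) \<Rightarrow> (nat \<Rightarrow> complex) set" where
  "synthesis_ker M f = {c \<in> ell2. L2_norm M (synthesis M f c) = 0}"

definition ell2_perp :: "(nat \<Rightarrow> complex) set \<Rightarrow> (nat \<Rightarrow> complex) set" where
  "ell2_perp K = {c \<in> ell2. \<forall>d \<in> K. ell2_inner c d = 0}"

definition frame_sequence ::
    "'a measure \<Rightarrow> (nat \<Rightarrow> 'a \<Rightarrow> complex) \<Rightarrow> real \<Rightarrow> real \<Rightarrow> bool" where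
  "frame_sequence M f C D \<longleftrightarrow>
     0 < C \<and> C \<le> D \<and> (\<forall>n. f n \<in> L2 M) \<and>
     (\<forall>c \<in> ell2. \<exists>g. L2_sums M (\<lambda>n x. c n * f n x) g) \<and>
     (\<forall>c \<in> ell2_perp (synthesis_ker M f).
        C * (ell2_norm c)\<^sup>2 \<le> (L2_norm M (synthesis M f c))\<^sup>2 \<and>
        (L2_norm M (synthesis M f c))\<^sup>2 \<le> D * (ell2_norm c)\<^sup>2)"

definition bracket_null_set :: "int \<Rightarrow> (digits \<Rightarrow> complex) \<Rightarrow> digits set" where
  "bracket_null_set p \<psi> = {\<omega> \<in> vil_nbhd p 0. vil_bracket p \<psi> \<psi> \<omega> = 0}"

end

theory Submission
  imports Defs
begin

text \<open>
  The transform turns translation by \<open>h \<in> H\<close> into multiplication by the character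
  \<open>\<omega> \<mapsto> cnj (\<chi>(h, \<omega>))\<close>, which is invariant under \<open>H\<^sup>\<bottom>\<close>. Since the translates of \<open>U\<^sup>*\<close> by \<open>H\<^sup>\<bottom>\<close> tile the
  dual group, Plancherel's theorem gives for finite sums
  \<open>\<parallel>\<Sum>n. c\<^sub>n T\<^sub>h\<^sub>n \<phi>\<parallel>\<^sup>2 = \<integral>\<^sub>U\<^sub>* w \<bar>\<Sum>n. c\<^sub>n e\<^sub>n\<bar>\<^sup>2\<close>,
  where \<open>w\<close> is the bracket of the transform of \<open>\<phi>\<close> with itself and the \<open>e\<^sub>n\<close> are the characters above
  restricted to \<open>U\<^sup>*\<close> (\<open>translates_isometry\<close>). The \<open>e\<^sub>n\<close> form an orthonormal basis of \<open>L\<^sup>2(U\<^sup>*)\<close>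
  (\<open>H_char_orthonormal\<close>, \<open>expands_surj\<close>), so \<open>c \<in> \<ell>\<^sup>2\<close> corresponds isometrically to
  \<open>m = \<Sum>n. c\<^sub>n e\<^sub>n\<close>. Whenever the series \<open>T c\<close> converges, \<open>\<parallel>T c\<parallel>\<^sup>2 = \<integral> w \<bar>m\<bar>\<^sup>2\<close> (\<open>synthesis_isometry\<close>): an
  almost everywhere convergent subsequence identifies the limit, so this holds also for unbounded
  \<open>w\<close>.

  Consequently the kernel of \<open>T\<close> consists of the \<open>c\<close> for which \<open>m\<close> vanishes off \<open>{w = 0}\<close>, and its
  orthogonal complement of those for which \<open>m\<close> vanishes on \<open>{w = 0}\<close>. If \<open>C \<le> w \<le> D\<close> almost
  everywhere off \<open>{w = 0}\<close>, the upper bound makes all the series converge and integration of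
  \<open>C \<bar>m\<bar>\<^sup>2 \<le> w \<bar>m\<bar>\<^sup>2 \<le> D \<bar>m\<bar>\<^sup>2\<close> gives the frame inequalities. Conversely, the frame inequalities for
  \<open>m = 1\<^sub>E\<close>, with \<open>E\<close> one of the sets \<open>{0 < w < C}\<close> and \<open>{w > D}\<close>, show that \<open>E\<close> is a null set.

  Plancherel's theorem is proved for linear combinations of indicators of cosets of the subgroups
  \<open>U\<^sub>l\<close>, whose transforms are multiples of characters cut down to subgroups, by comparing Gram
  matrices, and extended to
  \<open>L\<^sup>1 \<inter> L\<^sup>2\<close> by approximation in both norms at once. As the group and its dual are given by the same
  sequences, the theorem also applies in the opposite direction, and there it yields the
  completeness of the \<open>e\<^sub>n\<close>: the transform of a function supported in \<open>U\<^sup>*\<close> is constant on the cosets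
  of \<open>U\<close>.
\<close>

section \<open>Square-integrable functions\<close>

lemma L2_measurable: "f \<in> L2 M \<Longrightarrow> f \<in> borel_measurable M"
  by (simp add: L2_def)

lemma L2_integrable: "f \<in> L2 M \<Longrightarrow> integrable M (\<lambda>x. (cmod (f x))\<^sup>2)"
  by (simp add: L2_def)

lemma L2I_bound:
  assumes [measurable]: "f \<in> borel_measurable M" and g: "integrable M g"
    and "\<And>x. x \<in> space M \<Longrightarrow> (cmod (f x))\<^sup>2 \<le> g x"
  shows "f \<in> L2 M"
proof -
  have "integrable M (\<lambda>x. (cmod (f x))\<^sup>2)"
    by (rule Bochner_Integration.integrable_bound[OF g]) (use assms(3) in \<open>force+\<close>)
  then show ?thesis by (simp add: L2_def)
qed

lemma L2I_nn:
  assumes "f \<in> borel_measurable M" "(\<integral>\<^sup>+x. ennreal ((cmod (f x))\<^sup>2) \<partial>M) < \<infinity>"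
  shows "f \<in> L2 M"
  using assms by (auto simp: L2_def integrable_iff_bounded)

lemma L2_norm_nonneg [simp]: "0 \<le> L2_norm M f"
  by (simp add: L2_norm_def)

lemma L2_norm_power2: "(L2_norm M f)\<^sup>2 = (LINT x|M. (cmod (f x))\<^sup>2)"
  by (simp add: L2_norm_def)

lemma L2_norm_power2_nn:
  "f \<in> L2 M \<Longrightarrow> ennreal ((L2_norm M f)\<^sup>2) = (\<integral>\<^sup>+x. ennreal ((cmod (f x))\<^sup>2) \<partial>M)"
  by (simp add: L2_norm_power2 L2_integrable nn_integral_eq_integral)

lemma L2_norm_minus_commute: "L2_norm M (\<lambda>x. f x - g x) = L2_norm M (\<lambda>x. g x - f x)"
  by (simp add: L2_norm_def norm_minus_commute)

lemma square_norm_add_le: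
  fixes a b :: "'a::real_normed_vector" and t :: real
  assumes "0 < t"
  shows "(norm (a + b))\<^sup>2 \<le> (1 + t) * (norm a)\<^sup>2 + (1 + 1 / t) * (norm b)\<^sup>2"
proof -
  have "(norm (a + b))\<^sup>2 \<le> (norm a + norm b)\<^sup>2"
    by (intro power_mono norm_triangle_ineq) auto
  also have "\<dots> = (norm a)\<^sup>2 + (norm b)\<^sup>2 + 2 * (norm a * norm b)"
    by (simp add: power2_sum)
  also have "2 * (norm a * norm b) \<le> t * (norm a)\<^sup>2 + (norm b)\<^sup>2 / t"
  proof -
    have "0 \<le> (t * norm a - norm b)\<^sup>2 / t" using assms by simp
    also have "\<dots> = t * (norm a)\<^sup>2 + (norm b)\<^sup>2 / t - 2 * (norm a * norm b)"
      using assms by (simp add: power2_diff field_simps power2_eq_square)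
    finally show ?thesis by simp
  qed
  finally show ?thesis by (simp add: algebra_simps)
qed

lemma L2_scale: "f \<in> L2 M \<Longrightarrow> (\<lambda>x. c * f x) \<in> L2 M"
  by (auto simp: L2_def norm_mult power_mult_distrib)

lemma L2_norm_scale: "L2_norm M (\<lambda>x. c * f x) = cmod c * L2_norm M f"
  by (simp add: L2_norm_def norm_mult power_mult_distrib real_sqrt_mult)

lemma L2_add:
  assumes "f \<in> L2 M" "g \<in> L2 M"
  shows "(\<lambda>x. f x + g x) \<in> L2 M"
proof (rule L2I_bound)
  show "integrable M (\<lambda>x. 2 * (cmod (f x))\<^sup>2 + 2 * (cmod (g x))\<^sup>2)"
    using assms[THEN L2_integrable] by simp
  show "(cmod (f x + g x))\<^sup>2 \<le> 2 * (cmod (f x))\<^sup>2 + 2 * (cmod (g x))\<^sup>2" for x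
    using square_norm_add_le[of 1 "f x" "g x"] by simp
qed (use assms[THEN L2_measurable] in simp)

lemma L2_diff: "f \<in> L2 M \<Longrightarrow> g \<in> L2 M \<Longrightarrow> (\<lambda>x. f x - g x) \<in> L2 M"
  using L2_add[of f M "\<lambda>x. (-1) * g x"] L2_scale[of g M "-1"] by simp

lemma L2_zero: "(\<lambda>x. 0) \<in> L2 M"
  by (simp add: L2_def)

lemma L2_sum: "(\<And>i. i \<in> I \<Longrightarrow> f i \<in> L2 M) \<Longrightarrow> (\<lambda>x. \<Sum>i\<in>I. f i x) \<in> L2 M"
  by (induction I rule: infinite_finite_induct) (auto intro: L2_zero L2_add)

lemma L2_norm_cong_AE:
  assumes "AE x in M. f x = g x" "f \<in> borel_measurable M" "g \<in> borel_measurable M"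
  shows "L2_norm M f = L2_norm M g"
proof -
  have "(LINT x|M. (cmod (f x))\<^sup>2) = (LINT x|M. (cmod (g x))\<^sup>2)"
    by (rule integral_cong_AE) (use assms in \<open>auto elim: eventually_mono\<close>)
  then show ?thesis by (simp add: L2_norm_def)
qed

text \<open>Minkowski's inequality, from the pointwise bound
  \<open>\<bar>a + b\<bar>\<^sup>2 \<le> (1 + t) \<bar>a\<bar>\<^sup>2 + (1 + 1 / t) \<bar>b\<bar>\<^sup>2\<close>: after integration \<open>t\<close> is chosen as \<open>s / r\<close>,
  where \<open>r\<close> and \<open>s\<close> exceed the two norms, so that vanishing norms do no harm.\<close>

lemma L2_norm_triangle:
  assumes f: "f \<in> L2 M" and g: "g \<in> L2 M"
  shows "L2_norm M (\<lambda>x. f x + g x) \<le> L2_norm M f + L2_norm M g"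
proof -
  have main: "L2_norm M (\<lambda>x. f x + g x) \<le> r + s"
    if r: "L2_norm M f < r" and s: "L2_norm M g < s" for r s
  proof -
    have r0: "0 < r" and s0: "0 < s"
      using r s L2_norm_nonneg[of M f] L2_norm_nonneg[of M g] by linarith+
    have "(L2_norm M (\<lambda>x. f x + g x))\<^sup>2
        \<le> (LINT x|M. (1 + s / r) * (cmod (f x))\<^sup>2 + (1 + 1 / (s / r)) * (cmod (g x))\<^sup>2)"
      unfolding L2_norm_power2
    proof (intro integral_mono)
      show "(cmod (f x + g x))\<^sup>2
          \<le> (1 + s / r) * (cmod (f x))\<^sup>2 + (1 + 1 / (s / r)) * (cmod (g x))\<^sup>2" for x
        using r0 s0 by (intro square_norm_add_le) simp
    qed (use L2_integrable[OF f] L2_integrable[OF g] L2_integrable[OF L2_add[OF f g]] in simp_all)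
    also have "\<dots> = (1 + s / r) * (L2_norm M f)\<^sup>2 + (1 + r / s) * (L2_norm M g)\<^sup>2"
      using L2_integrable[OF f] L2_integrable[OF g] by (simp add: L2_norm_power2)
    also have "\<dots> \<le> (1 + s / r) * r\<^sup>2 + (1 + r / s) * s\<^sup>2"
      using r s r0 s0 by (intro add_mono mult_left_mono power_mono) auto
    also have "\<dots> = (r + s)\<^sup>2"
    proof -
      have "s / r * r\<^sup>2 = s * r" "r / s * s\<^sup>2 = r * s"
        using r0 s0 by (simp_all add: power2_eq_square)
      then show ?thesis by (simp add: distrib_right power2_sum)
    qed
    finally have "(L2_norm M (\<lambda>x. f x + g x))\<^sup>2 \<le> (r + s)\<^sup>2" .
    then show ?thesis
      by (rule power2_le_imp_le) (use r0 s0 in linarith)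
  qed
  show ?thesis
  proof (rule field_le_epsilon)
    fix e :: real assume "0 < e"
    then show "L2_norm M (\<lambda>x. f x + g x) \<le> L2_norm M f + L2_norm M g + e"
      using main[of "L2_norm M f + e / 2" "L2_norm M g + e / 2"] by simp
  qed
qed

lemma L2_norm_diff_triangle:
  assumes "f \<in> L2 M" "g \<in> L2 M" "h \<in> L2 M"
  shows "L2_norm M (\<lambda>x. f x - h x) \<le> L2_norm M (\<lambda>x. f x - g x) + L2_norm M (\<lambda>x. g x - h x)"
  using L2_norm_triangle[OF L2_diff[OF assms(1,2)] L2_diff[OF assms(2,3)]] by simp

lemma L2_norm_diff_ge:
  assumes "f \<in> L2 M" "g \<in> L2 M"
  shows "\<bar>L2_norm M f - L2_norm M g\<bar> \<le> L2_norm M (\<lambda>x. f x - g x)"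
  using L2_norm_diff_triangle[OF assms L2_zero] L2_norm_diff_triangle[OF assms(2,1) L2_zero]
  by (simp add: L2_norm_minus_commute[of M g f])

lemma L2_converges_norm:
  assumes "L2_converges M F f"
  shows "(\<lambda>n. L2_norm M (F n)) \<longlonglongrightarrow> L2_norm M f"
proof -
  have "(\<lambda>n. L2_norm M (F n) - L2_norm M f) \<longlonglongrightarrow> 0"
    by (rule Lim_null_comparison[of _ "\<lambda>n. L2_norm M (\<lambda>x. F n x - f x)"])
       (use assms L2_norm_diff_ge in \<open>auto simp: L2_converges_def intro!: always_eventually\<close>)
  then show ?thesis using LIM_zero_iff by blast
qed

definition L2_Cauchy :: "'a measure \<Rightarrow> (nat \<Rightarrow> 'a \<Rightarrow> complex) \<Rightarrow> bool" where
  "L2_Cauchy M F \<longleftrightarrow> (\<forall>n. F n \<in> L2 M) \<and>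
     (\<forall>e>0. \<exists>N. \<forall>m\<ge>N. \<forall>n\<ge>N. L2_norm M (\<lambda>x. F m x - F n x) < e)"

lemma L2_CauchyD:
  assumes "L2_Cauchy M F" "0 < e"
  obtains N where "\<And>m n. m \<ge> N \<Longrightarrow> n \<ge> N \<Longrightarrow> L2_norm M (\<lambda>x. F m x - F n x) < e"
  using assms unfolding L2_Cauchy_def by blast

lemma L2_converges_imp_Cauchy:
  assumes F: "L2_converges M F f"
  shows "L2_Cauchy M F"
  unfolding L2_Cauchy_def
proof (intro conjI allI impI)
  show L: "F n \<in> L2 M" for n using F by (simp add: L2_converges_def)
  have f: "f \<in> L2 M" and lim: "(\<lambda>n. L2_norm M (\<lambda>x. F n x - f x)) \<longlonglongrightarrow> 0"
    using F by (simp_all add: L2_converges_def)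
  fix e :: real assume "0 < e"
  then obtain N where N: "\<And>n. n \<ge> N \<Longrightarrow> L2_norm M (\<lambda>x. F n x - f x) < e / 2"
    using LIMSEQ_D[OF lim, of "e / 2"] by auto
  have "L2_norm M (\<lambda>x. F m x - F n x) < e" if "m \<ge> N" "n \<ge> N" for m n
    using L2_norm_diff_triangle[OF L f L, of m n] N[OF that(1)] N[OF that(2)]
    by (simp add: L2_norm_minus_commute[of M f])
  then show "\<exists>N. \<forall>m\<ge>N. \<forall>n\<ge>N. L2_norm M (\<lambda>x. F m x - F n x) < e" by blast
qed

text \<open>Fatou's lemma turns almost everywhere convergence of a subsequence of a Cauchy sequence into
  convergence in norm of the whole sequence.\<close>

lemma L2_Cauchy_AE_limit:
  assumes C: "L2_Cauchy M F" and r: "strict_mono r" and [measurable]: "f \<in> borel_measurable M"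
    and lim: "AE x in M. (\<lambda>k. F (r k) x) \<longlonglongrightarrow> f x"
  shows "L2_converges M F f"
proof -
  have F: "F n \<in> L2 M" for n using C by (simp add: L2_Cauchy_def)
  note [measurable] = L2_measurable[OF F]
  have key: "F n \<in> L2 M \<and> (\<lambda>x. F n x - f x) \<in> L2 M \<and> L2_norm M (\<lambda>x. F n x - f x) \<le> e"
    if e: "0 < e" and n: "n \<ge> N"
      and N: "\<And>m n. m \<ge> N \<Longrightarrow> n \<ge> N \<Longrightarrow> L2_norm M (\<lambda>x. F m x - F n x) < e" for e n N
  proof -
    have "(\<integral>\<^sup>+x. ennreal ((cmod (F n x - f x))\<^sup>2) \<partial>M)
        = (\<integral>\<^sup>+x. liminf (\<lambda>k. ennreal ((cmod (F n x - F (r k) x))\<^sup>2)) \<partial>M)"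
    proof (rule nn_integral_cong_AE)
      show "AE x in M. ennreal ((cmod (F n x - f x))\<^sup>2)
          = liminf (\<lambda>k. ennreal ((cmod (F n x - F (r k) x))\<^sup>2))"
        using lim
      proof eventually_elim
        fix x assume "(\<lambda>k. F (r k) x) \<longlonglongrightarrow> f x"
        then have "(\<lambda>k. ennreal ((cmod (F n x - F (r k) x))\<^sup>2)) \<longlonglongrightarrow> ennreal ((cmod (F n x - f x))\<^sup>2)"
          by (intro tendsto_intros)
        then show "ennreal ((cmod (F n x - f x))\<^sup>2)
            = liminf (\<lambda>k. ennreal ((cmod (F n x - F (r k) x))\<^sup>2))"
          by (intro lim_imp_Liminf[symmetric]) auto
      qed
    qed
    also have "\<dots> \<le> liminf (\<lambda>k. \<integral>\<^sup>+x. ennreal ((cmod (F n x - F (r k) x))\<^sup>2) \<partial>M)"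
      by (rule nn_integral_liminf) measurable
    also have "\<dots> = liminf (\<lambda>k. ennreal ((L2_norm M (\<lambda>x. F n x - F (r k) x))\<^sup>2))"
      by (simp add: L2_norm_power2_nn L2_diff F)
    also have "\<dots> \<le> liminf (\<lambda>k::nat. ennreal (e\<^sup>2))"
    proof (rule Liminf_mono)
      show "\<forall>\<^sub>F k in sequentially.
          ennreal ((L2_norm M (\<lambda>x. F n x - F (r k) x))\<^sup>2) \<le> ennreal (e\<^sup>2)"
        using eventually_ge_at_top[of N]
      proof eventually_elim
        fix k assume "k \<ge> N"
        then have "r k \<ge> N" using seq_suble[OF r, of k] by linarith
        then show "ennreal ((L2_norm M (\<lambda>x. F n x - F (r k) x))\<^sup>2) \<le> ennreal (e\<^sup>2)"
          using N[OF n, of "r k"] by (intro ennreal_leI power_mono) auto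
      qed
    qed
    also have "\<dots> = ennreal (e\<^sup>2)" by (simp add: Liminf_const)
    finally have le: "(\<integral>\<^sup>+x. ennreal ((cmod (F n x - f x))\<^sup>2) \<partial>M) \<le> ennreal (e\<^sup>2)" .
    have L: "(\<lambda>x. F n x - f x) \<in> L2 M"
      by (rule L2I_nn) (use le in \<open>auto simp: le_less_trans[OF _ ennreal_less_top]\<close>)
    have "(L2_norm M (\<lambda>x. F n x - f x))\<^sup>2 \<le> e\<^sup>2"
      using le L2_norm_power2_nn[OF L] e by (metis ennreal_le_iff zero_le_power2)
    then show ?thesis using L F e by (auto intro: power2_le_imp_le)
  qed
  obtain N1 where "\<And>m n. m \<ge> N1 \<Longrightarrow> n \<ge> N1 \<Longrightarrow> L2_norm M (\<lambda>x. F m x - F n x) < 1"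
    using L2_CauchyD[OF C, of 1] by auto
  from key[OF _ order_refl this] have "(\<lambda>x. F N1 x - f x) \<in> L2 M" by simp
  from L2_diff[OF F[of N1] this] have f: "f \<in> L2 M" by simp
  have "(\<lambda>n. L2_norm M (\<lambda>x. F n x - f x)) \<longlonglongrightarrow> 0"
  proof (rule LIMSEQ_I)
    fix e :: real assume "0 < e"
    then obtain N where "\<And>m n. m \<ge> N \<Longrightarrow> n \<ge> N \<Longrightarrow> L2_norm M (\<lambda>x. F m x - F n x) < e / 2"
      using L2_CauchyD[OF C, of "e / 2"] by auto
    from key[OF _ _ this] \<open>0 < e\<close>
    show "\<exists>N. \<forall>n\<ge>N. norm (L2_norm M (\<lambda>x. F n x - f x) - 0) < e"
      by (intro exI[of _ N]) force
  qed
  with F f show ?thesis by (simp add: L2_converges_def)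
qed

lemma L2_converges_AE_subseq:
  assumes "L2_converges M F f"
  obtains r where "strict_mono r" "AE x in M. (\<lambda>k. F (r k) x) \<longlonglongrightarrow> f x"
proof -
  have F: "F n \<in> L2 M" and f: "f \<in> L2 M" for n using assms by (auto simp: L2_converges_def)
  have "(\<lambda>n. (L2_norm M (\<lambda>x. F n x - f x))\<^sup>2) \<longlonglongrightarrow> 0\<^sup>2"
    using assms by (intro tendsto_power) (auto simp: L2_converges_def)
  then have lim: "(\<lambda>n. LINT x|M. (cmod (F n x - f x))\<^sup>2) \<longlonglongrightarrow> 0"
    by (simp add: L2_norm_power2)
  obtain r :: "nat \<Rightarrow> nat" where r: "strict_mono r"
    "AE x in M. (\<lambda>k. (cmod (F (r k) x - f x))\<^sup>2) \<longlonglongrightarrow> 0"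
    using tendsto_L1_AE_subseq[of M "\<lambda>n x. (cmod (F n x - f x))\<^sup>2"] lim
      L2_integrable[OF L2_diff[OF F f]] by auto
  have "AE x in M. (\<lambda>k. F (r k) x) \<longlonglongrightarrow> f x"
    using r(2)
  proof eventually_elim
    fix x assume "(\<lambda>k. (cmod (F (r k) x - f x))\<^sup>2) \<longlonglongrightarrow> 0"
    then have "(\<lambda>k. sqrt ((cmod (F (r k) x - f x))\<^sup>2)) \<longlonglongrightarrow> sqrt 0"
      by (intro tendsto_real_sqrt)
    then have "(\<lambda>k. F (r k) x - f x) \<longlonglongrightarrow> 0"
      by (simp add: tendsto_norm_zero_iff)
    then show "(\<lambda>k. F (r k) x) \<longlonglongrightarrow> f x" using LIM_zero_iff by blast
  qed
  with r(1) that show thesis by blast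
qed

text \<open>Riesz--Fischer. Along a subsequence with increments of norm below \<open>4\<^sup>-\<^sup>k\<close>, the function
  \<open>\<Sum>k. 4\<^sup>k \<bar>d\<^sub>k\<bar>\<^sup>2\<close> built from the increments \<open>d\<^sub>k\<close> is integrable; wherever it is finite,
  \<open>\<bar>d\<^sub>k\<bar>\<close> decays like \<open>2\<^sup>-\<^sup>k\<close>, so the subsequence converges pointwise there.\<close>

lemma L2_complete:
  assumes C: "L2_Cauchy M F"
  obtains f where "L2_converges M F f"
proof -
  have F: "F n \<in> L2 M" for n using C by (simp add: L2_Cauchy_def)
  note [measurable] = L2_measurable[OF F]
  have "\<exists>r. strict_mono r \<and> (\<forall>k. L2_norm M (\<lambda>x. F (r (Suc k)) x - F (r k) x) < (1 / 4) ^ k)"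
  proof -
    have "\<exists>N. \<forall>m\<ge>N. \<forall>n\<ge>N. L2_norm M (\<lambda>x. F m x - F n x) < (1 / 4) ^ k" for k
      using C by (auto simp: L2_Cauchy_def)
    then obtain N where N: "\<And>k m n. m \<ge> N k \<Longrightarrow> n \<ge> N k \<Longrightarrow>
        L2_norm M (\<lambda>x. F m x - F n x) < (1 / 4) ^ k"
      by metis
    define r where "r k = k + (\<Sum>i\<le>k. N i)" for k
    have "strict_mono r" by (auto simp: r_def strict_mono_Suc_iff)
    moreover have "r k \<ge> N k" for k
      unfolding r_def by (intro trans_le_add2 member_le_sum) auto
    moreover have "r (Suc k) \<ge> r k" for k by (auto simp: r_def)
    ultimately show ?thesis using N by (metis order_trans)
  qed
  then obtain r where r: "strict_mono r"
    and small: "\<And>k. L2_norm M (\<lambda>x. F (r (Suc k)) x - F (r k) x) < (1 / 4) ^ k" by blast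
  define d where "d k x = F (r (Suc k)) x - F (r k) x" for k x
  have d: "d k \<in> L2 M" for k unfolding d_def by (intro L2_diff F)
  note [measurable] = L2_measurable[OF d]
  have "(\<integral>\<^sup>+x. (\<Sum>k. ennreal (4 ^ k * (cmod (d k x))\<^sup>2)) \<partial>M)
      = (\<Sum>k. \<integral>\<^sup>+x. ennreal (4 ^ k * (cmod (d k x))\<^sup>2) \<partial>M)"
    by (rule nn_integral_suminf) measurable
  also have "\<dots> = (\<Sum>k. ennreal (4 ^ k * (L2_norm M (d k))\<^sup>2))"
    by (simp add: ennreal_mult nn_integral_cmult L2_norm_power2_nn d)
  also have "\<dots> \<le> (\<Sum>k. ennreal ((1 / 4) ^ k))"
  proof (intro suminf_le ennreal_leI)
    fix k
    have "4 ^ k * (L2_norm M (d k))\<^sup>2 \<le> 4 ^ k * ((1 / 4) ^ k)\<^sup>2"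
      using small[of k] by (intro mult_left_mono power_mono) (auto simp: d_def[abs_def])
    also have "\<dots> = (1 / 4) ^ k" by (simp add: power2_eq_square power_divide)
    finally show "4 ^ k * (L2_norm M (d k))\<^sup>2 \<le> (1 / 4) ^ k" .
  qed auto
  also have "\<dots> = ennreal (\<Sum>k. (1 / 4) ^ k)"
    by (intro suminf_ennreal2 summable_geometric) auto
  also have "\<dots> < \<infinity>" by simp
  finally have "(\<integral>\<^sup>+x. (\<Sum>k. ennreal (4 ^ k * (cmod (d k x))\<^sup>2)) \<partial>M) \<noteq> \<infinity>" by simp
  then have fin: "AE x in M. (\<Sum>k. ennreal (4 ^ k * (cmod (d k x))\<^sup>2)) \<noteq> \<infinity>"
    by (intro nn_integral_PInf_AE) auto
  have conv: "convergent (\<lambda>k. F (r k) x)"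
    if "(\<Sum>k. ennreal (4 ^ k * (cmod (d k x))\<^sup>2)) \<noteq> \<infinity>" for x
  proof -
    have "summable (\<lambda>k. 4 ^ k * (cmod (d k x))\<^sup>2)"
      using that by (intro summable_suminf_not_top) auto
    then have "(\<lambda>k. 4 ^ k * (cmod (d k x))\<^sup>2) \<longlonglongrightarrow> 0" by (rule summable_LIMSEQ_zero)
    then have "\<forall>\<^sub>F k in sequentially. 4 ^ k * (cmod (d k x))\<^sup>2 < 1"
      by (rule order_tendstoD) simp
    then have "\<forall>\<^sub>F k in sequentially. norm (d k x) \<le> (1 / 2) ^ k"
    proof eventually_elim
      fix k assume *: "4 ^ k * (cmod (d k x))\<^sup>2 < 1"
      have "(2 ^ k * cmod (d k x))\<^sup>2 = 4 ^ k * (cmod (d k x))\<^sup>2"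
        by (simp add: power_mult_distrib power2_eq_square flip: power_mult_distrib)
      with * have "(2 ^ k * cmod (d k x))\<^sup>2 \<le> 1\<^sup>2" by simp
      then have "2 ^ k * cmod (d k x) \<le> 1" by (rule power2_le_imp_le) simp
      then show "norm (d k x) \<le> (1 / 2) ^ k" by (simp add: field_simps power_divide)
    qed
    then have "summable (\<lambda>k. d k x)"
      by (rule summable_comparison_test_ev) (simp add: summable_geometric)
    then have "convergent (\<lambda>n. \<Sum>k<n. d k x)" by (simp add: summable_iff_convergent)
    moreover have "(\<Sum>k<n. d k x) = F (r n) x - F (r 0) x" for n
      unfolding d_def by (rule sum_lessThan_telescope)
    ultimately have "convergent (\<lambda>n. (F (r n) x - F (r 0) x) + F (r 0) x)"
      by (intro convergent_add convergent_const) simp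
    then show ?thesis by simp
  qed
  define f where "f x = lim (\<lambda>k. F (r k) x)" for x
  have "f \<in> borel_measurable M" unfolding f_def by measurable
  moreover have "AE x in M. (\<lambda>k. F (r k) x) \<longlonglongrightarrow> f x"
    using fin by eventually_elim (use conv in \<open>auto simp: f_def convergent_LIMSEQ_iff\<close>)
  ultimately show thesis
    using L2_Cauchy_AE_limit[OF C r] that by blast
qed

lemma L2_norm_eq_0_iff:
  assumes "f \<in> L2 M"
  shows "L2_norm M f = 0 \<longleftrightarrow> (AE x in M. f x = 0)"
  using integral_nonneg_eq_0_iff_AE[OF L2_integrable[OF assms]] by (simp add: L2_norm_def)

lemma complex_borel_measurable_cnj [measurable]:
  assumes "f \<in> borel_measurable M"
  shows "(\<lambda>x. cnj (f x)) \<in> borel_measurable M"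
  by (rule measurable_compose[OF assms])
     (intro borel_measurable_continuous_onI continuous_intros)

lemma L2_prod_integrable:
  assumes "f \<in> L2 M" "g \<in> L2 M"
  shows "integrable M (\<lambda>x. f x * cnj (g x))"
proof (rule Bochner_Integration.integrable_bound)
  show "integrable M (\<lambda>x. (cmod (f x))\<^sup>2 + (cmod (g x))\<^sup>2)"
    using assms[THEN L2_integrable] by simp
  show "(\<lambda>x. f x * cnj (g x)) \<in> borel_measurable M"
    using assms by (intro borel_measurable_times complex_borel_measurable_cnj L2_measurable)
  have "cmod a * cmod b \<le> (cmod a)\<^sup>2 + (cmod b)\<^sup>2" for a b
  proof -
    have "0 \<le> cmod a * cmod b" by simp
    then show ?thesis using sum_squares_bound[of "cmod a" "cmod b"] by linarith
  qed
  then show "AE x in M. norm (f x * cnj (g x)) \<le> norm ((cmod (f x))\<^sup>2 + (cmod (g x))\<^sup>2)"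
    by (auto simp: norm_mult intro!: AE_I2)
qed

text \<open>This reduces an equality of norms of linear combinations in two spaces, as in Plancherel's
  theorem, to an equality of inner products.\<close>

lemma L2_norm_sum_Gram:
  assumes I: "finite I" and u: "\<And>i. i \<in> I \<Longrightarrow> u i \<in> L2 M"
  shows "complex_of_real ((L2_norm M (\<lambda>x. \<Sum>i\<in>I. c i * u i x))\<^sup>2)
    = (\<Sum>i\<in>I. \<Sum>j\<in>I. c i * cnj (c j) * (LINT x|M. u i x * cnj (u j x)))"
proof -
  have "complex_of_real ((L2_norm M (\<lambda>x. \<Sum>i\<in>I. c i * u i x))\<^sup>2)
      = (LINT x|M. complex_of_real ((cmod (\<Sum>i\<in>I. c i * u i x))\<^sup>2))"
    by (simp add: L2_norm_power2 del: of_real_power)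
  also have "\<dots> = (LINT x|M. (\<Sum>i\<in>I. \<Sum>j\<in>I. c i * cnj (c j) * (u i x * cnj (u j x))))"
    unfolding complex_norm_square
    by (simp add: sum_product mult_ac flip: complex_cnj_mult)
  also have "\<dots> = (\<Sum>i\<in>I. \<Sum>j\<in>I. c i * cnj (c j) * (LINT x|M. u i x * cnj (u j x)))"
    by (subst Bochner_Integration.integral_sum)
       (auto simp: Bochner_Integration.integral_sum L2_prod_integrable u
          intro!: Bochner_Integration.integrable_sum integrable_mult_right)
  finally show ?thesis .
qed

lemma has_bochner_integral_complex_indicator:
  assumes "A \<in> sets M" "emeasure M A < \<infinity>"
  shows "has_bochner_integral M (indicator A :: _ \<Rightarrow> complex) (of_real (measure M A))"
proof -
  have "(\<lambda>x. indicator A x *\<^sub>R (1 :: complex)) = indicator A"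
    by (auto simp: indicator_def)
  then show ?thesis using has_bochner_integral_indicator[OF assms, of "1 :: complex"]
    by (simp add: scaleR_conv_of_real)
qed

lemma L2_indicator:
  assumes "A \<in> sets M" "emeasure M A < \<infinity>"
  shows "(indicator A :: _ \<Rightarrow> complex) \<in> L2 M"
proof -
  have "(\<lambda>x. (cmod (indicator A x))\<^sup>2) = (indicator A :: _ \<Rightarrow> real)"
    by (auto simp: indicator_def)
  then show ?thesis using assms by (simp add: L2_def)
qed

lemma L2_sums_exists:
  assumes u: "\<And>n. u n \<in> L2 M" and b: "summable b"
    and le: "\<And>m n. m \<le> n \<Longrightarrow> (L2_norm M (\<lambda>x. \<Sum>i=m..<n. u i x))\<^sup>2 \<le> (\<Sum>i=m..<n. b i)"
  shows "\<exists>g. L2_sums M u g"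
proof -
  let ?S = "\<lambda>N x. \<Sum>n<N. u n x"
  have "L2_Cauchy M ?S"
    unfolding L2_Cauchy_def
  proof (intro conjI allI impI)
    show "?S n \<in> L2 M" for n by (intro L2_sum u)
    fix e :: real assume e: "0 < e"
    then obtain N where N: "\<And>m n. m \<ge> N \<Longrightarrow> norm (sum b {m..<n}) < e\<^sup>2"
      using b unfolding summable_Cauchy by (meson zero_less_power)
    have *: "L2_norm M (\<lambda>x. ?S n x - ?S m x) < e" if "m \<ge> N" "m \<le> n" for m n
    proof -
      have "?S n x - ?S m x = (\<Sum>i=m..<n. u i x)" for x
        using sum_diff_nat_ivl[of 0 m n "\<lambda>i. u i x"] that(2) by (simp add: atLeast0LessThan)
      then have "(L2_norm M (\<lambda>x. ?S n x - ?S m x))\<^sup>2 \<le> sum b {m..<n}"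
        using le[OF that(2)] by simp
      also have "\<dots> < e\<^sup>2" using N[OF that(1), of n] by simp
      finally show ?thesis by (rule power2_less_imp_less) (use e in simp)
    qed
    have "L2_norm M (\<lambda>x. ?S n x - ?S m x) < e" if "m \<ge> N" "n \<ge> N" for m n
      using *[of m n] *[of n m] that L2_norm_minus_commute[of M "?S n" "?S m"]
      by (cases "m \<le> n") auto
    then show "\<exists>N. \<forall>m\<ge>N. \<forall>n\<ge>N. L2_norm M (\<lambda>x. ?S m x - ?S n x) < e" by blast
  qed
  then obtain g where "L2_converges M ?S g" by (rule L2_complete)
  then show ?thesis unfolding L2_sums_def by blast
qed

lemma L2_converges_add:
  assumes F: "L2_converges M F f" and G: "L2_converges M G g"
  shows "L2_converges M (\<lambda>n x. F n x + G n x) (\<lambda>x. f x + g x)"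
proof -
  have L: "F n \<in> L2 M" "f \<in> L2 M" "G n \<in> L2 M" "g \<in> L2 M" for n
    using F G by (auto simp: L2_converges_def)
  have lim: "(\<lambda>n. L2_norm M (\<lambda>x. F n x - f x) + L2_norm M (\<lambda>x. G n x - g x)) \<longlonglongrightarrow> 0"
    using tendsto_add[of "\<lambda>n. L2_norm M (\<lambda>x. F n x - f x)" 0] F G by (force simp: L2_converges_def)
  have "(\<lambda>n. L2_norm M (\<lambda>x. (F n x + G n x) - (f x + g x))) \<longlonglongrightarrow> 0"
  proof (rule Lim_null_comparison[OF _ lim], rule always_eventually, rule allI)
    fix n
    have "(\<lambda>x. (F n x + G n x) - (f x + g x)) = (\<lambda>x. (F n x - f x) + (G n x - g x))" by auto
    then show "norm (L2_norm M (\<lambda>x. (F n x + G n x) - (f x + g x)))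
        \<le> L2_norm M (\<lambda>x. F n x - f x) + L2_norm M (\<lambda>x. G n x - g x)"
      using L2_norm_triangle[OF L2_diff[OF L(1,2)] L2_diff[OF L(3,4)]] by simp
  qed
  then show ?thesis using L by (simp add: L2_converges_def L2_add)
qed

lemma L2_converges_scale:
  assumes F: "L2_converges M F f"
  shows "L2_converges M (\<lambda>n x. a * F n x) (\<lambda>x. a * f x)"
proof -
  have "(\<lambda>n. cmod a * L2_norm M (\<lambda>x. F n x - f x)) \<longlonglongrightarrow> cmod a * 0"
    using F by (intro tendsto_mult_left) (simp add: L2_converges_def)
  moreover have "L2_norm M (\<lambda>x. a * F n x - a * f x) = cmod a * L2_norm M (\<lambda>x. F n x - f x)" for n
    using L2_norm_scale[of M a "\<lambda>x. F n x - f x"] by (simp add: right_diff_distrib)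
  ultimately show ?thesis using F by (simp add: L2_converges_def L2_scale)
qed

lemma L2_converges_sum:
  assumes "finite A" "\<And>i. i \<in> A \<Longrightarrow> L2_converges M (\<lambda>n. F i n) (f i)"
  shows "L2_converges M (\<lambda>n x. \<Sum>i\<in>A. F i n x) (\<lambda>x. \<Sum>i\<in>A. f i x)"
  using assms
proof (induction A)
  case empty
  then show ?case by (simp add: L2_converges_def L2_zero) (simp add: L2_norm_def)
next
  case (insert i A)
  then show ?case using L2_converges_add[of M "F i" "f i"] by simp
qed

lemma L2_bounded_mult:
  assumes f: "f \<in> L2 M" and [measurable]: "q \<in> borel_measurable M"
    and q: "\<And>x. x \<in> space M \<Longrightarrow> cmod (q x) \<le> K" and K: "0 \<le> K"
  shows "(\<lambda>x. q x * f x) \<in> L2 M" "L2_norm M (\<lambda>x. q x * f x) \<le> K * L2_norm M f"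
proof -
  note [measurable] = L2_measurable[OF f]
  have le: "(cmod (q x * f x))\<^sup>2 \<le> K\<^sup>2 * (cmod (f x))\<^sup>2" if "x \<in> space M" for x
    using q[OF that] by (simp add: norm_mult power_mult_distrib mult_right_mono power_mono)
  have int: "integrable M (\<lambda>x. K\<^sup>2 * (cmod (f x))\<^sup>2)" by (intro integrable_mult_right L2_integrable f)
  show qf: "(\<lambda>x. q x * f x) \<in> L2 M" by (rule L2I_bound[OF _ int le]) measurable
  have "(L2_norm M (\<lambda>x. q x * f x))\<^sup>2 \<le> (LINT x|M. K\<^sup>2 * (cmod (f x))\<^sup>2)"
    unfolding L2_norm_power2 by (rule integral_mono[OF L2_integrable[OF qf] int le])
  also have "\<dots> = (K * L2_norm M f)\<^sup>2" by (simp add: L2_norm_power2 power_mult_distrib)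
  finally have sq: "(L2_norm M (\<lambda>x. q x * f x))\<^sup>2 \<le> (K * L2_norm M f)\<^sup>2" .
  then show "L2_norm M (\<lambda>x. q x * f x) \<le> K * L2_norm M f"
    by (rule power2_le_imp_le) (simp add: K)
qed

lemma L2_converges_bounded_mult:
  assumes F: "L2_converges M F f" and q: "q \<in> borel_measurable M"
    "\<And>x. x \<in> space M \<Longrightarrow> cmod (q x) \<le> K" "0 \<le> K"
  shows "L2_converges M (\<lambda>n x. q x * F n x) (\<lambda>x. q x * f x)"
proof -
  have L: "F n \<in> L2 M" "f \<in> L2 M" for n using F by (auto simp: L2_converges_def)
  have lim: "(\<lambda>n. K * L2_norm M (\<lambda>x. F n x - f x)) \<longlonglongrightarrow> 0"
    using tendsto_mult_left[of "\<lambda>n. L2_norm M (\<lambda>x. F n x - f x)" 0 sequentially K] F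
    by (simp add: L2_converges_def)
  have "(\<lambda>n. L2_norm M (\<lambda>x. q x * F n x - q x * f x)) \<longlonglongrightarrow> 0"
  proof (rule Lim_null_comparison[OF _ lim], rule always_eventually, rule allI)
    show "norm (L2_norm M (\<lambda>x. q x * F n x - q x * f x)) \<le> K * L2_norm M (\<lambda>x. F n x - f x)" for n
      using L2_bounded_mult(2)[OF L2_diff[OF L] q, of n] by (simp add: right_diff_distrib)
  qed
  then show ?thesis using L L2_bounded_mult(1)[OF _ q] by (simp add: L2_converges_def)
qed


section \<open>Cosets, topology and Haar measure of the Vilenkin group\<close>

lemma vil_iff: "x \<in> vil p \<longleftrightarrow> (\<forall>j. 0 \<le> x j \<and> x j < p) \<and> (\<exists>k. \<forall>j<k. x j = 0)"
  by (simp add: vil_def)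

lemma vil_mod [simp]: "x \<in> vil p \<Longrightarrow> x j mod p = x j"
  by (simp add: vil_def)

lemma vil_zero [simp]: "0 < p \<Longrightarrow> (\<lambda>_. 0) \<in> vil p"
  by (simp add: vil_def)

lemma vil_add_closed [simp]:
  assumes "0 < p" "x \<in> vil p" "y \<in> vil p"
  shows "vil_add p x y \<in> vil p"
proof -
  obtain k l where "\<forall>j<k. x j = 0" "\<forall>j<l. y j = 0" using assms by (auto simp: vil_iff)
  then have "\<forall>j<min k l. vil_add p x y j = 0" by (simp add: vil_add_def)
  then show ?thesis using assms(1) by (auto simp: vil_iff vil_add_def simp del: min_less_iff_conj)
qed

lemma vil_diff_closed [simp]:
  assumes "0 < p" "x \<in> vil p" "y \<in> vil p"
  shows "vil_diff p x y \<in> vil p"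
proof -
  obtain k l where "\<forall>j<k. x j = 0" "\<forall>j<l. y j = 0" using assms by (auto simp: vil_iff)
  then have "\<forall>j<min k l. vil_diff p x y j = 0" by (simp add: vil_diff_def)
  then show ?thesis using assms(1) by (auto simp: vil_iff vil_diff_def simp del: min_less_iff_conj)
qed

lemma vil_add_commute: "vil_add p x y = vil_add p y x"
  by (simp add: vil_add_def add.commute)

lemma vil_add_diff [simp]: "y \<in> vil p \<Longrightarrow> vil_add p x (vil_diff p y x) = y"
  by (auto simp: vil_add_def vil_diff_def mod_simps)

lemma vil_diff_add [simp]: "y \<in> vil p \<Longrightarrow> vil_diff p (vil_add p x y) x = y"
  by (auto simp: vil_add_def vil_diff_def mod_simps)

lemma vil_diff_eq_add_neg: "vil_diff p x h = vil_add p (vil_diff p (\<lambda>_. 0) h) x"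
  by (auto simp: vil_add_def vil_diff_def mod_simps)

text \<open>The coset \<open>a \<oplus> U\<^sub>l\<close>, described by its leading digits, so that intersections and inclusions of
  cosets can be read off.\<close>

definition cyl :: "int \<Rightarrow> digits \<Rightarrow> int \<Rightarrow> digits set" where
  "cyl p a l = {x \<in> vil p. \<forall>j\<le>l. x j = a j}"

definition cyls :: "int \<Rightarrow> digits set set" where
  "cyls p = {cyl p a l | a l. a \<in> vil p}"

lemma cyl_subset: "cyl p a l \<subseteq> vil p"
  by (auto simp: cyl_def)

lemma cyl_self: "a \<in> vil p \<Longrightarrow> a \<in> cyl p a l"
  by (auto simp: cyl_def)

lemma vil_nbhd_eq_cyl: "vil_nbhd p l = cyl p (\<lambda>_. 0) l"
  by (simp add: vil_nbhd_def cyl_def)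

lemma cyl_cong: "(\<And>j. j \<le> l \<Longrightarrow> a j = b j) \<Longrightarrow> cyl p a l = cyl p b l"
  by (auto simp: cyl_def)

lemma cyl_eq: "x \<in> cyl p a l \<Longrightarrow> cyl p x l = cyl p a l"
  by (auto simp: cyl_def)

lemma cyl_antimono: "l \<le> k \<Longrightarrow> cyl p a k \<subseteq> cyl p a l"
  by (auto simp: cyl_def)

lemma cyl_Int:
  assumes "l \<le> k" "b \<in> vil p"
  shows "cyl p a l \<inter> cyl p b k = (if b \<in> cyl p a l then cyl p b k else {})"
proof -
  have "x \<in> cyl p a l \<longleftrightarrow> b \<in> cyl p a l" if x: "x \<in> cyl p b k" for x
  proof -
    have "\<forall>j\<le>l. x j = b j" using x assms by (auto simp: cyl_def)
    moreover have "x \<in> vil p" using x by (simp add: cyl_def)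
    ultimately show ?thesis using assms(2) by (auto simp: cyl_def)
  qed
  then show ?thesis by auto
qed

lemma vil_add_image_cyl:
  assumes "0 < p" "a \<in> vil p" "b \<in> vil p"
  shows "vil_add p a ` cyl p b l = cyl p (vil_add p a b) l"
proof
  show "vil_add p a ` cyl p b l \<subseteq> cyl p (vil_add p a b) l"
    using assms by (auto simp: cyl_def) (simp add: vil_add_def)
  show "cyl p (vil_add p a b) l \<subseteq> vil_add p a ` cyl p b l"
  proof
    fix x assume x: "x \<in> cyl p (vil_add p a b) l"
    then have "vil_diff p x a \<in> cyl p b l"
      using assms by (auto simp: cyl_def) (simp add: vil_diff_def vil_add_def mod_simps)
    moreover have "x = vil_add p a (vil_diff p x a)" using x by (simp add: cyl_def)
    ultimately show "x \<in> vil_add p a ` cyl p b l" by blast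
  qed
qed

lemma vil_add_zero [simp]: "a \<in> vil p \<Longrightarrow> vil_add p a (\<lambda>_. 0) = a"
  by (auto simp: vil_add_def)

lemma vil_topology_eq:
  assumes "0 < p"
  shows "vil_topology p = topology_generated_by (cyls p)"
proof -
  have "vil_add p a ` vil_nbhd p l = cyl p a l" if "a \<in> vil p" for a l
    using vil_add_image_cyl[of p a "\<lambda>_. 0"] assms that by (simp add: vil_nbhd_eq_cyl)
  then have "{vil_add p a ` vil_nbhd p l | a l. a \<in> vil p} = cyls p"
    unfolding cyls_def by metis
  then show ?thesis by (simp add: vil_topology_def)
qed

lemma openin_vil_topology_cyl:
  assumes "0 < p" "openin (vil_topology p) S" "x \<in> S"
  obtains l where "x \<in> vil p" "cyl p x l \<subseteq> S"
proof -
  have "generate_topology_on (cyls p) S"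
    using assms(1,2) by (simp add: vil_topology_eq openin_topology_generated_by_iff)
  then have "\<forall>x\<in>S. x \<in> vil p \<and> (\<exists>l. cyl p x l \<subseteq> S)"
  proof induction
    case (Int A B)
    show ?case
    proof
      fix x assume "x \<in> A \<inter> B"
      then obtain l k where "x \<in> vil p" "cyl p x l \<subseteq> A" "cyl p x k \<subseteq> B" using Int by blast
      moreover have "cyl p x (max l k) \<subseteq> cyl p x l" "cyl p x (max l k) \<subseteq> cyl p x k"
        by (simp_all add: cyl_antimono)
      ultimately show "x \<in> vil p \<and> (\<exists>l. cyl p x l \<subseteq> A \<inter> B)" by blast
    qed
  next
    case (Basis S)
    then show ?case using cyl_eq by (fastforce simp: cyls_def cyl_def)
  qed blast+
  then show thesis using assms(3) that by blast
qed

lemma countable_cyls: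
  assumes "0 < p"
  shows "countable (cyls p)"
proof -
  define S where "S n = {x :: digits. \<forall>j. (j \<in> {-int n..int n} \<longrightarrow> x j \<in> {0..<p}) \<and>
    (j \<notin> {-int n..int n} \<longrightarrow> x j = 0)}" for n :: nat
  have "finite (S n)" for n
    unfolding S_def by (rule finite_set_of_finite_funs) auto
  then have "countable ((\<Union>n. S n) \<times> (UNIV :: int set))"
    by (intro countable_SIGMA countable_UN) (auto intro: countable_finite)
  then have "countable ((\<lambda>(a, l). cyl p a l) ` ((\<Union>n. S n) \<times> UNIV))"
    by (rule countable_image)
  moreover have "cyls p \<subseteq> (\<lambda>(a, l). cyl p a l) ` ((\<Union>n. S n) \<times> UNIV)"
  proof
    fix K assume "K \<in> cyls p"
    then obtain a l where a: "a \<in> vil p" and K: "K = cyl p a l" by (auto simp: cyls_def)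
    obtain k where k: "\<forall>j<k. a j = 0" using a by (auto simp: vil_iff)
    \<comment> \<open>The digits beyond \<open>l\<close> do not matter for the coset, so its representative can be taken with
      finite support.\<close>
    define b where "b = (\<lambda>j. if j \<le> l then a j else 0)"
    have "b \<in> S (nat (max \<bar>k\<bar> \<bar>l\<bar>))"
      using a k assms by (auto simp: S_def b_def vil_iff)
    moreover have "K = cyl p b l" unfolding K by (rule cyl_cong) (simp add: b_def)
    ultimately show "K \<in> (\<lambda>(a, l). cyl p a l) ` ((\<Union>n. S n) \<times> UNIV)" by blast
  qed
  ultimately show ?thesis by (rule countable_subset[rotated])
qed

text \<open>Uniqueness and existence of base \<open>p\<close> expansions make \<open>vil_H_index\<close> a bijection.\<close>

lemma digit_sum_inj:
  fixes h g :: "nat \<Rightarrow> int"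
  assumes "\<And>i. 0 \<le> h i \<and> h i < p" "\<And>i. 0 \<le> g i \<and> g i < p"
    "(\<Sum>i<n. h i * p ^ i) = (\<Sum>i<n. g i * p ^ i)"
  shows "\<forall>i<n. h i = g i"
  using assms
proof (induction n arbitrary: h g)
  case (Suc n)
  have split: "(\<Sum>i<Suc n. f i * p ^ i) = f 0 + p * (\<Sum>i<n. f (Suc i) * p ^ i)"
    for f :: "nat \<Rightarrow> int"
    unfolding sum.lessThan_Suc_shift sum_distrib_left by (simp add: mult_ac)
  have eq: "h 0 + p * (\<Sum>i<n. h (Suc i) * p ^ i) = g 0 + p * (\<Sum>i<n. g (Suc i) * p ^ i)"
    using Suc.prems(3) by (simp only: split)
  have "h 0 = g 0"
    using arg_cong[OF eq, of "\<lambda>x. x mod p"] Suc.prems(1,2) by simp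
  moreover have "0 < p" using Suc.prems(1)[of 0] by linarith
  ultimately have "\<forall>i<n. h (Suc i) = g (Suc i)"
    using eq Suc.prems(1,2) by (intro Suc.IH) auto
  then show ?case using \<open>h 0 = g 0\<close> by (auto simp: less_Suc_eq_0_disj)
qed simp

lemma digit_sum_exists:
  fixes N p :: int
  assumes "0 < p" "0 \<le> N" "N < p ^ n"
  obtains h :: "nat \<Rightarrow> int" where "\<And>i. 0 \<le> h i \<and> h i < p" "\<And>i. i \<ge> n \<Longrightarrow> h i = 0"
    "(\<Sum>i<n. h i * p ^ i) = N"
  using assms
proof (induction n arbitrary: N thesis)
  case 0
  then show ?case by (intro "0.prems"(1)[of "\<lambda>_. 0"]) auto
next
  case (Suc n)
  have "N div p < p ^ n" "0 \<le> N div p"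
  proof -
    have "p * (N div p) \<le> N" using Suc.prems(2) by (simp add: minus_mod_eq_mult_div [symmetric])
    also have "N < p * p ^ n" using Suc.prems(4) by simp
    finally show "N div p < p ^ n" using Suc.prems(2) by simp
    show "0 \<le> N div p" using Suc.prems by (simp add: pos_imp_zdiv_nonneg_iff)
  qed
  then obtain h :: "nat \<Rightarrow> int" where h: "\<And>i. 0 \<le> h i \<and> h i < p" "\<And>i. i \<ge> n \<Longrightarrow> h i = 0"
    "(\<Sum>i<n. h i * p ^ i) = N div p"
    using Suc.IH[OF _ \<open>0 < p\<close>] by blast
  define g where "g i = (case i of 0 \<Rightarrow> N mod p | Suc k \<Rightarrow> h k)" for i
  have "(\<Sum>i<Suc n. g i * p ^ i) = N mod p + p * (\<Sum>i<n. h i * p ^ i)"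
    unfolding sum.lessThan_Suc_shift sum_distrib_left by (simp add: g_def mult_ac)
  also have "\<dots> = N" by (simp add: h(3))
  finally show ?case
    using h \<open>0 < p\<close>
    by (intro Suc.prems(1)[of g]) (auto simp: g_def split: nat.splits)
qed

lemma vil_H_index_eq:
  assumes "0 < p" "h \<in> vil_H p" and n: "\<And>i. i \<ge> n \<Longrightarrow> h (- int i) = 0"
  shows "int (vil_H_index p h) = (\<Sum>i<n. h (- int i) * p ^ i)"
proof -
  have pos: "\<And>j. 0 < j \<Longrightarrow> h j = 0" and nn: "\<And>j. 0 \<le> h j"
    using assms by (auto simp: vil_H_def vil_iff)
  have "{j. h j \<noteq> 0} \<subseteq> (\<lambda>i. - int i) ` {..<n}"
  proof
    fix j assume "j \<in> {j. h j \<noteq> 0}"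
    then have j: "h j \<noteq> 0" by simp
    then have "j \<le> 0" using pos[of j] by force
    then have "j = - int (nat (- j))" by simp
    moreover have "nat (- j) < n" using j n[of "nat (- j)"] \<open>j \<le> 0\<close> by force
    ultimately show "j \<in> (\<lambda>i. - int i) ` {..<n}" by blast
  qed
  then have "(\<Sum>j | h j \<noteq> 0. h j * p ^ nat (- j)) = (\<Sum>j\<in>(\<lambda>i. - int i) ` {..<n}. h j * p ^ nat (- j))"
    by (intro sum.mono_neutral_left) auto
  also have "\<dots> = (\<Sum>i<n. h (- int i) * p ^ i)"
    by (subst sum.reindex) (auto simp: inj_on_def)
  finally have eq: "(\<Sum>j | h j \<noteq> 0. h j * p ^ nat (- j)) = (\<Sum>i<n. h (- int i) * p ^ i)" .
  moreover have "0 \<le> (\<Sum>j | h j \<noteq> 0. h j * p ^ nat (- j))"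
    using nn assms(1) by (intro sum_nonneg) auto
  ultimately show ?thesis by (simp add: vil_H_index_def)
qed

lemma vil_H_support:
  assumes "h \<in> vil_H p"
  obtains n where "\<And>i. i \<ge> n \<Longrightarrow> h (- int i) = 0"
proof -
  obtain k where "\<forall>j<k. h j = 0" using assms by (auto simp: vil_H_def vil_iff)
  then show thesis by (intro that[of "nat (1 - k)"]) auto
qed

lemma bij_betw_vil_H_index:
  assumes p: "2 \<le> p"
  shows "bij_betw (vil_H_index p) (vil_H p) UNIV"
proof (rule bij_betwI')
  fix h g assume h: "h \<in> vil_H p" and g: "g \<in> vil_H p"
  show "(vil_H_index p h = vil_H_index p g) = (h = g)"
  proof
    assume eq: "vil_H_index p h = vil_H_index p g"
    obtain n m where nm: "\<And>i. i \<ge> n \<Longrightarrow> h (- int i) = 0" "\<And>i. i \<ge> m \<Longrightarrow> g (- int i) = 0"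
      using vil_H_support h g by metis
    have "(\<Sum>i<max n m. h (- int i) * p ^ i) = (\<Sum>i<max n m. g (- int i) * p ^ i)"
      using vil_H_index_eq[of p h "max n m"] vil_H_index_eq[of p g "max n m"] p h g nm eq by simp
    then have *: "\<forall>i<max n m. h (- int i) = g (- int i)"
      by (rule digit_sum_inj[rotated 2]) (use h g in \<open>auto simp: vil_H_def vil_iff\<close>)
    then have **: "h (- int i) = g (- int i)" for i using nm[of i] by (cases "i < max n m") auto
    show "h = g"
    proof
      fix j show "h j = g j"
        using **[of "nat (- j)"] h g by (cases "j \<le> 0") (auto simp: vil_H_def)
    qed
  qed simp
next
  fix N :: nat
  have "int N < p ^ N"
  proof -
    have "int N < 2 ^ N" using of_nat_less_two_power by blast
    also have "\<dots> \<le> p ^ N" using p by (intro power_mono) auto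
    finally show ?thesis .
  qed
  then obtain h :: "nat \<Rightarrow> int" where h: "\<And>i. 0 \<le> h i \<and> h i < p" "\<And>i. i \<ge> N \<Longrightarrow> h i = 0"
    "(\<Sum>i<N. h i * p ^ i) = int N"
    using digit_sum_exists[of p "int N" N] p by auto
  define g where "g j = (if j \<le> 0 then h (nat (- j)) else 0)" for j
  have "g \<in> vil_H p"
    using h p by (auto simp: vil_H_def vil_iff g_def intro!: exI[of _ "- int N"])
  moreover from this have "int (vil_H_index p g) = int N"
    using vil_H_index_eq[of p g N] p h by (simp add: g_def)
  ultimately show "\<exists>x\<in>vil_H p. N = vil_H_index p x" by force
qed simp

lemma bij_betw_vil_H_enum: "2 \<le> p \<Longrightarrow> bij_betw (vil_H_enum p) UNIV (vil_H p)"
  unfolding vil_H_enum_def by (rule bij_betw_inv_into[OF bij_betw_vil_H_index])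

lemma vil_H_subset: "h \<in> vil_H p \<Longrightarrow> h \<in> vil p"
  by (simp add: vil_H_def)

lemma vil_H_enum_in [simp]: "2 \<le> p \<Longrightarrow> vil_H_enum p n \<in> vil_H p"
  using bij_betw_vil_H_enum[of p] by (auto simp: bij_betw_def)

lemma vil_H_enum_vil [simp]: "2 \<le> p \<Longrightarrow> vil_H_enum p n \<in> vil p"
  by (rule vil_H_subset) simp

lemma vil_H_enum_inj: "2 \<le> p \<Longrightarrow> vil_H_enum p n = vil_H_enum p m \<longleftrightarrow> n = m"
  using bij_betw_vil_H_enum[of p] by (auto simp: bij_betw_def inj_on_def)

lemma vil_H_eqI:
  "h \<in> vil_H p \<Longrightarrow> g \<in> vil_H p \<Longrightarrow> (\<And>j. j \<le> 0 \<Longrightarrow> h j = g j) \<Longrightarrow> h = g"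
proof (rule ext)
  fix j
  assume "h \<in> vil_H p" "g \<in> vil_H p" "\<And>j. j \<le> 0 \<Longrightarrow> h j = g j"
  then show "h j = g j" by (cases "j \<le> 0") (simp_all add: vil_H_def)
qed

text \<open>An element lies in the translate \<open>h \<oplus> U\<close> iff its digits at \<open>j \<le> 0\<close> are those of \<open>h\<close>. So its
  tile is found by cutting off the digits at \<open>j > 0\<close>, and no other tile contains it.\<close>

lemma disjoint_tiles:
  assumes "2 \<le> p"
  shows "disjoint_family (\<lambda>n. cyl p (vil_H_enum p n) 0)"
  unfolding disjoint_family_on_def
proof (intro ballI impI)
  fix m n :: nat assume "m \<noteq> n"
  show "cyl p (vil_H_enum p m) 0 \<inter> cyl p (vil_H_enum p n) 0 = {}"
  proof (rule ccontr)
    assume "cyl p (vil_H_enum p m) 0 \<inter> cyl p (vil_H_enum p n) 0 \<noteq> {}"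
    then obtain x where "x \<in> cyl p (vil_H_enum p m) 0" "x \<in> cyl p (vil_H_enum p n) 0" by blast
    then have "vil_H_enum p m = vil_H_enum p n"
      using assms by (intro vil_H_eqI[of _ p]) (auto simp: cyl_def)
    then show False using vil_H_enum_inj[OF assms] \<open>m \<noteq> n\<close> by simp
  qed
qed

lemma tile_exists:
  assumes "2 \<le> p" "x \<in> vil p"
  obtains n where "x \<in> cyl p (vil_H_enum p n) 0"
proof -
  define h where "h = (\<lambda>j. if j \<le> 0 then x j else 0)"
  have "h \<in> vil_H p" using assms by (auto simp: h_def vil_H_def vil_iff)
  then obtain n where "h = vil_H_enum p n"
    using bij_betw_vil_H_enum[OF assms(1)] by (auto simp: bij_betw_def)
  then have "\<forall>j\<le>0. x j = vil_H_enum p n j" by (simp add: h_def flip: \<open>h = vil_H_enum p n\<close>)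
  then have "x \<in> cyl p (vil_H_enum p n) 0" using assms(2) by (simp add: cyl_def)
  then show thesis by (rule that)
qed

locale vil_haar =
  fixes p :: int and \<mu> :: "digits measure"
  assumes p_ge_2: "2 \<le> p" and haar: "haar_measure p \<mu>"
begin

lemma p_pos [simp]: "0 < p"
  using p_ge_2 by simp

lemma space_eq [simp]: "space \<mu> = vil p"
  using haar by (simp add: haar_measure_def)

text \<open>There are only countably many cosets, so they generate the Borel sets.\<close>

lemma sets_eq: "sets \<mu> = sigma_sets (vil p) (cyls p)"
proof -
  have "sigma_sets (vil p) {S. openin (vil_topology p) S} = sigma_sets (vil p) (cyls p)"
  proof (rule sigma_sets_eqI)
    fix K assume "K \<in> cyls p"
    then show "K \<in> sigma_sets (vil p) {S. openin (vil_topology p) S}"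
      by (auto intro!: sigma_sets.Basic simp: vil_topology_eq topology_generated_by_Basis)
  next
    fix S assume "S \<in> {S. openin (vil_topology p) S}"
    then have S: "openin (vil_topology p) S" by simp
    have "S \<subseteq> \<Union>{K \<in> cyls p. K \<subseteq> S}"
    proof
      fix x assume "x \<in> S"
      then obtain l where "x \<in> vil p" "cyl p x l \<subseteq> S"
        using openin_vil_topology_cyl[OF p_pos S] by blast
      moreover from this have "cyl p x l \<in> cyls p" "x \<in> cyl p x l"
        by (auto simp: cyls_def cyl_self)
      ultimately show "x \<in> \<Union>{K \<in> cyls p. K \<subseteq> S}" by blast
    qed
    then have "S = \<Union>{K \<in> cyls p. K \<subseteq> S}" by blast
    moreover have "countable {K \<in> cyls p. K \<subseteq> S}"
      by (rule countable_subset[OF _ countable_cyls[OF p_pos]]) auto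
    moreover have "sigma_algebra (vil p) (sigma_sets (vil p) (cyls p))"
      by (rule sigma_algebra_sigma_sets) (auto simp: cyls_def cyl_def)
    ultimately show "S \<in> sigma_sets (vil p) (cyls p)"
      by (metis (no_types, lifting) sigma_algebra.countable_Union mem_Collect_eq sigma_sets.Basic
          subsetI)
  qed
  then show ?thesis using haar by (simp add: haar_measure_def)
qed

lemma cyl_sets [measurable, simp]: "a \<in> vil p \<Longrightarrow> cyl p a l \<in> sets \<mu>"
  unfolding sets_eq by (rule sigma_sets.Basic) (auto simp: cyls_def)

text \<open>Preimages under such a function are unions of cosets, necessarily countable unions. This
  covers the characters, which are locally constant.\<close>

lemma measurable_coset_constant:
  assumes "\<And>x y. x \<in> vil p \<Longrightarrow> y \<in> vil p \<Longrightarrow> (\<And>j. j \<le> l \<Longrightarrow> x j = y j) \<Longrightarrow> f x = f y"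
  shows "f \<in> measurable \<mu> (count_space UNIV)"
proof (rule measurableI)
  fix A
  have "f -` A \<inter> vil p \<subseteq> \<Union>{K \<in> cyls p. K \<subseteq> f -` A \<inter> vil p}"
  proof
    fix x assume x: "x \<in> f -` A \<inter> vil p"
    have "f y = f x" if "y \<in> cyl p x l" for y
      using x that by (intro assms) (auto simp: cyl_def)
    then have "cyl p x l \<subseteq> f -` A \<inter> vil p" using x by (auto simp: cyl_def)
    moreover have "cyl p x l \<in> cyls p" "x \<in> cyl p x l"
      using x by (auto simp: cyls_def cyl_self)
    ultimately show "x \<in> \<Union>{K \<in> cyls p. K \<subseteq> f -` A \<inter> vil p}" by blast
  qed
  then have "f -` A \<inter> vil p = \<Union>{K \<in> cyls p. K \<subseteq> f -` A \<inter> vil p}" by blast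
  also have "\<dots> \<in> sets \<mu>"
    by (intro sets.countable_Union countable_subset[OF _ countable_cyls[OF p_pos]])
       (auto simp: cyls_def)
  finally show "f -` A \<inter> space \<mu> \<in> sets \<mu>" by simp
qed simp

lemma borel_measurable_coset_constant:
  fixes f :: "digits \<Rightarrow> 'b::topological_space"
  assumes "\<And>x y. x \<in> vil p \<Longrightarrow> y \<in> vil p \<Longrightarrow> (\<And>j. j \<le> l \<Longrightarrow> x j = y j) \<Longrightarrow> f x = f y"
  shows "f \<in> borel_measurable \<mu>"
  by (rule measurable_compose[OF measurable_coset_constant[OF assms], of l "\<lambda>x. x"]) auto

lemma vil_add_vimage_cyl:
  assumes "a \<in> vil p" "b \<in> vil p"
  shows "vil_add p a -` cyl p b l \<inter> vil p = cyl p (vil_diff p b a) l"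
proof
  show "vil_add p a -` cyl p b l \<inter> vil p \<subseteq> cyl p (vil_diff p b a) l"
  proof
    fix x assume x: "x \<in> vil_add p a -` cyl p b l \<inter> vil p"
    have "x j = vil_diff p b a j" if "j \<le> l" for j
    proof -
      have "vil_diff p b a j = vil_diff p (vil_add p a x) a j"
        using x that by (simp add: cyl_def vil_diff_def)
      then show ?thesis using x by simp
    qed
    then show "x \<in> cyl p (vil_diff p b a) l" using x by (auto simp: cyl_def)
  qed
  have "vil_add p a ` cyl p (vil_diff p b a) l = cyl p b l"
    using assms by (subst vil_add_image_cyl) auto
  then show "cyl p (vil_diff p b a) l \<subseteq> vil_add p a -` cyl p b l \<inter> vil p"
    using cyl_subset by blast
qed

lemma vil_add_measurable [measurable]:
  assumes "a \<in> vil p"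
  shows "vil_add p a \<in> measurable \<mu> \<mu>"
proof (rule measurable_sigma_sets[OF sets_eq])
  show "cyls p \<subseteq> Pow (vil p)" by (auto simp: cyls_def cyl_def)
  show "vil_add p a \<in> space \<mu> \<rightarrow> vil p" using assms by simp
  show "vil_add p a -` K \<inter> space \<mu> \<in> sets \<mu>" if "K \<in> cyls p" for K
    using that assms by (auto simp: cyls_def vil_add_vimage_cyl)
qed

lemma vil_add_measurable' [measurable]:
  "a \<in> vil p \<Longrightarrow> (\<lambda>x. vil_add p x a) \<in> measurable \<mu> \<mu>"
  using vil_add_measurable[of a] by (simp add: vil_add_commute[of p a] cong: measurable_cong)

lemma emeasure_vil_add_image:
  "a \<in> vil p \<Longrightarrow> A \<in> sets \<mu> \<Longrightarrow> emeasure \<mu> (vil_add p a ` A) = emeasure \<mu> A"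
  using haar by (simp add: haar_measure_def)

lemma distr_vil_add:
  assumes a: "a \<in> vil p"
  shows "distr \<mu> \<mu> (vil_add p a) = \<mu>"
proof (rule measure_eqI)
  fix A assume "A \<in> sets (distr \<mu> \<mu> (vil_add p a))"
  then have A: "A \<in> sets \<mu>" by simp
  then have "A \<subseteq> vil p" using sets.sets_into_space by fastforce
  then have "A = vil_add p a ` (vil_add p a -` A \<inter> vil p)"
  proof (intro equalityI subsetI)
    fix x assume x: "x \<in> A"
    then have "x = vil_add p a (vil_diff p x a)" "vil_diff p x a \<in> vil p"
      using \<open>A \<subseteq> vil p\<close> a by auto
    then show "x \<in> vil_add p a ` (vil_add p a -` A \<inter> vil p)" using x by (metis IntI image_eqI vimageI)
  qed auto
  moreover have "vil_add p a -` A \<inter> vil p \<in> sets \<mu>"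
    using measurable_sets[OF vil_add_measurable[OF a] A] by simp
  ultimately have "emeasure \<mu> A = emeasure \<mu> (vil_add p a -` A \<inter> vil p)"
    using emeasure_vil_add_image[OF a] by metis
  then show "emeasure (distr \<mu> \<mu> (vil_add p a)) A = emeasure \<mu> A"
    using A a by (simp add: emeasure_distr)
qed simp

lemma nn_integral_translate:
  "a \<in> vil p \<Longrightarrow> f \<in> borel_measurable \<mu> \<Longrightarrow>
    (\<integral>\<^sup>+x. f (vil_add p a x) \<partial>\<mu>) = (\<integral>\<^sup>+x. f x \<partial>\<mu>)"
  using nn_integral_distr[of "vil_add p a" \<mu> \<mu> f] by (simp add: distr_vil_add)

lemma integral_translate:
  fixes f :: "digits \<Rightarrow> 'b::{banach, second_countable_topology}"
  shows "a \<in> vil p \<Longrightarrow> f \<in> borel_measurable \<mu> \<Longrightarrow>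
    (LINT x|\<mu>. f (vil_add p a x)) = (LINT x|\<mu>. f x)"
  using integral_distr[of "vil_add p a" \<mu> \<mu> f] by (simp add: distr_vil_add)

lemma integrable_translate:
  fixes f :: "digits \<Rightarrow> 'b::{banach, second_countable_topology}"
  shows "a \<in> vil p \<Longrightarrow> integrable \<mu> f \<Longrightarrow> integrable \<mu> (\<lambda>x. f (vil_add p a x))"
  using integrable_distr[of "vil_add p a" \<mu> \<mu> f] by (simp add: distr_vil_add)

lemma emeasure_cyl_translate:
  assumes "a \<in> vil p"
  shows "emeasure \<mu> (cyl p a l) = emeasure \<mu> (cyl p (\<lambda>_. 0) l)"
proof -
  have "cyl p a l = vil_add p a ` cyl p (\<lambda>_. 0) l"
    using assms by (simp add: vil_add_image_cyl)
  then show ?thesis using emeasure_vil_add_image assms by simp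
qed

text \<open>A coset of \<open>U\<^sub>l\<close> splits into \<open>p\<close> cosets of \<open>U\<^bsub>l+1\<^esub>\<close> according to the digit at \<open>l + 1\<close>.\<close>

lemma emeasure_cyl_Suc:
  "emeasure \<mu> (cyl p (\<lambda>_. 0) l) = ennreal (real_of_int p) * emeasure \<mu> (cyl p (\<lambda>_. 0) (l + 1))"
proof -
  define b where "b d = (\<lambda>j. if j = l + 1 then d else (0::int))" for d
  have b: "b d \<in> vil p" if "d \<in> {0..<p}" for d
    using that p_pos by (auto simp: vil_iff b_def intro!: exI[of _ l])
  have "x \<in> cyl p (b (x (l + 1))) (l + 1)" if "x \<in> cyl p (\<lambda>_. 0) l" for x
    using that by (auto simp: cyl_def b_def)
  moreover have "x (l + 1) \<in> {0..<p}" if "x \<in> cyl p (\<lambda>_. 0) l" for x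
    using that by (simp add: cyl_def vil_iff)
  moreover have "cyl p (b d) (l + 1) \<subseteq> cyl p (\<lambda>_. 0) l" for d
    by (auto simp: cyl_def b_def)
  ultimately have "cyl p (\<lambda>_. 0) l = (\<Union>d\<in>{0..<p}. cyl p (b d) (l + 1))" by fast
  then have "emeasure \<mu> (cyl p (\<lambda>_. 0) l) = emeasure \<mu> (\<Union>d\<in>{0..<p}. cyl p (b d) (l + 1))"
    by simp
  also have "\<dots> = (\<Sum>d\<in>{0..<p}. emeasure \<mu> (cyl p (b d) (l + 1)))"
    by (rule sum_emeasure[symmetric])
       (use b in auto, auto simp: disjoint_family_on_def cyl_def b_def)
  also have "\<dots> = (\<Sum>d\<in>{0..<p}. emeasure \<mu> (cyl p (\<lambda>_. 0) (l + 1)))"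
    by (intro sum.cong refl emeasure_cyl_translate b)
  also have "\<dots> = ennreal (real_of_int p) * emeasure \<mu> (cyl p (\<lambda>_. 0) (l + 1))"
    using p_pos by (simp add: ennreal_of_nat_eq_real_of_nat del: p_pos)
  finally show ?thesis .
qed

lemma emeasure_cyl:
  assumes "a \<in> vil p"
  shows "emeasure \<mu> (cyl p a l) = ennreal (real_of_int p powi (- l))"
proof -
  have "emeasure \<mu> (cyl p (\<lambda>_. 0) l) = ennreal (real_of_int p powi (- l))"
  proof (induction l rule: int_induct[of _ 0])
    case base
    then show ?case using haar by (simp add: haar_measure_def vil_nbhd_eq_cyl)
  next
    case (step1 i)
    have "ennreal (real_of_int p) * emeasure \<mu> (cyl p (\<lambda>_. 0) (i + 1))
        = ennreal (real_of_int p) * ennreal (real_of_int p powi (- (i + 1)))"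
    proof -
      have "real_of_int p powi (- i) = real_of_int p * real_of_int p powi (- (i + 1))"
        using p_ge_2 power_int_add_1'[of "real_of_int p" "- (i + 1)"] by simp
      then show ?thesis
        using emeasure_cyl_Suc[of i] step1 p_pos by (metis ennreal_mult' of_int_0_le_iff less_imp_le)
    qed
    then show ?case
      using p_pos by (subst (asm) ennreal_mult_cancel_left) auto
  next
    case (step2 i)
    have "real_of_int p powi (- (i - 1)) = real_of_int p * real_of_int p powi (- i)"
      using p_ge_2 power_int_add_1'[of "real_of_int p" "- i"] by simp
    moreover have "emeasure \<mu> (cyl p (\<lambda>_. 0) (i - 1))
        = ennreal (real_of_int p) * ennreal (real_of_int p powi (- i))"
      using emeasure_cyl_Suc[of "i - 1"] step2 by simp
    moreover have "ennreal (real_of_int p * real_of_int p powi (- i))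
        = ennreal (real_of_int p) * ennreal (real_of_int p powi (- i))"
      using p_ge_2 by (intro ennreal_mult') simp
    ultimately show ?case by (simp only:)
  qed
  then show ?thesis by (simp only: emeasure_cyl_translate[OF assms])
qed

lemma measure_cyl: "a \<in> vil p \<Longrightarrow> measure \<mu> (cyl p a l) = real_of_int p powi (- l)"
  using p_pos by (simp add: measure_def emeasure_cyl)

lemma emeasure_cyl_finite [simp]: "a \<in> vil p \<Longrightarrow> emeasure \<mu> (cyl p a l) < top"
  by (simp add: emeasure_cyl)

text \<open>The basic periodization formula: the integral over a tile is moved to \<open>U\<close> by translation.\<close>

lemma nn_integral_tiles:
  fixes f :: "digits \<Rightarrow> ennreal"
  assumes [measurable]: "f \<in> borel_measurable \<mu>"
  shows "(\<integral>\<^sup>+x. f x \<partial>\<mu>)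
    = (\<Sum>n. \<integral>\<^sup>+x. f (vil_add p x (vil_H_enum p n)) * indicator (cyl p (\<lambda>_. 0) 0) x \<partial>\<mu>)"
proof -
  note [simp] = p_ge_2
  let ?h = "vil_H_enum p"
  have "(\<integral>\<^sup>+x. f x \<partial>\<mu>) = (\<integral>\<^sup>+x. (\<Sum>n. f x * indicator (cyl p (?h n) 0) x) \<partial>\<mu>)"
  proof (rule nn_integral_cong)
    fix x assume "x \<in> space \<mu>"
    then obtain n where "x \<in> cyl p (?h n) 0" using tile_exists[OF p_ge_2] by auto
    from suminf_cmult_indicator[OF disjoint_tiles[OF p_ge_2] this, of "\<lambda>_. f x"]
    show "f x = (\<Sum>n. f x * indicator (cyl p (?h n) 0) x)" by (rule sym)
  qed
  also have "\<dots> = (\<Sum>n. \<integral>\<^sup>+x. f x * indicator (cyl p (?h n) 0) x \<partial>\<mu>)"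
    by (rule nn_integral_suminf) measurable
  also have "(\<lambda>n. \<integral>\<^sup>+x. f x * indicator (cyl p (?h n) 0) x \<partial>\<mu>)
      = (\<lambda>n. \<integral>\<^sup>+x. f (vil_add p x (?h n)) * indicator (cyl p (\<lambda>_. 0) 0) x \<partial>\<mu>)"
  proof
    fix n
    have "(\<integral>\<^sup>+x. f x * indicator (cyl p (?h n) 0) x \<partial>\<mu>)
        = (\<integral>\<^sup>+x. f (vil_add p (?h n) x) * indicator (cyl p (?h n) 0) (vil_add p (?h n) x) \<partial>\<mu>)"
      by (rule nn_integral_translate[symmetric]) auto
    also have "\<dots> = (\<integral>\<^sup>+x. f (vil_add p x (?h n)) * indicator (cyl p (\<lambda>_. 0) 0) x \<partial>\<mu>)"
    proof (rule nn_integral_cong)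
      fix x assume x: "x \<in> space \<mu>"
      have "vil_add p (?h n) -` cyl p (?h n) 0 \<inter> vil p = cyl p (\<lambda>_. 0) 0"
        by (subst vil_add_vimage_cyl) (auto simp: vil_diff_def)
      then have "vil_add p (?h n) x \<in> cyl p (?h n) 0 \<longleftrightarrow> x \<in> cyl p (\<lambda>_. 0) 0"
        using x by auto
      then show "f (vil_add p (?h n) x) * indicator (cyl p (?h n) 0) (vil_add p (?h n) x)
          = f (vil_add p x (?h n)) * indicator (cyl p (\<lambda>_. 0) 0) x"
        by (simp add: vil_add_commute indicator_def)
    qed
    finally show "(\<integral>\<^sup>+x. f x * indicator (cyl p (?h n) 0) x \<partial>\<mu>)
        = (\<integral>\<^sup>+x. f (vil_add p x (?h n)) * indicator (cyl p (\<lambda>_. 0) 0) x \<partial>\<mu>)" .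
  qed
  finally show ?thesis .
qed

end

section \<open>Characters\<close>

definition root_char :: "int \<Rightarrow> int \<Rightarrow> complex" where
  "root_char p n = exp (2 * of_real pi * \<i> / of_int p * of_int n)"

lemma root_char_add: "root_char p (m + n) = root_char p m * root_char p n"
  by (simp add: root_char_def distrib_left exp_add)

lemma root_char_eq_cis: "root_char p n = cis (2 * pi * of_int n / of_int p)"
  by (simp add: root_char_def cis_conv_exp mult_ac)

lemma norm_root_char [simp]: "cmod (root_char p n) = 1"
  by (simp add: root_char_eq_cis)

lemma root_char_zero [simp]: "root_char p 0 = 1"
  by (simp add: root_char_def)

lemma root_char_mult_period: "0 < p \<Longrightarrow> root_char p (p * k) = 1"
  using cis_multiple_2pi[of "of_int k"] by (simp add: root_char_eq_cis mult.assoc)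

lemma root_char_cong:
  assumes "0 < p" "m mod p = n mod p"
  shows "root_char p m = root_char p n"
proof -
  have "root_char p k = root_char p (k mod p)" for k
    using root_char_add[of p "p * (k div p)" "k mod p"] root_char_mult_period[OF assms(1)] by simp
  then show ?thesis using assms(2) by metis
qed

lemma root_char_neq_1:
  assumes "0 < n" "n < p"
  shows "root_char p n \<noteq> 1"
proof
  assume "root_char p n = 1"
  then obtain k :: int where "2 * pi * of_int n / of_int p = of_int (2 * k) * pi"
    unfolding root_char_eq_cis cis_conv_exp exp_eq_1 by auto
  then have "real_of_int n = real_of_int (k * p)" using assms by (simp add: field_simps)
  then have "n = k * p" by linarith
  then have "p dvd n" by simp
  then show False using assms zdvd_imp_le by fastforce
qed

lemma vil_in_cyl_zero:
  assumes "x \<in> vil p"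
  obtains l where "x \<in> cyl p (\<lambda>_. 0) l"
proof -
  obtain k where "\<forall>j<k. x j = 0" using assms by (auto simp: vil_iff)
  then have "x \<in> cyl p (\<lambda>_. 0) (k - 1)" using assms by (auto simp: cyl_def)
  then show thesis by (rule that)
qed

lemma finite_vil_char_support:
  assumes "x \<in> vil p" "\<omega> \<in> vil p"
  shows "finite {j. x j * \<omega> (1 - j) \<noteq> 0}"
proof -
  obtain k l where "\<forall>j<k. x j = 0" "\<forall>j<l. \<omega> j = 0" using assms by (auto simp: vil_iff)
  then have "{j. x j * \<omega> (1 - j) \<noteq> 0} \<subseteq> {k..1 - l}" by force
  then show ?thesis by (rule finite_subset) simp
qed

lemma vil_char_eq:
  assumes "finite J" "{j. x j * \<omega> (1 - j) \<noteq> 0} \<subseteq> J"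
  shows "vil_char p x \<omega> = root_char p (\<Sum>j\<in>J. x j * \<omega> (1 - j))"
proof -
  have "(\<Sum>j | x j * \<omega> (1 - j) \<noteq> 0. x j * \<omega> (1 - j)) = (\<Sum>j\<in>J. x j * \<omega> (1 - j))"
    using assms by (intro sum.mono_neutral_left) auto
  then show ?thesis by (simp add: vil_char_def root_char_def)
qed

lemma norm_vil_char [simp]: "cmod (vil_char p x \<omega>) = 1"
  unfolding vil_char_def root_char_def[symmetric] by simp

lemma vil_char_commute: "vil_char p x \<omega> = vil_char p \<omega> x"
proof -
  have "(\<Sum>j | x j * \<omega> (1 - j) \<noteq> 0. x j * \<omega> (1 - j)) = (\<Sum>j | \<omega> j * x (1 - j) \<noteq> 0. \<omega> j * x (1 - j))"
    by (rule sum.reindex_bij_witness[of _ "\<lambda>j. 1 - j" "\<lambda>j. 1 - j"]) (auto simp: mult.commute)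
  then show ?thesis by (simp add: vil_char_def)
qed

lemma vil_char_add:
  assumes "0 < p" "x \<in> vil p" "y \<in> vil p" "\<omega> \<in> vil p"
  shows "vil_char p (vil_add p x y) \<omega> = vil_char p x \<omega> * vil_char p y \<omega>"
proof -
  let ?S = "\<lambda>x. {j. x j * \<omega> (1 - j) \<noteq> 0}" and ?J = "\<lambda>x J. \<Sum>j\<in>J. x j * \<omega> (1 - j)"
  define J where "J = ?S x \<union> ?S y \<union> ?S (vil_add p x y)"
  have J: "finite J" unfolding J_def using assms by (intro finite_UnI finite_vil_char_support) simp_all
  have *: "vil_add p x y j * \<omega> (1 - j) mod p = (x j * \<omega> (1 - j) + y j * \<omega> (1 - j)) mod p" for j
    unfolding vil_add_def mod_mult_left_eq distrib_right ..
  have "?J (vil_add p x y) J mod p = (\<Sum>j\<in>J. vil_add p x y j * \<omega> (1 - j) mod p) mod p"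
    by (rule mod_sum_eq[symmetric])
  also have "\<dots> = (\<Sum>j\<in>J. x j * \<omega> (1 - j) + y j * \<omega> (1 - j)) mod p"
    unfolding * by (rule mod_sum_eq)
  also have "\<dots> = (?J x J + ?J y J) mod p" unfolding sum.distrib ..
  finally have "?J (vil_add p x y) J mod p = (?J x J + ?J y J) mod p" .
  then have "root_char p (?J (vil_add p x y) J) = root_char p (?J x J) * root_char p (?J y J)"
    unfolding root_char_add[symmetric] by (rule root_char_cong[OF assms(1)])
  moreover have "?S x \<subseteq> J" "?S y \<subseteq> J" "?S (vil_add p x y) \<subseteq> J" by (auto simp: J_def)
  ultimately show ?thesis by (simp only: vil_char_eq[OF J])
qed

text \<open>Where \<open>x\<close> and \<open>y\<close> may differ, at \<open>j > l\<close>, the digit of \<open>\<omega>\<close> paired with them has index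
  \<open>1 - j \<le> -l\<close> and vanishes.\<close>

lemma vil_char_coset_constant:
  assumes \<omega>: "\<omega> \<in> cyl p (\<lambda>_. 0) (- l)" and "\<And>j. j \<le> l \<Longrightarrow> x j = y j"
  shows "vil_char p x \<omega> = vil_char p y \<omega>"
proof -
  have "x j * \<omega> (1 - j) = y j * \<omega> (1 - j)" for j
    using assms by (cases "j \<le> l") (auto simp: cyl_def)
  then show ?thesis by (simp only: vil_char_def)
qed

lemma vil_char_zero [simp]: "vil_char p (\<lambda>_. 0) \<omega> = 1"
  by (simp add: vil_char_def)

lemma vil_char_diff:
  assumes "0 < p" "x \<in> vil p" "y \<in> vil p" "\<omega> \<in> vil p"
  shows "vil_char p (vil_diff p x y) \<omega> = vil_char p x \<omega> * cnj (vil_char p y \<omega>)"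
proof -
  have "vil_char p x \<omega> = vil_char p y \<omega> * vil_char p (vil_diff p x y) \<omega>"
    using vil_char_add[of p y "vil_diff p x y" \<omega>] assms by simp
  then have "vil_char p x \<omega> * cnj (vil_char p y \<omega>)
      = (vil_char p y \<omega> * cnj (vil_char p y \<omega>)) * vil_char p (vil_diff p x y) \<omega>"
    by simp
  then show ?thesis by (simp flip: complex_norm_square)
qed

context vil_haar begin

lemma vil_char_measurable [measurable]:
  assumes "\<omega> \<in> vil p"
  shows "(\<lambda>x. vil_char p x \<omega>) \<in> borel_measurable \<mu>"
proof -
  obtain l where "\<omega> \<in> cyl p (\<lambda>_. 0) (- (- l))" using vil_in_cyl_zero[OF assms] by auto
  from vil_char_coset_constant[OF this] show ?thesis
    by (rule borel_measurable_coset_constant[of "- l"])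
qed

lemma vil_char_measurable' [measurable]:
  "\<omega> \<in> vil p \<Longrightarrow> (\<lambda>x. vil_char p \<omega> x) \<in> borel_measurable \<mu>"
  by (subst vil_char_commute) (rule vil_char_measurable)

lemma indicator_cyl_add:
  assumes "a \<in> vil p" "x \<in> vil p"
  shows "indicator (cyl p a l) (vil_add p a x) = (indicator (cyl p (\<lambda>_. 0) l) x :: 'b::zero_neq_one)"
proof -
  have "vil_add p a -` cyl p a l \<inter> vil p = cyl p (\<lambda>_. 0) l"
    using assms by (subst vil_add_vimage_cyl) (auto simp: vil_diff_def)
  then have "vil_add p a x \<in> cyl p a l \<longleftrightarrow> x \<in> cyl p (\<lambda>_. 0) l" using assms(2) by blast
  then show ?thesis by (simp add: indicator_def)
qed

text \<open>A character that is nontrivial on the subgroup \<open>U\<^sub>l\<close> has integral zero over it: translating by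
  an element \<open>a\<close> of \<open>U\<^sub>l\<close> multiplies the integral by the value \<open>\<noteq> 1\<close> of the character at \<open>a\<close>.\<close>

lemma integral_vil_char_cyl:
  assumes \<omega>: "\<omega> \<in> vil p"
  shows "(LINT x|\<mu>. indicator (cyl p (\<lambda>_. 0) l) x * vil_char p x \<omega>)
    = (if \<omega> \<in> cyl p (\<lambda>_. 0) (- l) then of_real (real_of_int p powi (- l)) else 0)"
proof (cases "\<omega> \<in> cyl p (\<lambda>_. 0) (- l)")
  case True
  have "vil_char p x \<omega> = 1" if "x \<in> cyl p (\<lambda>_. 0) l" for x
    using vil_char_coset_constant[OF True, of x "\<lambda>_. 0"] that by (simp add: cyl_def)
  then have "(LINT x|\<mu>. indicator (cyl p (\<lambda>_. 0) l) x * vil_char p x \<omega>)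
      = (LINT x|\<mu>. (indicator (cyl p (\<lambda>_. 0) l) x :: complex))"
    by (intro Bochner_Integration.integral_cong) (auto simp: indicator_def)
  also have "\<dots> = of_real (measure \<mu> (cyl p (\<lambda>_. 0) l))"
    by (intro has_bochner_integral_integral_eq has_bochner_integral_complex_indicator) auto
  finally show ?thesis using True by (simp add: measure_cyl)
next
  case False
  then obtain j where j: "j \<le> - l" "\<omega> j \<noteq> 0" using \<omega> by (auto simp: cyl_def)
  \<comment> \<open>The unit at position \<open>1 - j\<close> pairs with the nonzero digit \<open>\<omega>\<^sub>j\<close>; as \<open>1 - j > l\<close>, it lies in
    \<open>U\<^sub>l\<close>.\<close>
  define a where "a = (\<lambda>i. if i = 1 - j then 1 else (0::int))"
  have a: "a \<in> vil p" using p_ge_2 by (auto simp: a_def vil_iff intro!: exI[of _ "1 - j"])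
  have "a \<in> cyl p (\<lambda>_. 0) l" using a j by (auto simp: cyl_def a_def)
  then have cyl_a: "cyl p a l = cyl p (\<lambda>_. 0) l" by (rule cyl_eq)
  have "vil_char p a \<omega> = root_char p (\<omega> j)"
    by (subst vil_char_eq[of "{1 - j}"]) (auto simp: a_def)
  moreover have "0 < \<omega> j" "\<omega> j < p" using \<omega> j(2) by (auto simp: vil_iff order_less_le)
  ultimately have ne: "vil_char p a \<omega> \<noteq> 1" using root_char_neq_1 by simp
  let ?I = "LINT x|\<mu>. indicator (cyl p (\<lambda>_. 0) l) x * vil_char p x \<omega>"
  have "?I = (LINT x|\<mu>. indicator (cyl p a l) (vil_add p a x) * vil_char p (vil_add p a x) \<omega>)"
    unfolding cyl_a by (rule integral_translate[symmetric]) (use a \<omega> in measurable)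
  also have "\<dots> = (LINT x|\<mu>. vil_char p a \<omega> * (indicator (cyl p (\<lambda>_. 0) l) x * vil_char p x \<omega>))"
    by (rule Bochner_Integration.integral_cong)
       (use a \<omega> in \<open>simp_all add: indicator_cyl_add vil_char_add\<close>)
  also have "\<dots> = vil_char p a \<omega> * ?I" by simp
  finally have "(vil_char p a \<omega> - 1) * ?I = 0" by (simp add: algebra_simps)
  then show ?thesis using ne False by simp
qed

lemma integrable_mult_vil_char:
  assumes f: "integrable \<mu> f" and \<omega>: "\<omega> \<in> vil p"
  shows "integrable \<mu> (\<lambda>x. f x * cnj (vil_char p x \<omega>))"
proof (rule Bochner_Integration.integrable_bound[OF f])
  show "(\<lambda>x. f x * cnj (vil_char p x \<omega>)) \<in> borel_measurable \<mu>"
    using f \<omega> by (intro borel_measurable_times complex_borel_measurable_cnj) auto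
qed (simp add: norm_mult)

lemma fourier_L1_diff:
  assumes "integrable \<mu> f" "integrable \<mu> g" "\<omega> \<in> vil p"
  shows "vil_fourier_L1 p \<mu> (\<lambda>x. f x - g x) \<omega> = vil_fourier_L1 p \<mu> f \<omega> - vil_fourier_L1 p \<mu> g \<omega>"
  using integrable_mult_vil_char assms by (simp add: vil_fourier_L1_def left_diff_distrib)

lemma fourier_L1_sum:
  assumes "\<And>i. i \<in> I \<Longrightarrow> integrable \<mu> (f i)" "\<omega> \<in> vil p"
  shows "vil_fourier_L1 p \<mu> (\<lambda>x. \<Sum>i\<in>I. c i * f i x) \<omega> = (\<Sum>i\<in>I. c i * vil_fourier_L1 p \<mu> (f i) \<omega>)"
proof -
  have "vil_fourier_L1 p \<mu> (\<lambda>x. \<Sum>i\<in>I. c i * f i x) \<omega>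
      = (LINT x|\<mu>. (\<Sum>i\<in>I. c i * (f i x * cnj (vil_char p x \<omega>))))"
    by (simp add: vil_fourier_L1_def sum_distrib_right mult.assoc)
  also have "\<dots> = (\<Sum>i\<in>I. c i * vil_fourier_L1 p \<mu> (f i) \<omega>)"
    using assms by (subst Bochner_Integration.integral_sum)
      (auto simp: vil_fourier_L1_def intro!: integrable_mult_vil_char)
  finally show ?thesis .
qed

lemma norm_fourier_L1_le:
  assumes "integrable \<mu> f"
  shows "cmod (vil_fourier_L1 p \<mu> f \<omega>) \<le> (LINT x|\<mu>. cmod (f x))"
proof -
  have "cmod (vil_fourier_L1 p \<mu> f \<omega>) \<le> (LINT x|\<mu>. cmod (f x * cnj (vil_char p x \<omega>)))"
    unfolding vil_fourier_L1_def by (rule integral_norm_bound)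
  then show ?thesis by (simp add: norm_mult)
qed

lemma vil_diff_measurable:
  assumes "a \<in> vil p"
  shows "(\<lambda>x. vil_diff p x a) \<in> measurable \<mu> \<mu>"
proof -
  have "(\<lambda>x. vil_diff p x a) = vil_add p (vil_diff p (\<lambda>_. 0) a)"
    by (rule ext) (rule vil_diff_eq_add_neg)
  then show ?thesis using vil_add_measurable assms by simp
qed

lemma fourier_L1_translate:
  assumes f: "integrable \<mu> f" and a: "a \<in> vil p" and \<omega>: "\<omega> \<in> vil p"
  shows "vil_fourier_L1 p \<mu> (vil_translate p a f) \<omega>
    = cnj (vil_char p a \<omega>) * vil_fourier_L1 p \<mu> f \<omega>"
proof -
  have "vil_fourier_L1 p \<mu> (vil_translate p a f) \<omega>
      = (LINT x|\<mu>. f (vil_diff p (vil_add p a x) a) * cnj (vil_char p (vil_add p a x) \<omega>))"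
    unfolding vil_fourier_L1_def vil_translate_def
  proof (rule integral_translate[symmetric, OF a])
    have "(\<lambda>x. vil_diff p x a) \<in> measurable \<mu> \<mu>"
      by (rule vil_diff_measurable[OF a])
    then show "(\<lambda>x. f (vil_diff p x a) * cnj (vil_char p x \<omega>)) \<in> borel_measurable \<mu>"
      using f \<omega> by (intro borel_measurable_times complex_borel_measurable_cnj vil_char_measurable)
        (auto intro: measurable_compose)
  qed
  also have "\<dots> = (LINT x|\<mu>. cnj (vil_char p a \<omega>) * (f x * cnj (vil_char p x \<omega>)))"
    by (rule Bochner_Integration.integral_cong) (use a \<omega> in \<open>simp_all add: vil_char_add\<close>)
  finally show ?thesis by (simp add: vil_fourier_L1_def)
qed

lemma integrable_indicator_cyl [simp]:
  "a \<in> vil p \<Longrightarrow> integrable \<mu> (indicator (cyl p a l) :: _ \<Rightarrow> complex)"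
  by (rule integrable.intros[OF has_bochner_integral_complex_indicator]) auto

lemma fourier_L1_cyl:
  assumes a: "a \<in> vil p" and \<omega>: "\<omega> \<in> vil p"
  shows "vil_fourier_L1 p \<mu> (indicator (cyl p a l)) \<omega>
    = of_real (real_of_int p powi (- l)) * cnj (vil_char p a \<omega>) * indicator (cyl p (\<lambda>_. 0) (- l)) \<omega>"
proof -
  have "vil_fourier_L1 p \<mu> (indicator (cyl p a l)) \<omega>
      = (LINT x|\<mu>. indicator (cyl p a l) (vil_add p a x) * cnj (vil_char p (vil_add p a x) \<omega>))"
    unfolding vil_fourier_L1_def
    by (rule integral_translate[symmetric, OF a])
       (use a \<omega> in \<open>auto intro!: borel_measurable_times complex_borel_measurable_cnj\<close>)
  also have "\<dots> = (LINT x|\<mu>. cnj (vil_char p a \<omega>) * cnj (indicator (cyl p (\<lambda>_. 0) l) x * vil_char p x \<omega>))"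
    by (rule Bochner_Integration.integral_cong)
       (use a \<omega> in \<open>simp_all add: indicator_cyl_add vil_char_add, simp add: indicator_def\<close>)
  also have "\<dots> = cnj (vil_char p a \<omega>) * cnj (LINT x|\<mu>. indicator (cyl p (\<lambda>_. 0) l) x * vil_char p x \<omega>)"
    by (simp only: integral_mult_right_zero Bochner_Integration.integral_cnj)
  finally show ?thesis
    unfolding integral_vil_char_cyl[OF \<omega>]
    by (cases "\<omega> \<in> cyl p (\<lambda>_. 0) (- l)") (simp_all add: mult.commute)
qed

end

section \<open>Plancherel's theorem\<close>

definition coset_step :: "int \<Rightarrow> (digits \<Rightarrow> complex) \<Rightarrow> bool" where
  "coset_step p f \<longleftrightarrow> (\<exists>I c. finite I \<and> (\<forall>i\<in>I. fst i \<in> vil p) \<and>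
     f = (\<lambda>x. \<Sum>i\<in>I. c i * indicator (cyl p (fst i) (snd i)) x))"

lemma coset_step_scale:
  assumes "coset_step p f"
  shows "coset_step p (\<lambda>x. c * f x)"
proof -
  obtain I d where *: "finite I" "\<forall>i\<in>I. fst i \<in> vil p"
    and f: "f = (\<lambda>x. \<Sum>i\<in>I. d i * indicator (cyl p (fst i) (snd i)) x)"
    using assms by (auto simp: coset_step_def)
  have "(\<lambda>x. c * f x) = (\<lambda>x. \<Sum>i\<in>I. (c * d i) * indicator (cyl p (fst i) (snd i)) x)"
    by (simp add: f sum_distrib_left mult.assoc)
  with * show ?thesis
    unfolding coset_step_def by (intro exI[of _ I] exI[of _ "\<lambda>i. c * d i"] conjI)
qed

lemma coset_step_add:
  assumes "coset_step p f" "coset_step p g"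
  shows "coset_step p (\<lambda>x. f x + g x)"
proof -
  obtain I c where I: "finite I" "\<forall>i\<in>I. fst i \<in> vil p"
    and f: "f = (\<lambda>x. \<Sum>i\<in>I. c i * indicator (cyl p (fst i) (snd i)) x)"
    using assms(1) by (auto simp: coset_step_def)
  obtain J d where J: "finite J" "\<forall>i\<in>J. fst i \<in> vil p"
    and g: "g = (\<lambda>x. \<Sum>i\<in>J. d i * indicator (cyl p (fst i) (snd i)) x)"
    using assms(2) by (auto simp: coset_step_def)
  define e where "e i = (if i \<in> I then c i else 0) + (if i \<in> J then d i else 0)" for i
  have "f x + g x = (\<Sum>i\<in>I \<union> J. e i * indicator (cyl p (fst i) (snd i)) x)" for x
  proof -
    have "f x = (\<Sum>i\<in>I \<union> J. (if i \<in> I then c i else 0) * indicator (cyl p (fst i) (snd i)) x)"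
      unfolding f using I(1) J(1) by (intro sum.mono_neutral_cong_left) auto
    moreover have "g x = (\<Sum>i\<in>I \<union> J. (if i \<in> J then d i else 0) * indicator (cyl p (fst i) (snd i)) x)"
      unfolding g using I(1) J(1) by (intro sum.mono_neutral_cong_left) auto
    ultimately show ?thesis by (simp add: e_def distrib_right sum.distrib)
  qed
  then show ?thesis
    unfolding coset_step_def using I J
    by (intro exI[of _ "I \<union> J"] exI[of _ e]) auto
qed

lemma coset_step_diff:
  "coset_step p f \<Longrightarrow> coset_step p g \<Longrightarrow> coset_step p (\<lambda>x. f x - g x)"
  using coset_step_add[of p f "\<lambda>x. (-1) * g x"] coset_step_scale[of p g "-1"] by simp

lemma coset_step_indicator: "a \<in> vil p \<Longrightarrow> coset_step p (indicator (cyl p a l))"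
  unfolding coset_step_def by (intro exI[of _ "{(a, l)}"] exI[of _ "\<lambda>_. 1"]) auto

lemma coset_step_zero: "coset_step p (\<lambda>_. 0)"
  unfolding coset_step_def by (intro exI[of _ "{}"]) auto

context vil_haar begin

lemma coset_step_integrable: "coset_step p f \<Longrightarrow> integrable \<mu> f"
  by (auto simp: coset_step_def intro!: Bochner_Integration.integrable_sum integrable_mult_right)

lemma coset_step_L2: "coset_step p f \<Longrightarrow> f \<in> L2 \<mu>"
  by (auto simp: coset_step_def intro!: L2_sum L2_scale L2_indicator)

text \<open>A single quantity that controls both the \<open>L\<^sup>1\<close> and the \<open>L\<^sup>2\<close> norm, so that both
  approximations can be made by the same step function.\<close>

definition gauge12 :: "(digits \<Rightarrow> complex) \<Rightarrow> ennreal" where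
  "gauge12 f = (\<integral>\<^sup>+x. ennreal (cmod (f x) + (cmod (f x))\<^sup>2) \<partial>\<mu>)"

definition approximable :: "(digits \<Rightarrow> complex) \<Rightarrow> bool" where
  "approximable f \<longleftrightarrow> f \<in> borel_measurable \<mu> \<and>
     (\<forall>e>0. \<exists>s. coset_step p s \<and> gauge12 (\<lambda>x. f x - s x) < ennreal e)"

lemma coset_step_measurable: "coset_step p f \<Longrightarrow> f \<in> borel_measurable \<mu>"
  using coset_step_L2 L2_measurable by blast

lemma gauge12_add:
  assumes [measurable]: "f \<in> borel_measurable \<mu>" "g \<in> borel_measurable \<mu>"
  shows "gauge12 (\<lambda>x. f x + g x) \<le> 2 * gauge12 f + 2 * gauge12 g"
proof -
  have "cmod (a + b) + (cmod (a + b))\<^sup>2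
      \<le> 2 * (cmod a + (cmod a)\<^sup>2) + 2 * (cmod b + (cmod b)\<^sup>2)" for a b
  proof -
    have "(cmod (a + b))\<^sup>2 \<le> 2 * (cmod a)\<^sup>2 + 2 * (cmod b)\<^sup>2"
      using square_norm_add_le[of 1 a b] by simp
    moreover have "u + v \<le> 2 * (x + x') + 2 * (y + y')"
      if "v \<le> 2 * x' + 2 * y'" "u \<le> x + y" "0 \<le> x" "0 \<le> y" for u v x y x' y' :: real
      using that by (simp add: distrib_left)
    ultimately show ?thesis
      using norm_triangle_ineq[of a b] norm_ge_zero[of a] norm_ge_zero[of b] by blast
  qed
  then have "ennreal (cmod (f x + g x) + (cmod (f x + g x))\<^sup>2)
      \<le> 2 * ennreal (cmod (f x) + (cmod (f x))\<^sup>2) + 2 * ennreal (cmod (g x) + (cmod (g x))\<^sup>2)" for x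
    by (simp add: ennreal_leI flip: ennreal_plus ennreal_mult ennreal_numeral)
  then have "gauge12 (\<lambda>x. f x + g x) \<le> (\<integral>\<^sup>+x. 2 * ennreal (cmod (f x) + (cmod (f x))\<^sup>2)
      + 2 * ennreal (cmod (g x) + (cmod (g x))\<^sup>2) \<partial>\<mu>)"
    unfolding gauge12_def by (rule nn_integral_mono)
  also have "\<dots> = 2 * gauge12 f + 2 * gauge12 g"
    by (simp add: gauge12_def nn_integral_add nn_integral_cmult)
  finally show ?thesis .
qed

lemma gauge12_scale:
  assumes [measurable]: "f \<in> borel_measurable \<mu>"
  shows "gauge12 (\<lambda>x. c * f x) \<le> ennreal (cmod c + (cmod c)\<^sup>2) * gauge12 f"
proof -
  have "cmod (c * a) + (cmod (c * a))\<^sup>2 \<le> (cmod c + (cmod c)\<^sup>2) * (cmod a + (cmod a)\<^sup>2)" for a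
    by (simp add: norm_mult power_mult_distrib algebra_simps)
  then have "gauge12 (\<lambda>x. c * f x)
      \<le> (\<integral>\<^sup>+x. ennreal (cmod c + (cmod c)\<^sup>2) * ennreal (cmod (f x) + (cmod (f x))\<^sup>2) \<partial>\<mu>)"
    unfolding gauge12_def
    by (intro nn_integral_mono, subst ennreal_mult[symmetric])
       (simp_all add: ennreal_leI del: ennreal_plus)
  also have "\<dots> = ennreal (cmod c + (cmod c)\<^sup>2) * gauge12 f"
    by (simp add: gauge12_def nn_integral_cmult)
  finally show ?thesis .
qed

lemma approximable_measurable: "approximable f \<Longrightarrow> f \<in> borel_measurable \<mu>"
  by (simp add: approximable_def)

lemma approximable_step: "coset_step p s \<Longrightarrow> approximable s"
  unfolding approximable_def
  by (auto intro!: coset_step_measurable exI[of _ s] simp: gauge12_def)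

lemma approximable_by_approximable:
  assumes f: "f \<in> borel_measurable \<mu>"
    and "\<And>e. 0 < e \<Longrightarrow> \<exists>g. approximable g \<and> gauge12 (\<lambda>x. f x - g x) < ennreal e"
  shows "approximable f"
  unfolding approximable_def
proof (intro conjI allI impI f)
  fix e :: real assume e: "0 < e"
  then obtain g where g: "approximable g" "gauge12 (\<lambda>x. f x - g x) < ennreal (e / 4)"
    using assms(2)[of "e / 4"] by auto
  then obtain s where s: "coset_step p s" "gauge12 (\<lambda>x. g x - s x) < ennreal (e / 4)"
    using e unfolding approximable_def by (meson divide_pos_pos zero_less_numeral)
  have "gauge12 (\<lambda>x. f x - s x) \<le> 2 * gauge12 (\<lambda>x. f x - g x) + 2 * gauge12 (\<lambda>x. g x - s x)"
    using gauge12_add[of "\<lambda>x. f x - g x" "\<lambda>x. g x - s x"] f approximable_measurable[OF g(1)]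
      coset_step_measurable[OF s(1)] by simp
  also have "\<dots> < 2 * ennreal (e / 4) + 2 * ennreal (e / 4)"
    using g(2) s(2) by (intro add_strict_mono ennreal_mult_strict_left_mono) auto
  also have "\<dots> = ennreal e"
    using e by (simp flip: ennreal_plus ennreal_mult ennreal_numeral)
  finally show "\<exists>s. coset_step p s \<and> gauge12 (\<lambda>x. f x - s x) < ennreal e" using s(1) by blast
qed

lemma approximable_add:
  assumes f: "approximable f" and g: "approximable g"
  shows "approximable (\<lambda>x. f x + g x)"
  unfolding approximable_def
proof (intro conjI allI impI)
  note [measurable] = approximable_measurable[OF f] approximable_measurable[OF g]
  show "(\<lambda>x. f x + g x) \<in> borel_measurable \<mu>" by measurable
  fix e :: real assume e: "0 < e"
  obtain s where s: "coset_step p s" "gauge12 (\<lambda>x. f x - s x) < ennreal (e / 4)"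
    using f e unfolding approximable_def by (meson divide_pos_pos zero_less_numeral)
  obtain t where t: "coset_step p t" "gauge12 (\<lambda>x. g x - t x) < ennreal (e / 4)"
    using g e unfolding approximable_def by (meson divide_pos_pos zero_less_numeral)
  note [measurable] = coset_step_measurable[OF s(1)] coset_step_measurable[OF t(1)]
  have "gauge12 (\<lambda>x. (f x + g x) - (s x + t x))
      \<le> 2 * gauge12 (\<lambda>x. f x - s x) + 2 * gauge12 (\<lambda>x. g x - t x)"
    using gauge12_add[of "\<lambda>x. f x - s x" "\<lambda>x. g x - t x"] by (simp add: algebra_simps)
  also have "\<dots> < 2 * ennreal (e / 4) + 2 * ennreal (e / 4)"
    using s(2) t(2) by (intro add_strict_mono ennreal_mult_strict_left_mono) auto
  also have "\<dots> = ennreal e"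
    using e by (simp flip: ennreal_plus ennreal_mult ennreal_numeral)
  finally show "\<exists>u. coset_step p u \<and> gauge12 (\<lambda>x. (f x + g x) - u x) < ennreal e"
    using coset_step_add[OF s(1) t(1)] by blast
qed

lemma approximable_scale:
  assumes f: "approximable f"
  shows "approximable (\<lambda>x. c * f x)"
  unfolding approximable_def
proof (intro conjI allI impI)
  note [measurable] = approximable_measurable[OF f]
  show "(\<lambda>x. c * f x) \<in> borel_measurable \<mu>" by measurable
  fix e :: real assume e: "0 < e"
  define K where "K = cmod c + (cmod c)\<^sup>2 + 1"
  have K: "0 < K" by (simp add: K_def add_nonneg_pos)
  obtain s where s: "coset_step p s" "gauge12 (\<lambda>x. f x - s x) < ennreal (e / K)"
    using f e K unfolding approximable_def by (meson divide_pos_pos)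
  note [measurable] = coset_step_measurable[OF s(1)]
  have "gauge12 (\<lambda>x. c * f x - c * s x) \<le> ennreal (cmod c + (cmod c)\<^sup>2) * gauge12 (\<lambda>x. f x - s x)"
    using gauge12_scale[of "\<lambda>x. f x - s x" c] by (simp add: right_diff_distrib)
  also have "\<dots> \<le> ennreal K * gauge12 (\<lambda>x. f x - s x)"
    by (intro mult_right_mono ennreal_leI) (auto simp: K_def)
  also have "\<dots> < ennreal K * ennreal (e / K)"
    using s(2) K by (intro ennreal_mult_strict_left_mono) auto
  also have "\<dots> = ennreal e" using e K by (simp flip: ennreal_mult)
  finally show "\<exists>u. coset_step p u \<and> gauge12 (\<lambda>x. c * f x - u x) < ennreal e"
    using coset_step_scale[OF s(1)] by blast
qed

lemma approximable_sum:
  "(\<And>i. i \<in> I \<Longrightarrow> approximable (f i)) \<Longrightarrow> approximable (\<lambda>x. \<Sum>i\<in>I. f i x)"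
  by (induction I rule: infinite_finite_induct)
     (auto intro: approximable_add approximable_step coset_step_zero)

lemma approximable_cong:
  assumes "approximable f" "\<And>x. x \<in> vil p \<Longrightarrow> f x = g x"
  shows "approximable g"
proof -
  have "f \<in> borel_measurable \<mu> \<longleftrightarrow> g \<in> borel_measurable \<mu>"
    using assms(2) by (intro measurable_cong) simp
  moreover have "gauge12 (\<lambda>x. f x - s x) = gauge12 (\<lambda>x. g x - s x)" for s
    unfolding gauge12_def using assms(2) by (intro nn_integral_cong) simp
  ultimately show ?thesis using assms(1) by (simp add: approximable_def)
qed

lemma approximable_dominated_limit:
  assumes fn: "\<And>n. approximable (f n)" and [measurable]: "g \<in> borel_measurable \<mu>"
    and lim: "\<And>x. x \<in> vil p \<Longrightarrow> (\<lambda>n. f n x) \<longlonglongrightarrow> g x"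
    and bound: "\<And>n x. x \<in> vil p \<Longrightarrow> cmod (g x - f n x) \<le> w x"
    and [measurable]: "w \<in> borel_measurable \<mu>"
    and fin: "(\<integral>\<^sup>+x. ennreal (w x + (w x)\<^sup>2) \<partial>\<mu>) < \<infinity>"
  shows "approximable g"
proof (rule approximable_by_approximable)
  note [measurable] = approximable_measurable[OF fn]
  have "(\<lambda>n. gauge12 (\<lambda>x. g x - f n x)) \<longlonglongrightarrow> (\<integral>\<^sup>+x. 0 \<partial>\<mu>)"
    unfolding gauge12_def
  proof (rule nn_integral_dominated_convergence[where w = "\<lambda>x. ennreal (w x + (w x)\<^sup>2)"])
    show "AE x in \<mu>. ennreal (cmod (g x - f n x) + (cmod (g x - f n x))\<^sup>2) \<le> ennreal (w x + (w x)\<^sup>2)" for n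
      using bound by (intro AE_I2 ennreal_leI add_mono power_mono) auto
    show "AE x in \<mu>. (\<lambda>n. ennreal (cmod (g x - f n x) + (cmod (g x - f n x))\<^sup>2)) \<longlonglongrightarrow> 0"
    proof (intro AE_I2)
      fix x assume "x \<in> space \<mu>"
      then have "(\<lambda>n. f n x) \<longlonglongrightarrow> g x" using lim by simp
      then have "(\<lambda>n. ennreal (cmod (g x - f n x) + (cmod (g x - f n x))\<^sup>2))
          \<longlonglongrightarrow> ennreal (cmod (g x - g x) + (cmod (g x - g x))\<^sup>2)"
        by (intro tendsto_intros)
      then show "(\<lambda>n. ennreal (cmod (g x - f n x) + (cmod (g x - f n x))\<^sup>2)) \<longlonglongrightarrow> 0" by simp
    qed
  qed (use fin in auto)
  then have lim0: "(\<lambda>n. gauge12 (\<lambda>x. g x - f n x)) \<longlonglongrightarrow> 0" by simp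
  fix e :: real assume "0 < e"
  then have "\<forall>\<^sub>F n in sequentially. gauge12 (\<lambda>x. g x - f n x) < ennreal e"
    by (intro order_tendstoD(2)[OF lim0]) simp
  then obtain n where "gauge12 (\<lambda>x. g x - f n x) < ennreal e"
    using eventually_happens'[OF sequentially_bot] by blast
  then show "\<exists>h. approximable h \<and> gauge12 (\<lambda>x. g x - h x) < ennreal e" using fn by blast
qed fact

text \<open>The cosets together with the empty set are stable under intersection, and the indicators of
  complements and of disjoint unions are differences and limits of sums of indicators. So
  Dynkin's lemma reaches all Borel sets, once they are cut down to a fixed \<open>U\<^sub>l\<close> of finite measure.\<close>

lemma approximable_indicator:
  assumes "A \<in> sets \<mu>"
  shows "approximable (indicator (A \<inter> cyl p (\<lambda>_. 0) l))"
proof -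
  let ?K = "cyl p (\<lambda>_. 0) l"
  have gen: "sigma_sets (vil p) (insert {} (cyls p)) = sets \<mu>"
    unfolding sets_eq by (rule sigma_sets_eqI) (auto intro: sigma_sets.Basic sigma_sets.Empty)
  then have A: "A \<in> sigma_sets (vil p) (insert {} (cyls p))"
    using assms by simp
  have stable: "Int_stable (insert {} (cyls p))"
  proof -
    have "cyl p a l \<inter> cyl p b k \<in> insert {} (cyls p)" if "a \<in> vil p" "b \<in> vil p" for a b l k
    proof (cases "l \<le> k")
      case True
      then show ?thesis using that by (auto simp: cyl_Int cyls_def)
    next
      case False
      then have "cyl p b k \<inter> cyl p a l \<in> insert {} (cyls p)"
        using that by (subst cyl_Int) (auto simp: cyls_def)
      then show ?thesis by (simp add: Int_commute)
    qed
    then have "A \<inter> B \<in> insert {} (cyls p)" if "A \<in> cyls p" "B \<in> cyls p" for A B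
      using that unfolding cyls_def by blast
    then show ?thesis by (auto simp: Int_stable_def)
  qed
  have "insert {} (cyls p) \<subseteq> Pow (vil p)" by (auto simp: cyls_def cyl_def)
  from stable this A show ?thesis
  proof (induction rule: sigma_sets_induct_disjoint)
    case (basic A)
    show ?case
    proof (cases "A = {}")
      case True
      then show ?thesis using approximable_step[OF coset_step_zero] by (simp add: indicator_def)
    next
      case False
      then obtain a k where a: "a \<in> vil p" and A: "A = cyl p a k" using basic by (auto simp: cyls_def)
      have "A \<inter> ?K = {} \<or> (\<exists>b j. b \<in> vil p \<and> A \<inter> ?K = cyl p b j)"
      proof (cases "k \<le> l")
        case True
        then have "A \<inter> ?K = (if (\<lambda>_. 0) \<in> cyl p a k then ?K else {})"
          by (simp add: A cyl_Int)
        then show ?thesis using vil_zero[OF p_pos] by metis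
      next
        case False
        then show ?thesis using cyl_Int[of l k a p "\<lambda>_. 0"] a by (auto simp: A Int_commute)
      qed
      moreover have "(indicator {} :: digits \<Rightarrow> complex) = (\<lambda>_. 0)" by auto
      ultimately show ?thesis
        using approximable_step[OF coset_step_zero] approximable_step[OF coset_step_indicator]
        by auto
    qed
  next
    case empty
    then show ?case using approximable_step[OF coset_step_zero] by (simp add: indicator_def)
  next
    case (compl A)
    have "approximable (\<lambda>x. indicator ?K x + (-1) * indicator (A \<inter> ?K) x)"
      by (intro approximable_add approximable_scale compl approximable_step coset_step_indicator) simp
    then show ?case
      by (rule approximable_cong) (auto simp: indicator_def)
  next
    case (union A)
    show ?case
    proof (rule approximable_dominated_limit)
      show "approximable (\<lambda>x. \<Sum>i<n. indicator (A i \<inter> ?K) x)" for n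
        by (intro approximable_sum union)
      have "A i \<in> sets \<mu>" for i
        using union(2) by (auto simp: gen)
      then show "(indicator (\<Union> (range A) \<inter> ?K) :: _ \<Rightarrow> complex) \<in> borel_measurable \<mu>" by simp
      fix x :: digits
      have dis: "disjoint_family (\<lambda>i. A i \<inter> ?K)"
        using union(1) by (auto simp: disjoint_family_on_def)
      have sum: "(\<Sum>i<n. indicator (A i \<inter> ?K) x :: complex) = indicator (\<Union>i<n. A i \<inter> ?K) x" for n
        by (rule indicator_UN_disjoint[symmetric])
          (use dis in \<open>auto intro: disjoint_family_on_mono\<close>)
      show "cmod (indicator (\<Union> (range A) \<inter> ?K) x - (\<Sum>i<n. indicator (A i \<inter> ?K) x))
          \<le> indicator ?K x" for n
        unfolding sum by (auto simp: indicator_def)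
      show "(\<lambda>n. \<Sum>i<n. indicator (A i \<inter> ?K) x) \<longlonglongrightarrow> (indicator (\<Union> (range A) \<inter> ?K) x :: complex)"
        unfolding sum
        using LIMSEQ_indicator_UN[of "\<lambda>i. A i \<inter> ?K" x] by simp
    next
      have "(\<integral>\<^sup>+x. ennreal (indicator ?K x + (indicator ?K x)\<^sup>2) \<partial>\<mu>) = (\<integral>\<^sup>+x. 2 * indicator ?K x \<partial>\<mu>)"
        by (rule nn_integral_cong) (auto simp: indicator_def)
      also have "\<dots> < \<infinity>" by (simp add: nn_integral_cmult ennreal_mult_less_top)
      finally show "(\<integral>\<^sup>+x. ennreal (indicator ?K x + (indicator ?K x)\<^sup>2) \<partial>\<mu>) < \<infinity>" .
    qed simp
  qed
qed


lemma vil_in_cyl_zero_eventually: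
  assumes "x \<in> vil p"
  shows "\<forall>\<^sub>F n in sequentially. x \<in> cyl p (\<lambda>_. 0) (- int n)"
proof -
  obtain l where "x \<in> cyl p (\<lambda>_. 0) l" using vil_in_cyl_zero assms by blast
  then have "x \<in> cyl p (\<lambda>_. 0) (- int n)" if "n \<ge> nat (- l)" for n
    using that cyl_antimono[of "- int n" l] by force
  then show ?thesis using eventually_sequentially by blast
qed

text \<open>Simple functions cut down to \<open>U\<^bsub>-n\<^esub>\<close> converge to \<open>f\<close>, dominated by a multiple of \<open>\<bar>f\<bar>\<close>; the
  truncation gives their level sets finite measure.\<close>

lemma approximable_L1_L2:
  assumes f1: "integrable \<mu> f" and f2: "f \<in> L2 \<mu>"
  shows "approximable f"
proof -
  note [measurable] = L2_measurable[OF f2]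
  let ?K = "\<lambda>n. cyl p (\<lambda>_. 0) (- int n)"
  obtain s where s: "\<And>i. simple_function \<mu> (s i)"
    and lim: "\<And>x. x \<in> vil p \<Longrightarrow> (\<lambda>i. s i x) \<longlonglongrightarrow> f x"
    and bound: "\<And>i x. x \<in> vil p \<Longrightarrow> cmod (s i x) \<le> 2 * cmod (f x)"
    using borel_measurable_implies_sequence_metric[of f \<mu> 0] by auto metis
  show ?thesis
  proof (rule approximable_dominated_limit)
    fix n
    let ?A = "\<lambda>y. s n -` {y} \<inter> vil p"
    have A: "?A y \<in> sets \<mu>" for y using simple_functionD(2)[OF s, of n "{y}"] by simp
    have "approximable (\<lambda>x. \<Sum>y\<in>s n ` vil p. y * indicator (?A y \<inter> ?K n) x)"
      by (intro approximable_sum approximable_scale approximable_indicator A)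
    then show "approximable (\<lambda>x. s n x * indicator (?K n) x)"
    proof (rule approximable_cong)
      fix x assume x: "x \<in> vil p"
      have "finite (s n ` vil p)" using simple_functionD(1)[OF s, of n] by simp
      then have "(\<Sum>y\<in>s n ` vil p. y * indicator (?A y \<inter> ?K n) x)
          = (\<Sum>y\<in>{s n x}. y * indicator (?A y \<inter> ?K n) x)"
        using x by (intro sum.mono_neutral_right) (auto simp: indicator_def)
      then show "(\<Sum>y\<in>s n ` vil p. y * indicator (?A y \<inter> ?K n) x) = s n x * indicator (?K n) x"
        using x by (simp add: indicator_def)
    qed
  next
    fix x assume x: "x \<in> vil p"
    have "\<forall>\<^sub>F n in sequentially. s n x = s n x * indicator (?K n) x"
      using vil_in_cyl_zero_eventually[OF x] by eventually_elim simp
    then show "(\<lambda>n. s n x * indicator (?K n) x) \<longlonglongrightarrow> f x"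
      by (rule Lim_transform_eventually[OF lim[OF x]])
    show "cmod (f x - s n x * indicator (?K n) x) \<le> 3 * cmod (f x)" for n
      using norm_triangle_ineq4[of "f x" "s n x * indicator (?K n) x"] bound[OF x, of n]
      by (auto simp: indicator_def)
  next
    have "integrable \<mu> (\<lambda>x. 3 * cmod (f x) + 9 * (cmod (f x))\<^sup>2)"
      using f1 L2_integrable[OF f2] by (intro Bochner_Integration.integrable_add integrable_mult_right) auto
    then show "(\<integral>\<^sup>+x. ennreal (3 * cmod (f x) + (3 * cmod (f x))\<^sup>2) \<partial>\<mu>) < \<infinity>"
      by (simp add: integrable_iff_bounded power_mult_distrib)
  qed measurable
qed

end

locale vil_dual = vil_haar p \<mu> + dual: vil_haar p \<nu>
  for p :: int and \<mu> \<nu> :: "digits measure"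
begin

text \<open>Indicators of cosets have the same Gram matrix as their Fourier transforms. Up to
  a factor, the transforms are characters cut down to subgroups of the dual group, so their inner
  products are integrals of characters over subgroups.\<close>

lemma Gram_cosets:
  assumes a: "a \<in> vil p" and b: "b \<in> vil p"
  shows "(LINT \<omega>|\<nu>. vil_fourier_L1 p \<mu> (indicator (cyl p a l)) \<omega>
            * cnj (vil_fourier_L1 p \<mu> (indicator (cyl p b k)) \<omega>))
    = (LINT x|\<mu>. indicator (cyl p a l) x * cnj (indicator (cyl p b k) x :: complex))"
    (is "?F a l b k = ?I a l b k")
proof -
  have main: "?F a l b k = ?I a l b k" if "l \<le> k" "a \<in> vil p" "b \<in> vil p" for a b l k
  proof -
    let ?q = "\<lambda>m. complex_of_real (real_of_int p powi m)"
    have "?F a l b k = (LINT \<omega>|\<nu>. ?q (- l) * ?q (- k) *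
        (indicator (cyl p (\<lambda>_. 0) (- l)) \<omega> * vil_char p \<omega> (vil_diff p b a)))"
    proof (rule Bochner_Integration.integral_cong[OF refl])
      fix \<omega> assume "\<omega> \<in> space \<nu>"
      then have \<omega>: "\<omega> \<in> vil p" by simp
      have "indicator (cyl p (\<lambda>_. 0) (- l)) \<omega> * indicator (cyl p (\<lambda>_. 0) (- k)) \<omega>
          = (indicator (cyl p (\<lambda>_. 0) (- l)) \<omega> :: complex)"
        using cyl_antimono[of "- k" "- l" p "\<lambda>_. 0"] \<open>l \<le> k\<close> by (auto simp: indicator_def)
      then show "vil_fourier_L1 p \<mu> (indicator (cyl p a l)) \<omega>
            * cnj (vil_fourier_L1 p \<mu> (indicator (cyl p b k)) \<omega>)
          = ?q (- l) * ?q (- k) *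
            (indicator (cyl p (\<lambda>_. 0) (- l)) \<omega> * vil_char p \<omega> (vil_diff p b a))"
        using that \<omega>
        by (simp add: fourier_L1_cyl vil_char_commute[of p \<omega>] vil_char_diff mult_ac
              del: mult_eq_0_iff mult_cancel_left mult_cancel_right)
    qed
    also have "\<dots> = ?q (- l) * ?q (- k) *
        (LINT \<omega>|\<nu>. indicator (cyl p (\<lambda>_. 0) (- l)) \<omega> * vil_char p \<omega> (vil_diff p b a))"
      by simp
    also have "\<dots> = ?q (- l) * ?q (- k) * (if vil_diff p b a \<in> cyl p (\<lambda>_. 0) l then ?q l else 0)"
      using that by (subst dual.integral_vil_char_cyl) auto
    also have "\<dots> = (if b \<in> cyl p a l then ?q (- k) else 0)"
    proof -
      have "vil_diff p b a \<in> cyl p (\<lambda>_. 0) l \<longleftrightarrow> b \<in> cyl p a l"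
        using indicator_cyl_add[of a "vil_diff p b a" l, where 'b = nat] that
        by (auto simp: indicator_def split: split_of_bool_asm)
      moreover have "?q (- l) * ?q l = 1"
        using p_ge_2 by (simp flip: of_real_mult power_int_add)
      ultimately show ?thesis by (simp add: mult_ac)
    qed
    also have "\<dots> = ?I a l b k"
    proof -
      have "?I a l b k = (LINT x|\<mu>. indicator (cyl p a l \<inter> cyl p b k) x)"
        by (rule Bochner_Integration.integral_cong) (auto simp: indicator_def)
      also have "\<dots> = of_real (measure \<mu> (cyl p a l \<inter> cyl p b k))"
        using that by (intro has_bochner_integral_integral_eq has_bochner_integral_complex_indicator)
          (auto simp: cyl_Int)
      finally show ?thesis using that by (simp add: cyl_Int measure_cyl)
    qed
    finally show ?thesis .
  qed
  show ?thesis
  proof (cases "l \<le> k")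
    case True
    then show ?thesis using main a b by simp
  next
    case False
    then have "cnj (?F b k a l) = cnj (?I b k a l)" using main a b by simp
    then show ?thesis
      by (simp only: Bochner_Integration.integral_cnj[symmetric] complex_cnj_mult complex_cnj_cnj mult.commute)
  qed
qed

lemma fourier_cyl_L2:
  assumes a: "a \<in> vil p"
  shows "vil_fourier_L1 p \<mu> (indicator (cyl p a l)) \<in> L2 \<nu>"
proof -
  let ?g = "\<lambda>\<omega>. complex_of_real (real_of_int p powi (- l)) * cnj (vil_char p a \<omega>)
      * indicator (cyl p (\<lambda>_. 0) (- l)) \<omega>"
  have eq: "\<And>\<omega>. \<omega> \<in> space \<nu> \<Longrightarrow> vil_fourier_L1 p \<mu> (indicator (cyl p a l)) \<omega> = ?g \<omega>"
    using fourier_L1_cyl[OF a] by simp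
  have "?g \<in> borel_measurable \<nu>"
    using a by (intro borel_measurable_times complex_borel_measurable_cnj) auto
  then have "vil_fourier_L1 p \<mu> (indicator (cyl p a l)) \<in> borel_measurable \<nu>"
    using measurable_cong[of \<nu>, OF eq] by simp
  then show ?thesis
  proof (rule L2I_bound)
    show "integrable \<nu> (\<lambda>\<omega>. (real_of_int p powi (- l))\<^sup>2 * indicator (cyl p (\<lambda>_. 0) (- l)) \<omega>)"
      by (intro integrable_mult_right integrable_real_indicator) auto
    show "(cmod (vil_fourier_L1 p \<mu> (indicator (cyl p a l)) \<omega>))\<^sup>2
        \<le> (real_of_int p powi (- l))\<^sup>2 * indicator (cyl p (\<lambda>_. 0) (- l)) \<omega>" if "\<omega> \<in> space \<nu>" for \<omega>
      unfolding eq[OF that] using p_ge_2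
      by (simp add: norm_mult power_mult_distrib indicator_def norm_power_int)
  qed
qed

lemma Plancherel_coset_step:
  assumes "coset_step p f"
  shows "vil_fourier_L1 p \<mu> f \<in> L2 \<nu>" "L2_norm \<nu> (vil_fourier_L1 p \<mu> f) = L2_norm \<mu> f"
proof -
  obtain I c where I: "finite I" "\<forall>i\<in>I. fst i \<in> vil p"
    and f: "f = (\<lambda>x. \<Sum>i\<in>I. c i * indicator (cyl p (fst i) (snd i)) x)"
    using assms by (auto simp: coset_step_def)
  let ?u = "\<lambda>i :: digits \<times> int. indicator (cyl p (fst i) (snd i)) :: digits \<Rightarrow> complex"
  let ?s = "\<lambda>\<omega>. \<Sum>i\<in>I. c i * vil_fourier_L1 p \<mu> (?u i) \<omega>"
  have eq: "\<And>\<omega>. \<omega> \<in> space \<nu> \<Longrightarrow> vil_fourier_L1 p \<mu> f \<omega> = ?s \<omega>"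
    unfolding f using I by (intro fourier_L1_sum) auto
  have s: "?s \<in> L2 \<nu>" using I by (intro L2_sum L2_scale fourier_cyl_L2) auto
  have "vil_fourier_L1 p \<mu> f \<in> borel_measurable \<nu> \<longleftrightarrow> ?s \<in> borel_measurable \<nu>"
    by (rule measurable_cong) (rule eq)
  then have meas: "vil_fourier_L1 p \<mu> f \<in> borel_measurable \<nu>"
    using L2_measurable[OF s] by simp
  show "vil_fourier_L1 p \<mu> f \<in> L2 \<nu>"
    using eq by (intro L2I_bound[OF meas L2_integrable[OF s]]) simp
  have "L2_norm \<nu> (vil_fourier_L1 p \<mu> f) = L2_norm \<nu> ?s"
    by (rule L2_norm_cong_AE) (use eq meas L2_measurable[OF s] in auto)
  moreover have "complex_of_real ((L2_norm \<nu> ?s)\<^sup>2) = complex_of_real ((L2_norm \<mu> f)\<^sup>2)"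
  proof -
    have "complex_of_real ((L2_norm \<nu> ?s)\<^sup>2) = (\<Sum>i\<in>I. \<Sum>j\<in>I. c i * cnj (c j) *
        (LINT \<omega>|\<nu>. vil_fourier_L1 p \<mu> (?u i) \<omega> * cnj (vil_fourier_L1 p \<mu> (?u j) \<omega>)))"
      by (rule L2_norm_sum_Gram) (use I fourier_cyl_L2 in auto)
    also have "\<dots> = (\<Sum>i\<in>I. \<Sum>j\<in>I. c i * cnj (c j) * (LINT x|\<mu>. ?u i x * cnj (?u j x)))"
      using I by (intro sum.cong refl arg_cong2[where f = "(*)"] Gram_cosets) auto
    also have "\<dots> = complex_of_real ((L2_norm \<mu> f)\<^sup>2)"
      unfolding f by (rule L2_norm_sum_Gram[symmetric]) (use I in \<open>auto intro!: L2_indicator\<close>)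
    finally show ?thesis .
  qed
  ultimately show "L2_norm \<nu> (vil_fourier_L1 p \<mu> f) = L2_norm \<mu> f"
    unfolding of_real_eq_iff by (simp add: power2_eq_iff_nonneg)
qed

text \<open>For \<open>f\<close> approximated by step functions \<open>s\<^sub>n\<close>, the \<open>L\<^sup>1\<close> approximation makes the transforms of
  \<open>s\<^sub>n\<close> converge pointwise to that of \<open>f\<close>, and the \<open>L\<^sup>2\<close> approximation makes them a Cauchy sequence in
  \<open>L\<^sup>2\<close>, with norms tending to the norm of \<open>f\<close>.\<close>

theorem Plancherel:
  assumes f1: "integrable \<mu> f" and f2: "f \<in> L2 \<mu>"
  shows "vil_fourier_L1 p \<mu> f \<in> L2 \<nu>" "L2_norm \<nu> (vil_fourier_L1 p \<mu> f) = L2_norm \<mu> f"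
proof -
  have "\<exists>s. coset_step p s \<and> gauge12 (\<lambda>x. f x - s x) < ennreal (1 / real (Suc n))" for n
    using approximable_L1_L2[OF f1 f2] unfolding approximable_def by simp
  then obtain s where s: "\<And>n. coset_step p (s n)"
    and small: "\<And>n. gauge12 (\<lambda>x. f x - s n x) < ennreal (1 / real (Suc n))" by metis
  note s1 = coset_step_integrable[OF s] and s2 = coset_step_L2[OF s]
  note [measurable] = L2_measurable[OF f2] L2_measurable[OF s2]
  have d1: "integrable \<mu> (\<lambda>x. f x - s n x)" and d2: "(\<lambda>x. f x - s n x) \<in> L2 \<mu>" for n
    using f1 f2 s1 s2 by (auto intro: L2_diff)
  have total: "(LINT x|\<mu>. cmod (f x - s n x)) + (L2_norm \<mu> (\<lambda>x. f x - s n x))\<^sup>2 < 1 / real (Suc n)" for n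
  proof -
    have "gauge12 (\<lambda>x. f x - s n x) = ennreal (LINT x|\<mu>. cmod (f x - s n x) + (cmod (f x - s n x))\<^sup>2)"
      unfolding gauge12_def
      using d1 L2_integrable[OF d2] by (intro nn_integral_eq_integral) auto
    also have "(LINT x|\<mu>. cmod (f x - s n x) + (cmod (f x - s n x))\<^sup>2)
        = (LINT x|\<mu>. cmod (f x - s n x)) + (L2_norm \<mu> (\<lambda>x. f x - s n x))\<^sup>2"
      unfolding L2_norm_power2
      using integrable_norm[OF d1] L2_integrable[OF d2] by (intro Bochner_Integration.integral_add)
    finally have "ennreal ((LINT x|\<mu>. cmod (f x - s n x)) + (L2_norm \<mu> (\<lambda>x. f x - s n x))\<^sup>2)
        < ennreal (1 / real (Suc n))"
      using small[of n] by simp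
    then show ?thesis
      by (subst (asm) ennreal_less_iff) (auto intro!: add_nonneg_nonneg)
  qed
  have inv0: "(\<lambda>n. 1 / real (Suc n)) \<longlonglongrightarrow> 0" by (rule LIMSEQ_Suc[OF lim_1_over_n])
  have lim1: "(\<lambda>n. LINT x|\<mu>. cmod (f x - s n x)) \<longlonglongrightarrow> 0"
  proof (rule tendsto_sandwich[OF _ _ tendsto_const inv0])
    show "\<forall>\<^sub>F n in sequentially. (LINT x|\<mu>. cmod (f x - s n x)) \<le> 1 / real (Suc n)"
    proof (intro always_eventually allI)
      fix n
      have "0 \<le> (L2_norm \<mu> (\<lambda>x. f x - s n x))\<^sup>2" by simp
      then show "(LINT x|\<mu>. cmod (f x - s n x)) \<le> 1 / real (Suc n)" using total[of n] by linarith
    qed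
  qed simp
  have "(\<lambda>n. (L2_norm \<mu> (\<lambda>x. f x - s n x))\<^sup>2) \<longlonglongrightarrow> 0"
  proof (rule tendsto_sandwich[OF _ _ tendsto_const inv0])
    show "\<forall>\<^sub>F n in sequentially. (L2_norm \<mu> (\<lambda>x. f x - s n x))\<^sup>2 \<le> 1 / real (Suc n)"
    proof (intro always_eventually allI)
      fix n
      have "0 \<le> (LINT x|\<mu>. cmod (f x - s n x))" by simp
      then show "(L2_norm \<mu> (\<lambda>x. f x - s n x))\<^sup>2 \<le> 1 / real (Suc n)" using total[of n] by linarith
    qed
  qed simp
  from tendsto_real_sqrt[OF this] have "L2_converges \<mu> s f"
    using s2 f2 by (simp add: L2_converges_def L2_norm_minus_commute)
  note conv = this
  let ?F = "\<lambda>n. vil_fourier_L1 p \<mu> (s n)"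
  have F2: "?F n \<in> L2 \<nu>" for n by (rule Plancherel_coset_step[OF s])
  have isom: "L2_norm \<nu> (\<lambda>\<omega>. ?F m \<omega> - ?F n \<omega>) = L2_norm \<mu> (\<lambda>x. s m x - s n x)" for m n
  proof -
    have "L2_norm \<nu> (\<lambda>\<omega>. ?F m \<omega> - ?F n \<omega>) = L2_norm \<nu> (vil_fourier_L1 p \<mu> (\<lambda>x. s m x - s n x))"
      by (rule L2_norm_cong_AE)
         (use L2_diff[OF F2 F2] Plancherel_coset_step(1)[OF coset_step_diff[OF s s]] in
           \<open>auto intro: L2_measurable simp: fourier_L1_diff[OF s1 s1]\<close>)
    also have "\<dots> = L2_norm \<mu> (\<lambda>x. s m x - s n x)"
      by (rule Plancherel_coset_step) (intro coset_step_diff s)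
    finally show ?thesis .
  qed
  have cauchy: "L2_Cauchy \<nu> ?F"
    using L2_converges_imp_Cauchy[OF conv] F2 unfolding L2_Cauchy_def isom by simp
  have ptw: "(\<lambda>n. ?F n \<omega>) \<longlonglongrightarrow> vil_fourier_L1 p \<mu> f \<omega>" if "\<omega> \<in> space \<nu>" for \<omega>
  proof -
    have "(\<lambda>n. vil_fourier_L1 p \<mu> f \<omega> - ?F n \<omega>) \<longlonglongrightarrow> 0"
    proof (rule Lim_null_comparison[OF _ lim1], rule always_eventually, rule allI)
      fix n
      have "vil_fourier_L1 p \<mu> f \<omega> - ?F n \<omega> = vil_fourier_L1 p \<mu> (\<lambda>x. f x - s n x) \<omega>"
        using that by (simp add: fourier_L1_diff[OF f1 s1])
      then show "cmod (vil_fourier_L1 p \<mu> f \<omega> - ?F n \<omega>) \<le> (LINT x|\<mu>. cmod (f x - s n x))"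
        using norm_fourier_L1_le[OF d1] by simp
    qed
    from tendsto_diff[OF tendsto_const[of "vil_fourier_L1 p \<mu> f \<omega>"] this] show ?thesis by simp
  qed
  have meas: "vil_fourier_L1 p \<mu> f \<in> borel_measurable \<nu>"
    by (rule borel_measurable_LIMSEQ_metric[OF L2_measurable[OF F2] ptw])
  have convF: "L2_converges \<nu> ?F (vil_fourier_L1 p \<mu> f)"
    by (rule L2_Cauchy_AE_limit[OF cauchy strict_mono_id meas]) (use ptw in auto)
  then show "vil_fourier_L1 p \<mu> f \<in> L2 \<nu>" by (simp add: L2_converges_def)
  have "(\<lambda>n. L2_norm \<nu> (?F n)) \<longlonglongrightarrow> L2_norm \<mu> f"
    using L2_converges_norm[OF conv] by (simp add: Plancherel_coset_step(2)[OF s])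
  then show "L2_norm \<nu> (vil_fourier_L1 p \<mu> f) = L2_norm \<mu> f"
    using L2_converges_norm[OF convF] LIMSEQ_unique by blast
qed

text \<open>Truncation to \<open>U\<^bsub>-n\<^esub>\<close> gives approximations in \<open>L\<^sup>1 \<inter> L\<^sup>2\<close>, so the extension to \<open>L\<^sup>2\<close> exists and the
  chosen representative has the defining property.\<close>

lemma vil_fourier_approx:
  assumes f: "f \<in> L2 \<mu>"
  obtains F where "\<And>n. integrable \<mu> (F n)" "L2_converges \<mu> F f"
    "L2_converges \<nu> (\<lambda>n. vil_fourier_L1 p \<mu> (F n)) (vil_fourier p \<mu> \<nu> f)"
proof -
  note [measurable] = L2_measurable[OF f]
  let ?K = "\<lambda>n. cyl p (\<lambda>_. 0) (- int n)"
  define F where "F n x = f x * indicator (?K n) x" for n x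
  have Fm [measurable]: "F n \<in> borel_measurable \<mu>" for n unfolding F_def by measurable
  have F2: "F n \<in> L2 \<mu>" for n
    by (rule L2I_bound[OF Fm L2_integrable[OF f]]) (auto simp: F_def indicator_def)
  have F1: "integrable \<mu> (F n)" for n
  proof (rule Bochner_Integration.integrable_bound)
    show "integrable \<mu> (\<lambda>x. (cmod (f x))\<^sup>2 + indicator (?K n) x)"
      using L2_integrable[OF f] by (intro Bochner_Integration.integrable_add integrable_real_indicator) auto
    have "cmod a \<le> (cmod a)\<^sup>2 + 1" for a
      using sum_squares_bound[of "cmod a" 1] norm_ge_zero[of a] by (simp, linarith)
    then show "AE x in \<mu>. norm (F n x) \<le> norm ((cmod (f x))\<^sup>2 + indicator (?K n) x)"
      by (auto simp: F_def indicator_def)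
  qed measurable
  have "(\<lambda>n. LINT x|\<mu>. (cmod (F n x - f x))\<^sup>2) \<longlonglongrightarrow> (LINT x|\<mu>. 0)"
  proof (rule integral_dominated_convergence[where w = "\<lambda>x. (cmod (f x))\<^sup>2"])
    show "AE x in \<mu>. (\<lambda>n. (cmod (F n x - f x))\<^sup>2) \<longlonglongrightarrow> 0"
    proof (rule AE_I2)
      fix x assume "x \<in> space \<mu>"
      then have "\<forall>\<^sub>F n in sequentially. x \<in> ?K n" using vil_in_cyl_zero_eventually by simp
      then have "\<forall>\<^sub>F n in sequentially. (cmod (F n x - f x))\<^sup>2 = 0"
        by eventually_elim (simp add: F_def)
      then show "(\<lambda>n. (cmod (F n x - f x))\<^sup>2) \<longlonglongrightarrow> 0" by (rule tendsto_eventually)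
    qed
  qed (use L2_integrable[OF f] in \<open>auto simp: F_def indicator_def\<close>)
  then have "(\<lambda>n. sqrt (LINT x|\<mu>. (cmod (F n x - f x))\<^sup>2)) \<longlonglongrightarrow> sqrt 0"
    by (intro tendsto_real_sqrt) simp
  then have conv: "L2_converges \<mu> F f" using F2 f by (simp add: L2_converges_def L2_norm_def)
  let ?F = "\<lambda>n. vil_fourier_L1 p \<mu> (F n)"
  have P2: "?F n \<in> L2 \<nu>" for n by (rule Plancherel[OF F1 F2])
  have isom: "L2_norm \<nu> (\<lambda>\<omega>. ?F m \<omega> - ?F n \<omega>) = L2_norm \<mu> (\<lambda>x. F m x - F n x)" for m n
  proof -
    have d: "integrable \<mu> (\<lambda>x. F m x - F n x)" "(\<lambda>x. F m x - F n x) \<in> L2 \<mu>"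
      using F1 F2 by (auto intro: L2_diff)
    have "L2_norm \<nu> (\<lambda>\<omega>. ?F m \<omega> - ?F n \<omega>) = L2_norm \<nu> (vil_fourier_L1 p \<mu> (\<lambda>x. F m x - F n x))"
      by (rule L2_norm_cong_AE)
         (use L2_diff[OF P2 P2] Plancherel(1)[OF d] in
           \<open>auto intro: L2_measurable simp: fourier_L1_diff[OF F1 F1]\<close>)
    then show ?thesis using Plancherel(2)[OF d] by simp
  qed
  have "L2_Cauchy \<nu> ?F"
    using L2_converges_imp_Cauchy[OF conv] P2 unfolding L2_Cauchy_def isom by simp
  then obtain g where "L2_converges \<nu> ?F g" by (rule L2_complete)
  with F1 conv have "\<exists>g F. (\<forall>n. integrable \<mu> (F n)) \<and> L2_converges \<mu> F f \<and>
      L2_converges \<nu> (\<lambda>n. vil_fourier_L1 p \<mu> (F n)) g" by blast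
  from someI_ex[OF this] that show thesis unfolding vil_fourier_def[symmetric] by blast
qed

end

section \<open>Square-summable sequences and orthonormal expansions\<close>

lemma complex_norm_add_power2:
  "(cmod (a + b))\<^sup>2 = ((cmod a)\<^sup>2 + (cmod b)\<^sup>2) + 2 * Re (a * cnj b)"
  unfolding cmod_power2 by (simp add: power2_eq_square algebra_simps)

lemma complex_norm_diff_power2:
  "(cmod (a - b))\<^sup>2 = ((cmod a)\<^sup>2 + (cmod b)\<^sup>2) - 2 * Re (a * cnj b)"
  unfolding cmod_power2 by (simp add: power2_eq_square algebra_simps)

lemma ell2_iff: "c \<in> ell2 \<longleftrightarrow> summable (\<lambda>n. (cmod (c n))\<^sup>2)"
  by (simp add: ell2_def)

lemma ell2_norm_power2: "c \<in> ell2 \<Longrightarrow> (ell2_norm c)\<^sup>2 = (\<Sum>n. (cmod (c n))\<^sup>2)"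
  by (simp add: ell2_norm_def ell2_iff suminf_nonneg)

lemma ell2_add: "c \<in> ell2 \<Longrightarrow> d \<in> ell2 \<Longrightarrow> (\<lambda>n. c n + d n) \<in> ell2"
  unfolding ell2_iff
proof (rule summable_comparison_test'[where g = "\<lambda>n. 2 * (cmod (c n))\<^sup>2 + 2 * (cmod (d n))\<^sup>2" and N = 0])
  show "norm ((cmod (c n + d n))\<^sup>2) \<le> 2 * (cmod (c n))\<^sup>2 + 2 * (cmod (d n))\<^sup>2" for n
    using square_norm_add_le[of 1 "c n" "d n"] by simp
qed (auto intro: summable_add summable_mult)

lemma ell2_scale: "c \<in> ell2 \<Longrightarrow> (\<lambda>n. a * c n) \<in> ell2"
  by (simp add: ell2_iff norm_mult power_mult_distrib summable_mult)

lemma ell2_inner_summable: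
  assumes "c \<in> ell2" "d \<in> ell2"
  shows "summable (\<lambda>n. c n * cnj (d n))"
proof (rule summable_comparison_test'[where g = "\<lambda>n. (cmod (c n))\<^sup>2 + (cmod (d n))\<^sup>2" and N = 0])
  show "norm (c n * cnj (d n)) \<le> (cmod (c n))\<^sup>2 + (cmod (d n))\<^sup>2" for n
  proof -
    have "0 \<le> cmod (c n) * cmod (d n)" by simp
    then have "cmod (c n) * cmod (d n) \<le> (cmod (c n))\<^sup>2 + (cmod (d n))\<^sup>2"
      using sum_squares_bound[of "cmod (c n)" "cmod (d n)"] by linarith
    then show ?thesis by (simp add: norm_mult)
  qed
qed (use assms in \<open>auto simp: ell2_iff intro: summable_add\<close>)

lemma ell2_inner_add_left:
  "c \<in> ell2 \<Longrightarrow> c' \<in> ell2 \<Longrightarrow> d \<in> ell2 \<Longrightarrow>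
    ell2_inner (\<lambda>n. c n + c' n) d = ell2_inner c d + ell2_inner c' d"
  unfolding ell2_inner_def by (simp add: distrib_right suminf_add ell2_inner_summable)

lemma ell2_inner_scale_right:
  "c \<in> ell2 \<Longrightarrow> d \<in> ell2 \<Longrightarrow> ell2_inner c (\<lambda>n. a * d n) = cnj a * ell2_inner c d"
  unfolding ell2_inner_def
  by (simp add: suminf_mult[symmetric] ell2_inner_summable mult_ac)

lemma ell2_inner_self: "c \<in> ell2 \<Longrightarrow> ell2_inner c c = of_real ((ell2_norm c)\<^sup>2)"
  unfolding ell2_inner_def
  by (simp add: ell2_norm_power2 ell2_iff suminf_of_real complex_norm_square[symmetric]
      del: of_real_power)

lemma ell2_norm_add_power2:
  assumes c: "c \<in> ell2" and d: "d \<in> ell2"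
  shows "(ell2_norm (\<lambda>n. c n + d n))\<^sup>2 = (ell2_norm c)\<^sup>2 + (ell2_norm d)\<^sup>2 + 2 * Re (ell2_inner c d)"
proof -
  have s: "summable (\<lambda>n. Re (c n * cnj (d n)))"
    using ell2_inner_summable[OF c d] by (rule summable_Re)
  have "(ell2_norm (\<lambda>n. c n + d n))\<^sup>2
      = (\<Sum>n. ((cmod (c n))\<^sup>2 + (cmod (d n))\<^sup>2) + 2 * Re (c n * cnj (d n)))"
    unfolding ell2_norm_power2[OF ell2_add[OF c d]]
    by (rule suminf_cong) (rule complex_norm_add_power2)
  also have "\<dots> = (ell2_norm c)\<^sup>2 + (ell2_norm d)\<^sup>2 + 2 * (\<Sum>n. Re (c n * cnj (d n)))"
    using c d unfolding ell2_norm_power2[OF c] ell2_norm_power2[OF d] ell2_iff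
    by (intro sums_unique[symmetric] sums_add sums_mult summable_sums s)
  also have "(\<Sum>n. Re (c n * cnj (d n))) = Re (ell2_inner c d)"
    unfolding ell2_inner_def by (rule Re_suminf[symmetric, OF ell2_inner_summable[OF c d]])
  finally show ?thesis .
qed

text \<open>The Pythagorean identity behind Bessel's inequality, for the expansion of \<open>f\<close> in an orthonormal
  family.\<close>

lemma L2_norm_minus_expansion:
  assumes f: "f \<in> L2 M" and u: "\<And>n. u n \<in> L2 M"
    and on: "\<And>m n. (LINT x|M. u m x * cnj (u n x)) = (if m = n then 1 else 0)"
    and c: "\<And>n. c n = (LINT x|M. f x * cnj (u n x))" and A: "finite A"
  shows "(L2_norm M (\<lambda>x. f x - (\<Sum>n\<in>A. c n * u n x)))\<^sup>2
    = (L2_norm M f)\<^sup>2 - (\<Sum>n\<in>A. (cmod (c n))\<^sup>2)"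
proof -
  let ?S = "\<lambda>x. \<Sum>n\<in>A. c n * u n x"
  have S: "?S \<in> L2 M" by (intro L2_sum L2_scale u)
  have fS: "(LINT x|M. f x * cnj (?S x)) = of_real (\<Sum>n\<in>A. (cmod (c n))\<^sup>2)"
  proof -
    have "(LINT x|M. f x * cnj (?S x)) = (LINT x|M. (\<Sum>n\<in>A. cnj (c n) * (f x * cnj (u n x))))"
      by (simp add: sum_distrib_left mult_ac)
    also have "\<dots> = (\<Sum>n\<in>A. cnj (c n) * (LINT x|M. f x * cnj (u n x)))"
      by (subst Bochner_Integration.integral_sum) (auto intro!: integrable_mult_right L2_prod_integrable f u)
    also have "\<dots> = of_real (\<Sum>n\<in>A. (cmod (c n))\<^sup>2)"
      by (simp add: c[symmetric] complex_norm_square mult.commute del: of_real_power)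
    finally show ?thesis .
  qed
  have SS: "complex_of_real ((L2_norm M ?S)\<^sup>2) = of_real (\<Sum>n\<in>A. (cmod (c n))\<^sup>2)"
  proof -
    have "complex_of_real ((L2_norm M ?S)\<^sup>2) = (\<Sum>i\<in>A. \<Sum>j\<in>A. c i * cnj (c j) * (if i = j then 1 else 0))"
      by (subst L2_norm_sum_Gram[OF A u]) (simp add: on)
    also have "\<dots> = (\<Sum>i\<in>A. c i * cnj (c i))"
      using A by (intro sum.cong refl) (simp add: if_distrib cong: if_cong)
    also have "\<dots> = of_real (\<Sum>n\<in>A. (cmod (c n))\<^sup>2)"
      by (simp add: complex_norm_square del: of_real_power)
    finally show ?thesis .
  qed
  have "(LINT x|M. (cmod (f x - ?S x))\<^sup>2)
      = (LINT x|M. ((cmod (f x))\<^sup>2 + (cmod (?S x))\<^sup>2) - 2 * Re (f x * cnj (?S x)))"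
    by (rule Bochner_Integration.integral_cong[OF refl]) (rule complex_norm_diff_power2)
  also have "\<dots> = (L2_norm M f)\<^sup>2 + (L2_norm M ?S)\<^sup>2 - 2 * Re (LINT x|M. f x * cnj (?S x))"
    using L2_integrable[OF f] L2_integrable[OF S] L2_prod_integrable[OF f S]
    by (simp add: L2_norm_power2 del: complex_cnj_mult cnj_sum times_complex.sel cnj.sel)
  finally show ?thesis
    using SS unfolding fS of_real_eq_iff by (simp add: L2_norm_power2)
qed

section \<open>An orthonormal basis of functions on the unit subgroup of the dual group\<close>

lemma vil_diff_in_cyl_zero_iff:
  assumes "0 < p" "a \<in> vil p" "b \<in> vil p"
  shows "vil_diff p b a \<in> cyl p (\<lambda>_. 0) l \<longleftrightarrow> b \<in> cyl p a l"
proof -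
  have "vil_diff p b a j = 0 \<longleftrightarrow> b j = a j" for j
  proof -
    have "0 \<le> a j" "a j < p" "0 \<le> b j" "b j < p" using assms by (auto simp: vil_iff)
    then show ?thesis
      by (metis (no_types, lifting) cancel_comm_monoid_add_class.diff_cancel mod_0 mod_diff_eq
          mod_eq_dvd_iff mod_pos_pos_trivial vil_diff_def dvd_eq_mod_eq_0)
  qed
  then show ?thesis using assms by (simp add: cyl_def)
qed

lemma vil_char_H_H:
  assumes "h \<in> vil_H p" "k \<in> vil_H p"
  shows "vil_char p h k = 1"
proof -
  have "h j * k (1 - j) = 0" for j using assms by (cases "j \<le> 0") (auto simp: vil_H_def)
  then show ?thesis by (simp add: vil_char_def)
qed

context vil_haar begin

text \<open>The conjugate is the factor by which translation acts on the transform; the indicator cuts the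
  character down to \<open>U\<^sup>*\<close>, so that \<open>L\<^sup>2(U\<^sup>*)\<close> is treated as a subspace of \<open>L\<^sup>2\<close> of the whole group.\<close>

definition H_char :: "nat \<Rightarrow> digits \<Rightarrow> complex" where
  "H_char n \<omega> = indicator (cyl p (\<lambda>_. 0) 0) \<omega> * cnj (vil_char p (vil_H_enum p n) \<omega>)"

lemma H_enum_simps [simp]: "vil_H_enum p n \<in> vil p" "vil_H_enum p n \<in> vil_H p"
  using p_ge_2 by simp_all

lemma H_char_measurable [measurable]: "H_char n \<in> borel_measurable \<mu>"
  unfolding H_char_def[abs_def]
  by (intro borel_measurable_times complex_borel_measurable_cnj vil_char_measurable') auto

lemma H_char_L2: "H_char n \<in> L2 \<mu>"
  by (rule L2I_bound[OF H_char_measurable, of "indicator (cyl p (\<lambda>_. 0) 0)"])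
     (auto simp: H_char_def norm_mult indicator_def)

lemma H_char_orthonormal:
  "(LINT \<omega>|\<mu>. H_char m \<omega> * cnj (H_char n \<omega>)) = (if m = n then 1 else 0)"
proof -
  let ?h = "vil_H_enum p"
  have "(LINT \<omega>|\<mu>. H_char m \<omega> * cnj (H_char n \<omega>))
      = (LINT \<omega>|\<mu>. indicator (cyl p (\<lambda>_. 0) 0) \<omega> * vil_char p \<omega> (vil_diff p (?h n) (?h m)))"
    by (rule Bochner_Integration.integral_cong)
       (auto simp: H_char_def vil_char_commute[of p _ "vil_diff p (?h n) (?h m)"] vil_char_diff indicator_def)
  also have "\<dots> = (if ?h n \<in> cyl p (?h m) 0 then 1 else 0)"
    by (subst integral_vil_char_cyl) (auto simp: vil_diff_in_cyl_zero_iff)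
  also have "?h n \<in> cyl p (?h m) 0 \<longleftrightarrow> m = n"
  proof
    assume "?h n \<in> cyl p (?h m) 0"
    then have "?h n = ?h m" by (intro vil_H_eqI[of _ p]) (auto simp: cyl_def)
    then show "m = n" using vil_H_enum_inj[OF p_ge_2] by simp
  qed (simp add: cyl_self)
  finally show ?thesis .
qed

lemma H_char_sum_norm:
  assumes "finite A"
  shows "(L2_norm \<mu> (\<lambda>\<omega>. \<Sum>n\<in>A. c n * H_char n \<omega>))\<^sup>2 = (\<Sum>n\<in>A. (cmod (c n))\<^sup>2)"
proof -
  have "complex_of_real ((L2_norm \<mu> (\<lambda>\<omega>. \<Sum>n\<in>A. c n * H_char n \<omega>))\<^sup>2)
      = (\<Sum>i\<in>A. \<Sum>j\<in>A. c i * cnj (c j) * (if i = j then 1 else 0))"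
    by (subst L2_norm_sum_Gram[OF assms H_char_L2]) (simp add: H_char_orthonormal)
  also have "\<dots> = (\<Sum>i\<in>A. c i * cnj (c i))"
    using assms by (intro sum.cong refl) (simp add: if_distrib cong: if_cong)
  also have "\<dots> = of_real (\<Sum>n\<in>A. (cmod (c n))\<^sup>2)"
    by (simp add: complex_norm_square del: of_real_power)
  finally show ?thesis unfolding of_real_eq_iff .
qed

text \<open>A relation, since the sum of the series is determined only up to a null set.\<close>

definition expands :: "(nat \<Rightarrow> complex) \<Rightarrow> (digits \<Rightarrow> complex) \<Rightarrow> bool" where
  "expands c m \<longleftrightarrow> c \<in> ell2 \<and> L2_sums \<mu> (\<lambda>n \<omega>. c n * H_char n \<omega>) m"

lemma expands_L2: "expands c m \<Longrightarrow> m \<in> L2 \<mu>"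
  by (simp add: expands_def L2_sums_def L2_converges_def)

lemma expands_ell2: "expands c m \<Longrightarrow> c \<in> ell2"
  by (simp add: expands_def)

lemma expands_exists:
  assumes "c \<in> ell2"
  obtains m where "expands c m"
proof -
  have "\<exists>m. L2_sums \<mu> (\<lambda>n \<omega>. c n * H_char n \<omega>) m"
    by (rule L2_sums_exists[of _ _ "\<lambda>n. (cmod (c n))\<^sup>2"])
       (use assms in \<open>auto simp: ell2_iff H_char_sum_norm intro: L2_scale H_char_L2\<close>)
  then show thesis using assms that by (auto simp: expands_def)
qed

lemma expands_norm:
  assumes "expands c m"
  shows "L2_norm \<mu> m = ell2_norm c"
proof -
  have "(\<lambda>N. (L2_norm \<mu> (\<lambda>\<omega>. \<Sum>n<N. c n * H_char n \<omega>))\<^sup>2) \<longlonglongrightarrow> (L2_norm \<mu> m)\<^sup>2"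
    using assms by (intro tendsto_power L2_converges_norm) (simp add: expands_def L2_sums_def)
  then have "(\<lambda>N. \<Sum>n<N. (cmod (c n))\<^sup>2) \<longlonglongrightarrow> (L2_norm \<mu> m)\<^sup>2"
    by (simp add: H_char_sum_norm)
  moreover have "(\<lambda>N. \<Sum>n<N. (cmod (c n))\<^sup>2) \<longlonglongrightarrow> (ell2_norm c)\<^sup>2"
    using assms by (simp add: expands_def ell2_norm_power2 ell2_iff summable_LIMSEQ)
  ultimately have "(L2_norm \<mu> m)\<^sup>2 = (ell2_norm c)\<^sup>2" by (rule LIMSEQ_unique)
  moreover have "0 \<le> ell2_norm c"
    using assms by (simp add: ell2_norm_def expands_def ell2_iff suminf_nonneg)
  ultimately show ?thesis by (simp add: power2_eq_iff_nonneg)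
qed

lemma expands_add:
  assumes "expands c m" "expands d k"
  shows "expands (\<lambda>n. c n + d n) (\<lambda>\<omega>. m \<omega> + k \<omega>)"
  using L2_converges_add[of \<mu> "\<lambda>N \<omega>. \<Sum>n<N. c n * H_char n \<omega>" m "\<lambda>N \<omega>. \<Sum>n<N. d n * H_char n \<omega>" k]
    ell2_add[of c d] assms
  by (simp add: expands_def L2_sums_def distrib_right sum.distrib)

lemma expands_scale:
  assumes "expands c m"
  shows "expands (\<lambda>n. a * c n) (\<lambda>\<omega>. a * m \<omega>)"
  using L2_converges_scale[of \<mu> "\<lambda>N \<omega>. \<Sum>n<N. c n * H_char n \<omega>" m a] ell2_scale[of c a] assms
  by (simp add: expands_def L2_sums_def sum_distrib_left mult.assoc)

lemma expands_vanishes_outside: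
  assumes "expands c m"
  shows "AE \<omega> in \<mu>. \<omega> \<notin> cyl p (\<lambda>_. 0) 0 \<longrightarrow> m \<omega> = 0"
proof -
  have "L2_converges \<mu> (\<lambda>N \<omega>. \<Sum>n<N. c n * H_char n \<omega>) m"
    using assms by (simp add: expands_def L2_sums_def)
  then obtain r where "AE \<omega> in \<mu>. (\<lambda>k. \<Sum>n<r k. c n * H_char n \<omega>) \<longlonglongrightarrow> m \<omega>"
    by (rule L2_converges_AE_subseq)
  then show ?thesis
  proof eventually_elim
    case (elim \<omega>)
    show ?case
    proof
      assume "\<omega> \<notin> cyl p (\<lambda>_. 0) 0"
      then have "(\<Sum>n<r k. c n * H_char n \<omega>) = 0" for k by (simp add: H_char_def)
      then show "m \<omega> = 0" using elim LIMSEQ_unique[OF elim, of 0] by simp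
    qed
  qed
qed

text \<open>Functions with disjoint supports satisfy the Pythagorean identity, and so do their coefficient
  sequences; this makes the real part of the inner product vanish, and multiplying one sequence
  by \<open>\<i>\<close> takes care of the imaginary part.\<close>

lemma expands_orthogonal:
  assumes c: "expands c m" and d: "expands d k" and disj: "AE \<omega> in \<mu>. m \<omega> = 0 \<or> k \<omega> = 0"
  shows "ell2_inner c d = 0"
proof -
  have re: "Re (ell2_inner c d) = 0"
    if d: "expands d k" and disj: "AE \<omega> in \<mu>. m \<omega> = 0 \<or> k \<omega> = 0" for d k
  proof -
    note L = expands_L2[OF c] expands_L2[OF d]
    have "(L2_norm \<mu> (\<lambda>\<omega>. m \<omega> + k \<omega>))\<^sup>2 = (LINT \<omega>|\<mu>. (cmod (m \<omega>))\<^sup>2 + (cmod (k \<omega>))\<^sup>2)"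
      unfolding L2_norm_power2
      by (rule integral_cong_AE)
         (use disj L2_measurable[OF L(1)] L2_measurable[OF L(2)] in \<open>auto elim!: eventually_mono\<close>)
    also have "\<dots> = (L2_norm \<mu> m)\<^sup>2 + (L2_norm \<mu> k)\<^sup>2"
      using L by (simp add: L2_norm_power2 L2_integrable)
    finally have "(ell2_norm (\<lambda>n. c n + d n))\<^sup>2 = (ell2_norm c)\<^sup>2 + (ell2_norm d)\<^sup>2"
      using expands_norm[OF c] expands_norm[OF d] expands_norm[OF expands_add[OF c d]] by simp
    then show ?thesis
      using ell2_norm_add_power2[OF expands_ell2[OF c] expands_ell2[OF d]] by simp
  qed
  have "Re (ell2_inner c (\<lambda>n. \<i> * d n)) = 0"
    by (rule re[OF expands_scale[OF d]]) (use disj in auto)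
  then have "Im (ell2_inner c d) = 0"
    by (simp add: ell2_inner_scale_right expands_ell2[OF c] expands_ell2[OF d])
  then show ?thesis using re[OF d disj] by (simp add: complex_eq_iff)
qed

end

context vil_dual begin

interpretation swapped: vil_dual p \<nu> \<mu> ..

text \<open>Completeness of the characters on \<open>U\<^sup>*\<close> is Plancherel's theorem in the opposite direction: the
  transform of a function supported in \<open>U\<^sup>*\<close> is constant on the cosets of \<open>U\<close>, so its squared norm is the
  sum of \<open>\<bar>\<cdot>\<bar>\<^sup>2\<close> of its values on \<open>H\<close>. Applied to \<open>cnj m\<close>, these values are the conjugates
  of the Fourier coefficients of \<open>m\<close>.\<close>

lemma expands_surj:
  assumes m: "m \<in> L2 \<nu>" and supp: "\<And>\<omega>. \<omega> \<in> vil p \<Longrightarrow> \<omega> \<notin> cyl p (\<lambda>_. 0) 0 \<Longrightarrow> m \<omega> = 0"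
  obtains c where "dual.expands c m"
proof -
  let ?h = "vil_H_enum p" and ?U = "cyl p (\<lambda>_. 0) 0"
  note [measurable] = L2_measurable[OF m]
  define g where "g \<omega> = cnj (m \<omega>)" for \<omega>
  have g2: "g \<in> L2 \<nu>" using m by (simp add: L2_def g_def[abs_def])
  have g1: "integrable \<nu> g"
  proof (rule Bochner_Integration.integrable_bound)
    show "integrable \<nu> (\<lambda>\<omega>. (cmod (m \<omega>))\<^sup>2 + indicator ?U \<omega>)"
      using L2_integrable[OF m] by (intro Bochner_Integration.integrable_add integrable_real_indicator) auto
    have "cmod a \<le> (cmod a)\<^sup>2 + 1" for a
      using sum_squares_bound[of "cmod a" 1] norm_ge_zero[of a] by (simp, linarith)
    then show "AE \<omega> in \<nu>. norm (g \<omega>) \<le> norm ((cmod (m \<omega>))\<^sup>2 + indicator ?U \<omega>)"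
      using supp by (intro AE_I2) (auto simp: g_def indicator_def)
  qed (use g2 L2_measurable in blast)
  let ?g = "vil_fourier_L1 p \<nu> g"
  define c where "c n = cnj (?g (?h n))" for n
  have coeff: "c n = (LINT \<omega>|\<nu>. m \<omega> * cnj (dual.H_char n \<omega>))" for n
    unfolding c_def vil_fourier_L1_def Bochner_Integration.integral_cnj[symmetric]
    by (rule Bochner_Integration.integral_cong)
       (use supp in \<open>auto simp: g_def dual.H_char_def vil_char_commute[of p _ "?h n"] indicator_def\<close>)
  have const: "?g (vil_add p x (?h n)) = ?g (?h n)" if x: "x \<in> ?U" for x n
    unfolding vil_fourier_L1_def
  proof (rule Bochner_Integration.integral_cong[OF refl])
    fix \<omega> assume "\<omega> \<in> space \<nu>"
    then have \<omega>: "\<omega> \<in> vil p" by simp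
    show "g \<omega> * cnj (vil_char p \<omega> (vil_add p x (?h n))) = g \<omega> * cnj (vil_char p \<omega> (?h n))"
    proof (cases "\<omega> \<in> ?U")
      case True
      then have "vil_char p (vil_add p x (?h n)) \<omega> = vil_char p (?h n) \<omega>"
        by (intro vil_char_coset_constant[of \<omega> p 0]) (use x in \<open>auto simp: vil_add_def cyl_def\<close>)
      then show ?thesis by (simp add: vil_char_commute[of p \<omega>])
    qed (use supp \<omega> in \<open>simp add: g_def\<close>)
  qed
  note F2 = swapped.Plancherel(1)[OF g1 g2]
  have "ennreal ((L2_norm \<nu> m)\<^sup>2) = ennreal ((L2_norm \<mu> ?g)\<^sup>2)"
    by (simp add: swapped.Plancherel(2)[OF g1 g2]) (simp add: L2_norm_def g_def)
  also have "\<dots> = (\<integral>\<^sup>+x. ennreal ((cmod (?g x))\<^sup>2) \<partial>\<mu>)" by (rule L2_norm_power2_nn[OF F2])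
  also have "\<dots> = (\<Sum>n. \<integral>\<^sup>+x. ennreal ((cmod (?g (vil_add p x (?h n))))\<^sup>2) * indicator ?U x \<partial>\<mu>)"
    using L2_measurable[OF F2] by (intro nn_integral_tiles) auto
  also have "\<dots> = (\<Sum>n. ennreal ((cmod (c n))\<^sup>2))"
  proof (rule suminf_cong)
    fix n
    have "(\<integral>\<^sup>+x. ennreal ((cmod (?g (vil_add p x (?h n))))\<^sup>2) * indicator ?U x \<partial>\<mu>)
        = (\<integral>\<^sup>+x. ennreal ((cmod (c n))\<^sup>2) * indicator ?U x \<partial>\<mu>)"
      by (rule nn_integral_cong) (auto simp: indicator_def const c_def)
    also have "\<dots> = ennreal ((cmod (c n))\<^sup>2) * emeasure \<mu> ?U"
      by (rule nn_integral_cmult_indicator) simp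
    finally show "(\<integral>\<^sup>+x. ennreal ((cmod (?g (vil_add p x (?h n))))\<^sup>2) * indicator ?U x \<partial>\<mu>)
        = ennreal ((cmod (c n))\<^sup>2)" by (simp add: emeasure_cyl)
  qed
  finally have eq: "ennreal ((L2_norm \<nu> m)\<^sup>2) = (\<Sum>n. ennreal ((cmod (c n))\<^sup>2))" .
  then have summ: "summable (\<lambda>n. (cmod (c n))\<^sup>2)"
    by (intro summable_suminf_not_top) (auto simp flip: eq)
  have "ennreal ((L2_norm \<nu> m)\<^sup>2) = ennreal (\<Sum>n. (cmod (c n))\<^sup>2)"
    unfolding eq by (rule suminf_ennreal2[OF _ summ]) simp
  then have norm: "(L2_norm \<nu> m)\<^sup>2 = (\<Sum>n. (cmod (c n))\<^sup>2)"
    by (subst (asm) ennreal_inj) (auto intro: suminf_nonneg summ)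
  let ?S = "\<lambda>N \<omega>. \<Sum>n<N. c n * dual.H_char n \<omega>"
  have "(\<lambda>N. sqrt ((L2_norm \<nu> m)\<^sup>2 - (\<Sum>n<N. (cmod (c n))\<^sup>2))) \<longlonglongrightarrow> sqrt ((L2_norm \<nu> m)\<^sup>2 - (L2_norm \<nu> m)\<^sup>2)"
    unfolding norm by (intro tendsto_real_sqrt tendsto_diff tendsto_const summable_LIMSEQ summ)
  moreover have "sqrt ((L2_norm \<nu> m)\<^sup>2 - (\<Sum>n<N. (cmod (c n))\<^sup>2)) = L2_norm \<nu> (\<lambda>\<omega>. ?S N \<omega> - m \<omega>)" for N
    unfolding L2_norm_minus_expansion[OF m dual.H_char_L2 dual.H_char_orthonormal coeff finite_lessThan,
        symmetric] L2_norm_minus_commute[of \<nu> "?S N"] by simp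
  ultimately have "L2_converges \<nu> ?S m"
    using m by (simp add: L2_converges_def L2_sum L2_scale dual.H_char_L2)
  then have "dual.expands c m" using summ by (simp add: dual.expands_def L2_sums_def ell2_iff)
  then show thesis by (rule that)
qed

end

section \<open>The bracket as a weight\<close>

context vil_haar begin

definition periodization :: "(digits \<Rightarrow> complex) \<Rightarrow> digits \<Rightarrow> ennreal" where
  "periodization g \<omega> = (\<Sum>n. ennreal ((cmod (g (vil_add p \<omega> (vil_H_enum p n))))\<^sup>2))"

text \<open>The bracket, as a function with real values; the value \<open>0\<close> at points of divergence agrees with
  the convention for divergent sums in the definition of the bracket.\<close>

definition weight :: "(digits \<Rightarrow> complex) \<Rightarrow> digits \<Rightarrow> real" where
  "weight g \<omega> = enn2real (periodization g \<omega>)"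

lemma weight_nonneg [simp]: "0 \<le> weight g \<omega>"
  by (simp add: weight_def)

text \<open>\<open>H\<close> and \<open>H\<^sup>\<bottom>\<close> consist of the same sequences, so the enumeration of \<open>H\<close> also runs through
  \<open>H\<^sup>\<bottom>\<close>.\<close>

lemma vil_bracket_eq_weight: "vil_bracket p g g \<omega> = of_real (weight g \<omega>)"
proof -
  let ?a = "\<lambda>n. (cmod (g (vil_add p \<omega> (vil_H_enum p n))))\<^sup>2"
  have HH: "vil_H_perp p = vil_H p" by (simp add: vil_H_perp_def vil_H_def)
  have "vil_bracket p g g \<omega> = (\<Sum>\<^sub>\<infinity>h\<in>vil_H p. of_real ((cmod (g (vil_add p \<omega> h)))\<^sup>2))"
    unfolding vil_bracket_def HH complex_norm_square ..
  also have "\<dots> = (\<Sum>\<^sub>\<infinity>n. of_real (?a n))"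
    by (rule infsum_reindex_bij_betw[OF bij_betw_vil_H_enum[OF p_ge_2], symmetric])
  also have "\<dots> = of_real (weight g \<omega>)"
  proof (cases "summable ?a")
    case True
    then have "(?a has_sum (\<Sum>n. ?a n)) UNIV"
      by (intro norm_summable_imp_has_sum) (auto intro: summable_sums)
    then have "((\<lambda>n. complex_of_real (?a n)) has_sum of_real (\<Sum>n. ?a n)) UNIV"
      by (simp only: has_sum_of_real_iff)
    moreover have "weight g \<omega> = (\<Sum>n. ?a n)"
    proof -
      have "periodization g \<omega> = ennreal (\<Sum>n. ?a n)"
        unfolding periodization_def by (rule suminf_ennreal2[OF _ True]) simp
      moreover have "0 \<le> (\<Sum>n. ?a n)" by (rule suminf_nonneg[OF True]) simp
      ultimately show ?thesis by (simp only: weight_def enn2real_ennreal)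
    qed
    ultimately show ?thesis by (simp add: infsumI)
  next
    case False
    have "summable ?a" if "periodization g \<omega> \<noteq> top"
      by (rule summable_suminf_not_top[OF _ that[unfolded periodization_def]]) simp
    then have "periodization g \<omega> = top" using False by blast
    moreover have "\<not> (\<lambda>n. complex_of_real (?a n)) summable_on UNIV"
    proof
      assume "(\<lambda>n. complex_of_real (?a n)) summable_on UNIV"
      then have "?a summable_on UNIV" using summable_on_Re by fastforce
      then show False using False summable_on_imp_summable by blast
    qed
    ultimately show ?thesis by (simp add: weight_def infsum_not_exists)
  qed
  finally show ?thesis .
qed

lemma periodization_measurable [measurable]:
  assumes "g \<in> borel_measurable \<mu>"
  shows "periodization g \<in> borel_measurable \<mu>"
proof -
  have "(\<lambda>\<omega>. g (vil_add p \<omega> (vil_H_enum p n))) \<in> borel_measurable \<mu>" for n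
    by (rule measurable_compose[OF vil_add_measurable' assms]) simp
  then show ?thesis unfolding periodization_def[abs_def] by measurable
qed

lemma weight_measurable [measurable]:
  "g \<in> borel_measurable \<mu> \<Longrightarrow> weight g \<in> borel_measurable \<mu>"
  unfolding weight_def[abs_def] by measurable

text \<open>Over \<open>U\<close> the periodization has the finite integral \<open>\<parallel>g\<parallel>\<^sup>2\<close>, because the tiles cover the group
  once.\<close>

lemma periodization_finite_AE:
  assumes g: "g \<in> L2 \<mu>"
  shows "AE \<omega> in \<mu>. \<omega> \<in> cyl p (\<lambda>_. 0) 0 \<longrightarrow> ennreal (weight g \<omega>) = periodization g \<omega>"
proof -
  note [measurable] = L2_measurable[OF g]
  let ?U = "cyl p (\<lambda>_. 0) 0"
  have [measurable]: "(\<lambda>\<omega>. g (vil_add p \<omega> (vil_H_enum p n))) \<in> borel_measurable \<mu>" for n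
    by (rule measurable_compose[OF vil_add_measurable' L2_measurable[OF g]]) simp
  have "(\<integral>\<^sup>+\<omega>. periodization g \<omega> * indicator ?U \<omega> \<partial>\<mu>)
      = (\<Sum>n. \<integral>\<^sup>+\<omega>. ennreal ((cmod (g (vil_add p \<omega> (vil_H_enum p n))))\<^sup>2) * indicator ?U \<omega> \<partial>\<mu>)"
    unfolding periodization_def ennreal_suminf_multc[symmetric]
    by (rule nn_integral_suminf) measurable
  also have "\<dots> = (\<integral>\<^sup>+\<omega>. ennreal ((cmod (g \<omega>))\<^sup>2) \<partial>\<mu>)"
    by (rule nn_integral_tiles[symmetric]) measurable
  also have "\<dots> < \<infinity>" using L2_norm_power2_nn[OF g, symmetric] by simp
  finally have "(\<integral>\<^sup>+\<omega>. periodization g \<omega> * indicator ?U \<omega> \<partial>\<mu>) \<noteq> \<infinity>" by simp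
  then have "AE \<omega> in \<mu>. periodization g \<omega> * indicator ?U \<omega> \<noteq> \<infinity>"
    by (intro nn_integral_PInf_AE) auto
  then show ?thesis
    by eventually_elim (auto simp: weight_def indicator_def less_top)
qed

text \<open>Cutting the integral into tiles and moving them to \<open>U\<close>, a periodic factor stays in place while
  the squares of \<open>g\<close> add up to the weight.\<close>

lemma nn_integral_periodic_mult:
  assumes g: "g \<in> L2 \<mu>" and [measurable]: "q \<in> borel_measurable \<mu>"
    and per: "\<And>\<omega> n. \<omega> \<in> vil p \<Longrightarrow> q (vil_add p \<omega> (vil_H_enum p n)) = q \<omega>"
  shows "(\<integral>\<^sup>+\<omega>. ennreal ((cmod (q \<omega> * g \<omega>))\<^sup>2) \<partial>\<mu>)
    = (\<integral>\<^sup>+\<omega>. ennreal ((cmod (of_real (sqrt (weight g \<omega>)) * (indicator (cyl p (\<lambda>_. 0) 0) \<omega> * q \<omega>)))\<^sup>2) \<partial>\<mu>)"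
proof -
  note [measurable] = L2_measurable[OF g]
  let ?U = "cyl p (\<lambda>_. 0) 0" and ?h = "vil_H_enum p"
  have [measurable]: "(\<lambda>\<omega>. g (vil_add p \<omega> (?h n))) \<in> borel_measurable \<mu>" for n
    by (rule measurable_compose[OF vil_add_measurable' L2_measurable[OF g]]) simp
  have "(\<integral>\<^sup>+\<omega>. ennreal ((cmod (q \<omega> * g \<omega>))\<^sup>2) \<partial>\<mu>)
      = (\<Sum>n. \<integral>\<^sup>+\<omega>. ennreal ((cmod (q (vil_add p \<omega> (?h n)) * g (vil_add p \<omega> (?h n))))\<^sup>2)
          * indicator ?U \<omega> \<partial>\<mu>)"
    by (rule nn_integral_tiles) measurable
  also have "\<dots> = (\<Sum>n. \<integral>\<^sup>+\<omega>. ennreal ((cmod (q \<omega>))\<^sup>2) * indicator ?U \<omega>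
      * ennreal ((cmod (g (vil_add p \<omega> (?h n))))\<^sup>2) \<partial>\<mu>)"
    by (intro suminf_cong nn_integral_cong)
       (simp add: per norm_mult power_mult_distrib ennreal_mult mult_ac)
  also have "\<dots> = (\<integral>\<^sup>+\<omega>. (\<Sum>n. ennreal ((cmod (q \<omega>))\<^sup>2) * indicator ?U \<omega>
      * ennreal ((cmod (g (vil_add p \<omega> (?h n))))\<^sup>2)) \<partial>\<mu>)"
    by (rule nn_integral_suminf[symmetric]) measurable
  also have "\<dots> = (\<integral>\<^sup>+\<omega>. ennreal ((cmod (q \<omega>))\<^sup>2) * indicator ?U \<omega> * periodization g \<omega> \<partial>\<mu>)"
    by (simp add: periodization_def)
  also have "\<dots> = (\<integral>\<^sup>+\<omega>. ennreal ((cmod (of_real (sqrt (weight g \<omega>)) * (indicator ?U \<omega> * q \<omega>)))\<^sup>2) \<partial>\<mu>)"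
    using periodization_finite_AE[OF g]
    by (intro nn_integral_cong_AE, eventually_elim)
       (auto simp: indicator_def norm_mult power_mult_distrib ennreal_mult mult.commute)
  finally show ?thesis .
qed

lemma L2_translate:
  assumes f: "f \<in> L2 \<mu>" and a: "a \<in> vil p"
  shows "vil_translate p a f \<in> L2 \<mu>" "L2_norm \<mu> (vil_translate p a f) = L2_norm \<mu> f"
proof -
  have eq: "vil_translate p a f x = f (vil_add p (vil_diff p (\<lambda>_. 0) a) x)" for x
    unfolding vil_translate_def by (rule arg_cong[where f = f]) (rule vil_diff_eq_add_neg)
  have b: "vil_diff p (\<lambda>_. 0) a \<in> vil p" using a by simp
  have "vil_translate p a f \<in> borel_measurable \<mu>"
    unfolding vil_translate_def[abs_def]
    by (rule measurable_compose[OF vil_diff_measurable[OF a] L2_measurable[OF f]])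
  then show "vil_translate p a f \<in> L2 \<mu>"
    using integrable_translate[OF b L2_integrable[OF f]] by (simp add: L2_def eq)
  show "L2_norm \<mu> (vil_translate p a f) = L2_norm \<mu> f"
    unfolding L2_norm_def eq
    using integral_translate[OF b, of "\<lambda>x. (cmod (f x))\<^sup>2"] L2_measurable[OF f] by simp
qed

lemma integrable_vil_translate:
  assumes f: "integrable \<mu> f" and a: "a \<in> vil p"
  shows "integrable \<mu> (vil_translate p a f)"
proof -
  have "vil_translate p a f = (\<lambda>x. f (vil_add p (vil_diff p (\<lambda>_. 0) a) x))"
    unfolding vil_translate_def
    by (rule ext, rule arg_cong[where f = f]) (rule vil_diff_eq_add_neg)
  then show ?thesis using integrable_translate[OF _ f, of "vil_diff p (\<lambda>_. 0) a"] a by simp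
qed

lemma L2_converges_translate:
  assumes F: "L2_converges \<mu> F f" and a: "a \<in> vil p"
  shows "L2_converges \<mu> (\<lambda>n. vil_translate p a (F n)) (vil_translate p a f)"
proof -
  have L: "F n \<in> L2 \<mu>" "f \<in> L2 \<mu>" for n using F by (auto simp: L2_converges_def)
  have "(\<lambda>x. vil_translate p a (F n) x - vil_translate p a f x)
      = vil_translate p a (\<lambda>x. F n x - f x)" for n
    by (simp add: vil_translate_def)
  then show ?thesis
    using F L a L2_translate(2)[OF L2_diff[OF L] a] by (simp add: L2_converges_def L2_translate(1))
qed

end

context vil_dual begin

text \<open>Translation by \<open>h\<close> becomes multiplication by a character that is invariant under
  \<open>H\<^sup>\<bottom>\<close>. So the norm of a combination of translates is a weighted norm of the trigonometric
  polynomial with the same coefficients, and the weight collects the values of the transform along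
  the cosets of \<open>H\<^sup>\<bottom>\<close>. The identity is first proved on \<open>L\<^sup>1 \<inter> L\<^sup>2\<close>, where the transform is an
  integral.\<close>

lemma translates_isometry:
  assumes \<phi>: "\<phi> \<in> L2 \<mu>" and A: "finite A"
  defines "g \<equiv> vil_fourier p \<mu> \<nu> \<phi>"
  shows "(\<lambda>\<omega>. of_real (sqrt (dual.weight g \<omega>)) * (\<Sum>n\<in>A. c n * dual.H_char n \<omega>)) \<in> L2 \<nu>"
    "L2_norm \<mu> (\<lambda>x. \<Sum>n\<in>A. c n * vil_translate p (vil_H_enum p n) \<phi> x)
      = L2_norm \<nu> (\<lambda>\<omega>. of_real (sqrt (dual.weight g \<omega>)) * (\<Sum>n\<in>A. c n * dual.H_char n \<omega>))"
proof -
  let ?h = "vil_H_enum p"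
  define T where "T f x = (\<Sum>n\<in>A. c n * vil_translate p (?h n) f x)" for f x
  define q where "q \<omega> = (\<Sum>n\<in>A. c n * cnj (vil_char p (?h n) \<omega>))" for \<omega>
  have [measurable]: "q \<in> borel_measurable \<nu>"
    unfolding q_def[abs_def]
    by (intro borel_measurable_sum borel_measurable_times borel_measurable_const
        complex_borel_measurable_cnj dual.vil_char_measurable') simp
  have q_bound: "cmod (q \<omega>) \<le> (\<Sum>n\<in>A. cmod (c n))" for \<omega>
    unfolding q_def by (rule order_trans[OF norm_sum]) (simp add: norm_mult)
  have per: "q (vil_add p \<omega> (?h n)) = q \<omega>" if "\<omega> \<in> vil p" for \<omega> n
    unfolding q_def using that
    by (intro sum.cong refl)
       (simp add: vil_char_commute[of p _ "vil_add p \<omega> (?h n)"] vil_char_add vil_char_H_H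
          vil_char_commute[of p \<omega>])
  obtain F where F1: "\<And>n. integrable \<mu> (F n)" and conv: "L2_converges \<mu> F \<phi>"
    and convF: "L2_converges \<nu> (\<lambda>n. vil_fourier_L1 p \<mu> (F n)) g"
    using vil_fourier_approx[OF \<phi>] unfolding g_def by blast
  have F2: "F n \<in> L2 \<mu>" for n using conv by (simp add: L2_converges_def)
  have g: "g \<in> L2 \<nu>" using convF by (simp add: L2_converges_def)
  have isoF: "L2_norm \<mu> (T (F k)) = L2_norm \<nu> (\<lambda>\<omega>. q \<omega> * vil_fourier_L1 p \<mu> (F k) \<omega>)" for k
  proof -
    have TF: "integrable \<mu> (T (F k))" "T (F k) \<in> L2 \<mu>"
      unfolding T_def
      by (auto intro!: Bochner_Integration.integrable_sum integrable_mult_right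
          integrable_vil_translate F1 L2_sum L2_scale L2_translate F2)
    have eq: "vil_fourier_L1 p \<mu> (T (F k)) \<omega> = q \<omega> * vil_fourier_L1 p \<mu> (F k) \<omega>" if "\<omega> \<in> vil p" for \<omega>
      unfolding T_def q_def using that F1 A
      by (subst fourier_L1_sum)
         (auto simp: fourier_L1_translate sum_distrib_right mult.assoc intro!: integrable_vil_translate)
    have "L2_norm \<mu> (T (F k)) = L2_norm \<nu> (vil_fourier_L1 p \<mu> (T (F k)))"
      by (rule Plancherel(2)[OF TF, symmetric])
    also have "\<dots> = L2_norm \<nu> (\<lambda>\<omega>. q \<omega> * vil_fourier_L1 p \<mu> (F k) \<omega>)"
    proof (rule L2_norm_cong_AE)
      show "vil_fourier_L1 p \<mu> (T (F k)) \<in> borel_measurable \<nu>"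
        by (rule L2_measurable[OF Plancherel(1)[OF TF]])
      show "(\<lambda>\<omega>. q \<omega> * vil_fourier_L1 p \<mu> (F k) \<omega>) \<in> borel_measurable \<nu>"
        using L2_measurable[OF Plancherel(1)[OF F1 F2]] by measurable
    qed (use eq in auto)
    finally show ?thesis .
  qed
  have "L2_converges \<mu> (\<lambda>k. T (F k)) (T \<phi>)"
    unfolding T_def[abs_def]
    by (rule L2_converges_sum[OF A]) (intro L2_converges_scale L2_converges_translate conv, simp)
  then have "(\<lambda>k. L2_norm \<mu> (T (F k))) \<longlonglongrightarrow> L2_norm \<mu> (T \<phi>)" by (rule L2_converges_norm)
  moreover have "(\<lambda>k. L2_norm \<mu> (T (F k))) \<longlonglongrightarrow> L2_norm \<nu> (\<lambda>\<omega>. q \<omega> * g \<omega>)"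
    unfolding isoF by (rule L2_converges_norm[OF L2_converges_bounded_mult[OF convF _ q_bound]]) (auto intro: sum_nonneg)
  ultimately have iso: "L2_norm \<mu> (T \<phi>) = L2_norm \<nu> (\<lambda>\<omega>. q \<omega> * g \<omega>)" by (rule LIMSEQ_unique)
  have qg: "(\<lambda>\<omega>. q \<omega> * g \<omega>) \<in> L2 \<nu>" by (rule L2_bounded_mult(1)[OF g _ q_bound]) (auto intro: sum_nonneg)
  let ?S = "\<lambda>\<omega>. of_real (sqrt (dual.weight g \<omega>)) * (\<Sum>n\<in>A. c n * dual.H_char n \<omega>)"
  have S_eq: "?S \<omega> = of_real (sqrt (dual.weight g \<omega>)) * (indicator (cyl p (\<lambda>_. 0) 0) \<omega> * q \<omega>)" for \<omega>
    by (simp add: dual.H_char_def q_def sum_distrib_left mult_ac)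
  have nn: "(\<integral>\<^sup>+\<omega>. ennreal ((cmod (q \<omega> * g \<omega>))\<^sup>2) \<partial>\<nu>) = (\<integral>\<^sup>+\<omega>. ennreal ((cmod (?S \<omega>))\<^sup>2) \<partial>\<nu>)"
    unfolding S_eq by (rule dual.nn_integral_periodic_mult[OF g _ per]) measurable
  have [measurable]: "?S \<in> borel_measurable \<nu>"
    using L2_measurable[OF g] by measurable
  show S: "?S \<in> L2 \<nu>"
    by (rule L2I_nn) (measurable, simp add: nn[symmetric] L2_norm_power2_nn[OF qg, symmetric])
  have "ennreal ((L2_norm \<nu> (\<lambda>\<omega>. q \<omega> * g \<omega>))\<^sup>2) = ennreal ((L2_norm \<nu> ?S)\<^sup>2)"
    unfolding L2_norm_power2_nn[OF qg] L2_norm_power2_nn[OF S] by (rule nn)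
  then have "L2_norm \<nu> (\<lambda>\<omega>. q \<omega> * g \<omega>) = L2_norm \<nu> ?S"
    by (simp add: power2_eq_iff_nonneg)
  then show "L2_norm \<mu> (\<lambda>x. \<Sum>n\<in>A. c n * vil_translate p (?h n) \<phi> x) = L2_norm \<nu> ?S"
    using iso by (simp add: T_def[abs_def])
qed

text \<open>Passing to infinite sums. The weighted partial sums form a Cauchy sequence because of the
  isometry, and an almost everywhere convergent subsequence of the unweighted sums identifies the
  limit.\<close>

lemma synthesis_isometry:
  assumes \<phi>: "\<phi> \<in> L2 \<mu>"
  defines "g \<equiv> vil_fourier p \<mu> \<nu> \<phi>"
  assumes G: "L2_sums \<mu> (\<lambda>n x. c n * vil_translate p (vil_H_enum p n) \<phi> x) G"
    and m: "dual.expands c m"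
  shows "(\<lambda>\<omega>. of_real (sqrt (dual.weight g \<omega>)) * m \<omega>) \<in> L2 \<nu>"
    "L2_norm \<mu> G = L2_norm \<nu> (\<lambda>\<omega>. of_real (sqrt (dual.weight g \<omega>)) * m \<omega>)"
proof -
  let ?t = "\<lambda>n. vil_translate p (vil_H_enum p n) \<phi>"
  let ?P = "\<lambda>N x. \<Sum>n<N. c n * ?t n x" and ?S = "\<lambda>N \<omega>. \<Sum>n<N. c n * dual.H_char n \<omega>"
  let ?r = "\<lambda>\<omega>. complex_of_real (sqrt (dual.weight g \<omega>))"
  note iso = translates_isometry[OF \<phi>, folded g_def]
  have P: "L2_converges \<mu> ?P G" using G by (simp add: L2_sums_def)
  have S: "L2_converges \<nu> ?S m" using m by (simp add: dual.expands_def L2_sums_def)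
  have rS: "(\<lambda>\<omega>. ?r \<omega> * ?S N \<omega>) \<in> L2 \<nu>" for N by (rule iso) simp
  have diff: "L2_norm \<nu> (\<lambda>\<omega>. ?r \<omega> * ?S N \<omega> - ?r \<omega> * ?S M \<omega>) = L2_norm \<mu> (\<lambda>x. ?P N x - ?P M x)" for M N
  proof -
    \<comment> \<open>The difference of two partial sums, in either order, as a single finite combination.\<close>
    define d where "d n = (if n < N then c n else 0) - (if n < M then c n else 0)" for n
    have d: "(\<Sum>n<N. c n * u n) - (\<Sum>n<M. c n * u n) = (\<Sum>n<max N M. d n * u n)" for u :: "nat \<Rightarrow> complex"
    proof -
      have "(\<Sum>n<K. c n * u n) = (\<Sum>n<max N M. (if n < K then c n else 0) * u n)" if "K \<le> max N M" for K
        using that by (intro sum.mono_neutral_cong_left) auto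
      from this[of N] this[of M] show ?thesis
        by (simp add: d_def left_diff_distrib sum_subtractf)
    qed
    have "L2_norm \<mu> (\<lambda>x. ?P N x - ?P M x) = L2_norm \<mu> (\<lambda>x. \<Sum>n<max N M. d n * ?t n x)"
      unfolding d ..
    also have "\<dots> = L2_norm \<nu> (\<lambda>\<omega>. ?r \<omega> * (\<Sum>n<max N M. d n * dual.H_char n \<omega>))"
      by (rule iso) simp
    also have "\<dots> = L2_norm \<nu> (\<lambda>\<omega>. ?r \<omega> * ?S N \<omega> - ?r \<omega> * ?S M \<omega>)"
      unfolding d[symmetric] right_diff_distrib ..
    finally show ?thesis ..
  qed
  have cauchy: "L2_Cauchy \<nu> (\<lambda>N \<omega>. ?r \<omega> * ?S N \<omega>)"
    using L2_converges_imp_Cauchy[OF P] rS unfolding L2_Cauchy_def diff by simp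
  obtain k where k: "strict_mono k" "AE \<omega> in \<nu>. (\<lambda>i. ?S (k i) \<omega>) \<longlonglongrightarrow> m \<omega>"
    using L2_converges_AE_subseq[OF S] by blast
  have lim: "AE \<omega> in \<nu>. (\<lambda>i. ?r \<omega> * ?S (k i) \<omega>) \<longlonglongrightarrow> ?r \<omega> * m \<omega>"
    using k(2) by eventually_elim (rule tendsto_mult_left)
  obtain F where "L2_converges \<nu> (\<lambda>n. vil_fourier_L1 p \<mu> (F n)) g"
    using vil_fourier_approx[OF \<phi>] unfolding g_def by blast
  then have "g \<in> borel_measurable \<nu>" by (auto simp: L2_converges_def dest: L2_measurable)
  then have "(\<lambda>\<omega>. ?r \<omega> * m \<omega>) \<in> borel_measurable \<nu>"
    using L2_measurable[OF dual.expands_L2[OF m]] by measurable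
  then have conv: "L2_converges \<nu> (\<lambda>N \<omega>. ?r \<omega> * ?S N \<omega>) (\<lambda>\<omega>. ?r \<omega> * m \<omega>)"
    by (rule L2_Cauchy_AE_limit[OF cauchy k(1) _ lim])
  then show "(\<lambda>\<omega>. ?r \<omega> * m \<omega>) \<in> L2 \<nu>" by (simp add: L2_converges_def)
  have "L2_norm \<mu> (?P N) = L2_norm \<nu> (\<lambda>\<omega>. ?r \<omega> * ?S N \<omega>)" for N by (rule iso) simp
  then have "(\<lambda>N. L2_norm \<mu> (?P N)) \<longlonglongrightarrow> L2_norm \<nu> (\<lambda>\<omega>. ?r \<omega> * m \<omega>)"
    using L2_converges_norm[OF conv] by simp
  then show "L2_norm \<mu> G = L2_norm \<nu> (\<lambda>\<omega>. ?r \<omega> * m \<omega>)"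
    using L2_converges_norm[OF P] LIMSEQ_unique by blast
qed

section \<open>Frame bounds and bounds of the bracket\<close>

lemma synthesis_norm:
  assumes \<phi>: "\<phi> \<in> L2 \<mu>"
  defines "w \<equiv> dual.weight (vil_fourier p \<mu> \<nu> \<phi>)"
  assumes ex: "\<exists>G. L2_sums \<mu> (\<lambda>n x. c n * vil_translate p (vil_H_enum p n) \<phi> x) G"
    and m: "dual.expands c m"
  shows "integrable \<nu> (\<lambda>\<omega>. w \<omega> * (cmod (m \<omega>))\<^sup>2)"
    "(L2_norm \<mu> (synthesis \<mu> (\<lambda>n. vil_translate p (vil_H_enum p n) \<phi>) c))\<^sup>2
      = (LINT \<omega>|\<nu>. w \<omega> * (cmod (m \<omega>))\<^sup>2)"
proof -
  let ?G = "synthesis \<mu> (\<lambda>n. vil_translate p (vil_H_enum p n) \<phi>) c"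
  have "L2_sums \<mu> (\<lambda>n x. c n * vil_translate p (vil_H_enum p n) \<phi> x) ?G"
    unfolding synthesis_def by (rule someI_ex[OF ex])
  note * = synthesis_isometry[OF \<phi> this m, folded w_def]
  have eq: "(cmod (of_real (sqrt (w \<omega>)) * m \<omega>))\<^sup>2 = w \<omega> * (cmod (m \<omega>))\<^sup>2" for \<omega>
    by (simp add: norm_mult power_mult_distrib w_def)
  show "integrable \<nu> (\<lambda>\<omega>. w \<omega> * (cmod (m \<omega>))\<^sup>2)" using L2_integrable[OF *(1)] unfolding eq .
  show "(L2_norm \<mu> ?G)\<^sup>2 = (LINT \<omega>|\<nu>. w \<omega> * (cmod (m \<omega>))\<^sup>2)"
    unfolding *(2) L2_norm_power2 eq ..
qed

lemma synthesis_ker_iff: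
  assumes \<phi>: "\<phi> \<in> L2 \<mu>"
  defines "w \<equiv> dual.weight (vil_fourier p \<mu> \<nu> \<phi>)"
  assumes ex: "\<exists>G. L2_sums \<mu> (\<lambda>n x. c n * vil_translate p (vil_H_enum p n) \<phi> x) G"
    and m: "dual.expands c m"
  shows "c \<in> synthesis_ker \<mu> (\<lambda>n. vil_translate p (vil_H_enum p n) \<phi>)
    \<longleftrightarrow> (AE \<omega> in \<nu>. w \<omega> = 0 \<or> m \<omega> = 0)"
proof -
  note * = synthesis_norm[OF \<phi> ex m, folded w_def]
  have "c \<in> synthesis_ker \<mu> (\<lambda>n. vil_translate p (vil_H_enum p n) \<phi>)
      \<longleftrightarrow> (LINT \<omega>|\<nu>. w \<omega> * (cmod (m \<omega>))\<^sup>2) = 0"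
    using dual.expands_ell2[OF m] *(2) by (simp add: synthesis_ker_def flip: *(2))
  also have "\<dots> \<longleftrightarrow> (AE \<omega> in \<nu>. w \<omega> * (cmod (m \<omega>))\<^sup>2 = 0)"
    by (rule integral_nonneg_eq_0_iff_AE[OF *(1)]) (simp add: w_def)
  finally show ?thesis by simp
qed

text \<open>Orthogonality to the kernel forces the expanded function to vanish where the weight does: its
  part there is itself expanded by a sequence in the kernel.\<close>

lemma ell2_perp_ker_vanishes:
  assumes \<phi>: "\<phi> \<in> L2 \<mu>"
  defines "w \<equiv> dual.weight (vil_fourier p \<mu> \<nu> \<phi>)" and "t \<equiv> (\<lambda>n. vil_translate p (vil_H_enum p n) \<phi>)"
  assumes ex: "\<And>c. c \<in> ell2 \<Longrightarrow> \<exists>G. L2_sums \<mu> (\<lambda>n x. c n * t n x) G"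
    and w [measurable]: "w \<in> borel_measurable \<nu>"
    and c: "c \<in> ell2_perp (synthesis_ker \<mu> t)" and m: "dual.expands c m"
  shows "AE \<omega> in \<nu>. w \<omega> = 0 \<longrightarrow> m \<omega> = 0"
proof -
  let ?U = "cyl p (\<lambda>_. 0) 0"
  have [measurable]: "m \<in> borel_measurable \<nu>" using L2_measurable[OF dual.expands_L2[OF m]] .
  define m0 where "m0 \<omega> = (if w \<omega> = 0 \<and> \<omega> \<in> ?U then m \<omega> else 0)" for \<omega>
  have [measurable]: "m0 \<in> borel_measurable \<nu>" unfolding m0_def[abs_def] by measurable
  have m0: "m0 \<in> L2 \<nu>"
    by (rule L2I_bound[OF _ L2_integrable[OF dual.expands_L2[OF m]]]) (auto simp: m0_def)
  obtain d where d: "dual.expands d m0"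
    using expands_surj[OF m0] by (auto simp: m0_def)
  have "d \<in> synthesis_ker \<mu> t"
    unfolding t_def
    by (rule iffD2[OF synthesis_ker_iff[OF \<phi> ex[unfolded t_def, OF dual.expands_ell2[OF d]] d]])
       (auto simp: m0_def w_def)
  then have "ell2_inner c d = 0" using c by (simp add: ell2_perp_def)
  moreover have "ell2_inner (\<lambda>n. c n + (-1) * d n) d = 0"
  proof (rule dual.expands_orthogonal[OF dual.expands_add[OF m dual.expands_scale[OF d]] d])
    show "AE \<omega> in \<nu>. m \<omega> + (-1) * m0 \<omega> = 0 \<or> m0 \<omega> = 0" by (auto simp: m0_def)
  qed
  moreover have "ell2_inner c d = ell2_inner (\<lambda>n. c n + (-1) * d n) d + ell2_inner d d"
    using ell2_inner_add_left[of "\<lambda>n. c n + (-1) * d n" d d] dual.expands_ell2[OF m]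
      dual.expands_ell2[OF d] dual.expands_ell2[OF dual.expands_add[OF m dual.expands_scale[OF d, of "-1"]]]
    by simp
  ultimately have "ell2_norm d = 0" using ell2_inner_self[OF dual.expands_ell2[OF d]] by simp
  then have "AE \<omega> in \<nu>. m0 \<omega> = 0"
    using L2_norm_eq_0_iff[OF m0] dual.expands_norm[OF d] by simp
  with dual.expands_vanishes_outside[OF m] show ?thesis
    by eventually_elim (auto simp: m0_def split: if_splits)
qed

text \<open>The upper bound on the weight makes the partial sums a Cauchy sequence, so that the synthesis
  operator is defined. The inequalities follow by integrating the pointwise ones: off \<open>U\<^sup>*\<close> and where
  the weight vanishes, the function expanded by \<open>c\<close> vanishes too.\<close>

lemma frame_sequence_if_weight_bounds:
  assumes \<phi>: "\<phi> \<in> L2 \<mu>" and CD: "0 < C" "C \<le> D"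
  defines "w \<equiv> dual.weight (vil_fourier p \<mu> \<nu> \<phi>)"
  assumes w [measurable]: "w \<in> borel_measurable \<nu>"
    and bounds: "AE \<omega> in \<nu>. \<omega> \<in> cyl p (\<lambda>_. 0) 0 \<longrightarrow> w \<omega> \<noteq> 0 \<longrightarrow> C \<le> w \<omega> \<and> w \<omega> \<le> D"
  shows "frame_sequence \<mu> (\<lambda>n. vil_translate p (vil_H_enum p n) \<phi>) C D"
proof -
  let ?t = "\<lambda>n. vil_translate p (vil_H_enum p n) \<phi>" and ?U = "cyl p (\<lambda>_. 0) 0"
  have t: "?t n \<in> L2 \<mu>" for n by (rule L2_translate(1)[OF \<phi>]) simp
  have ex: "\<exists>G. L2_sums \<mu> (\<lambda>n x. c n * ?t n x) G" if c: "c \<in> ell2" for c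
  proof (rule L2_sums_exists[of _ _ "\<lambda>n. D * (cmod (c n))\<^sup>2"])
    show "summable (\<lambda>n. D * (cmod (c n))\<^sup>2)" using c by (simp add: ell2_iff summable_mult)
    fix M N :: nat
    let ?S = "\<lambda>\<omega>. \<Sum>n=M..<N. c n * dual.H_char n \<omega>"
    have S: "?S \<in> L2 \<nu>" by (intro L2_sum L2_scale dual.H_char_L2)
    note iso = translates_isometry[OF \<phi>, of "{M..<N}" c, folded w_def]
    have "(L2_norm \<mu> (\<lambda>x. \<Sum>n=M..<N. c n * ?t n x))\<^sup>2
        = (LINT \<omega>|\<nu>. (cmod (of_real (sqrt (w \<omega>)) * ?S \<omega>))\<^sup>2)"
      by (subst iso(2)) (simp_all add: L2_norm_power2)
    also have "\<dots> \<le> (LINT \<omega>|\<nu>. D * (cmod (?S \<omega>))\<^sup>2)"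
    proof (rule integral_mono_AE)
      show "integrable \<nu> (\<lambda>\<omega>. (cmod (of_real (sqrt (w \<omega>)) * ?S \<omega>))\<^sup>2)"
        by (rule L2_integrable[OF iso(1)]) simp
      show "integrable \<nu> (\<lambda>\<omega>. D * (cmod (?S \<omega>))\<^sup>2)"
        by (intro integrable_mult_right L2_integrable S)
      show "AE \<omega> in \<nu>. (cmod (of_real (sqrt (w \<omega>)) * ?S \<omega>))\<^sup>2 \<le> D * (cmod (?S \<omega>))\<^sup>2"
        using bounds
      proof eventually_elim
        case (elim \<omega>)
        have "w \<omega> * (cmod (?S \<omega>))\<^sup>2 \<le> D * (cmod (?S \<omega>))\<^sup>2"
        proof (cases "\<omega> \<in> ?U")
          case True
          then have "w \<omega> \<le> D" using elim CD by (cases "w \<omega> = 0") auto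
          then show ?thesis by (rule mult_right_mono) simp
        next
          case False
          then have "?S \<omega> = 0" by (simp add: dual.H_char_def)
          then show ?thesis by simp
        qed
        then show ?case by (simp add: norm_mult power_mult_distrib w_def)
      qed
    qed
    also have "\<dots> = (\<Sum>n=M..<N. D * (cmod (c n))\<^sup>2)"
      by (simp add: dual.H_char_sum_norm sum_distrib_left flip: L2_norm_power2)
    finally show "(L2_norm \<mu> (\<lambda>x. \<Sum>n=M..<N. c n * ?t n x))\<^sup>2 \<le> (\<Sum>n=M..<N. D * (cmod (c n))\<^sup>2)" .
  qed (intro L2_scale t)
  have "C * (ell2_norm c)\<^sup>2 \<le> (L2_norm \<mu> (synthesis \<mu> ?t c))\<^sup>2 \<and>
      (L2_norm \<mu> (synthesis \<mu> ?t c))\<^sup>2 \<le> D * (ell2_norm c)\<^sup>2"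
    if c: "c \<in> ell2_perp (synthesis_ker \<mu> ?t)" for c
  proof -
    have c2: "c \<in> ell2" using c by (simp add: ell2_perp_def)
    then obtain m where m: "dual.expands c m" by (rule dual.expands_exists)
    note norm = synthesis_norm[OF \<phi> ex[OF c2] m, folded w_def]
    have zero: "AE \<omega> in \<nu>. w \<omega> = 0 \<longrightarrow> m \<omega> = 0"
      unfolding w_def
      by (rule ell2_perp_ker_vanishes[OF \<phi> ex _ c m]) (use w in \<open>auto simp: w_def\<close>)
    have sq: "(ell2_norm c)\<^sup>2 = (LINT \<omega>|\<nu>. (cmod (m \<omega>))\<^sup>2)"
      using dual.expands_norm[OF m] by (simp flip: L2_norm_power2)
    have int: "integrable \<nu> (\<lambda>\<omega>. (cmod (m \<omega>))\<^sup>2)" by (rule L2_integrable[OF dual.expands_L2[OF m]])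
    have ptw: "AE \<omega> in \<nu>. C * (cmod (m \<omega>))\<^sup>2 \<le> w \<omega> * (cmod (m \<omega>))\<^sup>2 \<and>
        w \<omega> * (cmod (m \<omega>))\<^sup>2 \<le> D * (cmod (m \<omega>))\<^sup>2"
      using bounds zero dual.expands_vanishes_outside[OF m]
    proof eventually_elim
      case (elim \<omega>)
      show ?case
      proof (cases "m \<omega> = 0")
        case False
        then have "C \<le> w \<omega> \<and> w \<omega> \<le> D" using elim by blast
        then show ?thesis by (simp add: mult_right_mono)
      qed simp
    qed
    have "(LINT \<omega>|\<nu>. C * (cmod (m \<omega>))\<^sup>2) \<le> (LINT \<omega>|\<nu>. w \<omega> * (cmod (m \<omega>))\<^sup>2)"
      by (rule integral_mono_AE) (use int norm(1) ptw in \<open>auto elim: eventually_mono\<close>)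
    moreover have "(LINT \<omega>|\<nu>. w \<omega> * (cmod (m \<omega>))\<^sup>2) \<le> (LINT \<omega>|\<nu>. D * (cmod (m \<omega>))\<^sup>2)"
      by (rule integral_mono_AE) (use int norm(1) ptw in \<open>auto elim: eventually_mono\<close>)
    ultimately show ?thesis unfolding norm(2) sq by simp
  qed
  then show ?thesis using CD t ex by (simp add: frame_sequence_def)
qed

text \<open>The coefficient sequence of \<open>1\<^sub>E\<close> is orthogonal to the kernel, because functions expanded by
  sequences in the kernel vanish wherever the weight does not, in particular on \<open>E\<close>. So the frame
  inequalities apply to it.\<close>

lemma frame_sequence_indicator:
  assumes \<phi>: "\<phi> \<in> L2 \<mu>"
  defines "w \<equiv> dual.weight (vil_fourier p \<mu> \<nu> \<phi>)"
  assumes frame: "frame_sequence \<mu> (\<lambda>n. vil_translate p (vil_H_enum p n) \<phi>) C D"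
    and E [measurable]: "E \<in> sets \<nu>" and EU: "E \<subseteq> cyl p (\<lambda>_. 0) 0"
    and pos: "\<And>\<omega>. \<omega> \<in> E \<Longrightarrow> w \<omega> \<noteq> 0"
  shows "integrable \<nu> (\<lambda>\<omega>. w \<omega> * indicator E \<omega>)" "integrable \<nu> (indicator E :: _ \<Rightarrow> real)"
    "C * measure \<nu> E \<le> (LINT \<omega>|\<nu>. w \<omega> * indicator E \<omega>)"
    "(LINT \<omega>|\<nu>. w \<omega> * indicator E \<omega>) \<le> D * measure \<nu> E"
proof -
  let ?t = "\<lambda>n. vil_translate p (vil_H_enum p n) \<phi>"
  have "emeasure \<nu> E \<le> emeasure \<nu> (cyl p (\<lambda>_. 0) 0)" using EU by (intro emeasure_mono) auto
  also have "\<dots> < \<infinity>" by simp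
  finally have fin: "emeasure \<nu> E < \<infinity>" .
  then show int: "integrable \<nu> (indicator E :: _ \<Rightarrow> real)" by simp
  have ex: "\<exists>G. L2_sums \<mu> (\<lambda>n x. d n * ?t n x) G" if "d \<in> ell2" for d
    using frame that by (simp add: frame_sequence_def)
  obtain c where c: "dual.expands c (indicator E)"
    using expands_surj[OF L2_indicator[OF E fin]] EU by (auto simp: indicator_def)
  have c2: "c \<in> ell2" by (rule dual.expands_ell2[OF c])
  have "c \<in> ell2_perp (synthesis_ker \<mu> ?t)"
    unfolding ell2_perp_def
  proof (intro CollectI conjI c2 ballI)
    fix d assume d: "d \<in> synthesis_ker \<mu> ?t"
    then have d2: "d \<in> ell2" by (simp add: synthesis_ker_def)
    then obtain k where k: "dual.expands d k" by (rule dual.expands_exists)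
    have "AE \<omega> in \<nu>. w \<omega> = 0 \<or> k \<omega> = 0"
      using iffD1[OF synthesis_ker_iff[OF \<phi> ex[OF d2] k] d] by (simp add: w_def)
    then have "AE \<omega> in \<nu>. indicator E \<omega> = (0::complex) \<or> k \<omega> = 0"
      by eventually_elim (use pos in \<open>auto simp: indicator_def\<close>)
    then show "ell2_inner c d = 0" by (rule dual.expands_orthogonal[OF c k])
  qed
  then have fr: "C * (ell2_norm c)\<^sup>2 \<le> (L2_norm \<mu> (synthesis \<mu> ?t c))\<^sup>2"
    "(L2_norm \<mu> (synthesis \<mu> ?t c))\<^sup>2 \<le> D * (ell2_norm c)\<^sup>2"
    using frame by (auto simp: frame_sequence_def)
  have ind: "(cmod (indicator E \<omega>))\<^sup>2 = indicator E \<omega>" for \<omega> by (simp add: indicator_def)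
  note norm = synthesis_norm[OF \<phi> ex[OF c2] c, folded w_def, unfolded ind]
  have sq: "(ell2_norm c)\<^sup>2 = measure \<nu> E"
  proof -
    have "(ell2_norm c)\<^sup>2 = (LINT \<omega>|\<nu>. (cmod (indicator E \<omega>))\<^sup>2)"
      using dual.expands_norm[OF c] by (simp flip: L2_norm_power2)
    also have "\<dots> = measure \<nu> (E \<inter> space \<nu>)" unfolding ind by simp
    also have "E \<inter> space \<nu> = E" using sets.sets_into_space[OF E] by blast
    finally show ?thesis .
  qed
  show "integrable \<nu> (\<lambda>\<omega>. w \<omega> * indicator E \<omega>)" by (rule norm(1))
  show "C * measure \<nu> E \<le> (LINT \<omega>|\<nu>. w \<omega> * indicator E \<omega>)"
    "(LINT \<omega>|\<nu>. w \<omega> * indicator E \<omega>) \<le> D * measure \<nu> E"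
    using fr unfolding norm(2) sq .
qed

text \<open>On a set where the weight is below \<open>C\<close> but not \<open>0\<close>, or above \<open>D\<close>, the inequalities for the
  indicator bound the integral of a positive function by \<open>0\<close>; so the set is null.\<close>

lemma weight_bounds_if_frame_sequence:
  assumes \<phi>: "\<phi> \<in> L2 \<mu>"
  defines "w \<equiv> dual.weight (vil_fourier p \<mu> \<nu> \<phi>)"
  assumes frame: "frame_sequence \<mu> (\<lambda>n. vil_translate p (vil_H_enum p n) \<phi>) C D"
    and w [measurable]: "w \<in> borel_measurable \<nu>"
  shows "AE \<omega> in \<nu>. \<omega> \<in> cyl p (\<lambda>_. 0) 0 \<longrightarrow> w \<omega> \<noteq> 0 \<longrightarrow> C \<le> w \<omega> \<and> w \<omega> \<le> D"
proof -
  let ?U = "cyl p (\<lambda>_. 0) 0"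
  have C: "0 < C" "C \<le> D" using frame by (auto simp: frame_sequence_def)
  note test = frame_sequence_indicator[OF \<phi> frame, folded w_def]
  have null: "AE \<omega> in \<nu>. f \<omega> * indicator E \<omega> = 0"
    if "integrable \<nu> (\<lambda>\<omega>. f \<omega> * indicator E \<omega>)" "(LINT \<omega>|\<nu>. f \<omega> * indicator E \<omega>) \<le> 0"
      "\<And>\<omega>. \<omega> \<in> E \<Longrightarrow> 0 \<le> f \<omega>" for f :: "digits \<Rightarrow> real" and E
  proof -
    have nn: "0 \<le> f \<omega> * indicator E \<omega>" for \<omega> using that(3) by (simp add: indicator_def)
    then have "0 \<le> (LINT \<omega>|\<nu>. f \<omega> * indicator E \<omega>)" by (intro integral_nonneg_AE) simp
    then have "(LINT \<omega>|\<nu>. f \<omega> * indicator E \<omega>) = 0" using that(2) by linarith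
    then show ?thesis
      using integral_nonneg_eq_0_iff_AE[OF that(1)] nn by simp
  qed
  define E where "E = {\<omega> \<in> space \<nu>. \<omega> \<in> ?U \<and> w \<omega> \<noteq> 0 \<and> w \<omega> < C}"
  define E' where "E' = {\<omega> \<in> space \<nu>. \<omega> \<in> ?U \<and> D < w \<omega>}"
  have [measurable]: "E \<in> sets \<nu>" "E' \<in> sets \<nu>" unfolding E_def E'_def by measurable
  have E: "E \<subseteq> ?U" "\<And>\<omega>. \<omega> \<in> E \<Longrightarrow> w \<omega> \<noteq> 0" by (auto simp: E_def)
  have E': "E' \<subseteq> ?U" "\<And>\<omega>. \<omega> \<in> E' \<Longrightarrow> w \<omega> \<noteq> 0" using C by (auto simp: E'_def)
  have meas: "(LINT \<omega>|\<nu>. indicator A \<omega>) = measure \<nu> A" if "A \<in> sets \<nu>" for A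
    using sets.sets_into_space[OF that] by (simp add: Int_absorb2)
  have "AE \<omega> in \<nu>. (C - w \<omega>) * indicator E \<omega> = 0"
  proof (rule null)
    have eq: "(\<lambda>\<omega>. (C - w \<omega>) * indicator E \<omega>) = (\<lambda>\<omega>. C * indicator E \<omega> - w \<omega> * indicator E \<omega>)"
      by (simp add: left_diff_distrib)
    show "integrable \<nu> (\<lambda>\<omega>. (C - w \<omega>) * indicator E \<omega>)"
      unfolding eq using test(1,2)[OF _ E] by auto
    show "(LINT \<omega>|\<nu>. (C - w \<omega>) * indicator E \<omega>) \<le> 0"
      unfolding eq using test(1-3)[OF _ E] meas[of E] by auto
  qed (auto simp: E_def)
  moreover have "AE \<omega> in \<nu>. (w \<omega> - D) * indicator E' \<omega> = 0"
  proof (rule null)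
    have eq: "(\<lambda>\<omega>. (w \<omega> - D) * indicator E' \<omega>) = (\<lambda>\<omega>. w \<omega> * indicator E' \<omega> - D * indicator E' \<omega>)"
      by (simp add: left_diff_distrib)
    show "integrable \<nu> (\<lambda>\<omega>. (w \<omega> - D) * indicator E' \<omega>)"
      unfolding eq using test(1,2)[OF _ E'] by auto
    show "(LINT \<omega>|\<nu>. (w \<omega> - D) * indicator E' \<omega>) \<le> 0"
      unfolding eq using test(1,2,4)[OF _ E'] meas[of E'] by auto
  qed (auto simp: E'_def)
  ultimately show ?thesis
    using AE_space
    by eventually_elim (auto simp: E_def E'_def indicator_def not_le[symmetric] split: split_of_bool_asm)
qed

end

theorem theorem3p16:
  fixes p :: int and \<mu> \<nu> :: "digits measure" and \<phi> :: "digits \<Rightarrow> complex" and C D :: real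
  assumes "2 \<le> p"
    and "haar_measure p \<mu>"
    and "haar_measure p \<nu>"
    and "\<phi> \<in> L2 \<mu>"
    and "0 < C" and "C \<le> D"
  shows "frame_sequence \<mu> (\<lambda>n. vil_translate p (vil_H_enum p n) \<phi>) C D \<longleftrightarrow>
    (AE \<omega> in \<nu>. \<omega> \<in> vil_nbhd p 0 - bracket_null_set p (vil_fourier p \<mu> \<nu> \<phi>) \<longrightarrow>
       C \<le> Re (vil_bracket p (vil_fourier p \<mu> \<nu> \<phi>) (vil_fourier p \<mu> \<nu> \<phi>) \<omega>) \<and>
       Re (vil_bracket p (vil_fourier p \<mu> \<nu> \<phi>) (vil_fourier p \<mu> \<nu> \<phi>) \<omega>) \<le> D)"
proof -
  interpret vil_dual p \<mu> \<nu>
    using assms by (simp add: vil_dual_def vil_haar_def)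
  let ?w = "dual.weight (vil_fourier p \<mu> \<nu> \<phi>)"
  obtain F where "L2_converges \<nu> (\<lambda>n. vil_fourier_L1 p \<mu> (F n)) (vil_fourier p \<mu> \<nu> \<phi>)"
    using vil_fourier_approx[OF assms(4)] by blast
  then have w: "?w \<in> borel_measurable \<nu>"
    by (auto simp: L2_converges_def intro!: dual.weight_measurable L2_measurable)
  have "frame_sequence \<mu> (\<lambda>n. vil_translate p (vil_H_enum p n) \<phi>) C D \<longleftrightarrow>
      (AE \<omega> in \<nu>. \<omega> \<in> cyl p (\<lambda>_. 0) 0 \<longrightarrow> ?w \<omega> \<noteq> 0 \<longrightarrow> C \<le> ?w \<omega> \<and> ?w \<omega> \<le> D)"
    using frame_sequence_if_weight_bounds[OF assms(4-6) w]
      weight_bounds_if_frame_sequence[OF assms(4) _ w] by blast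
  then show ?thesis
    by (simp add: bracket_null_set_def dual.vil_bracket_eq_weight vil_nbhd_eq_cyl imp_conjL)
qed

end
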